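(* Assume that $1<p<\infty$ and that $X$ is a proper connected metric space equipped with a locally doubling measure $\mu$ supporting a local $p$-Poincaré inequality. The following are equivalent: (i) $X$ is $p$-hyperbolic, i.e. there is a compact set $K$ such that $\mathrm{cap}_p(K,X)>0$, (ii) $\mathrm{cap}_p(E,X)>0$ for some set $E\subset X$ with $C_p(E)>0$, (iii) $\mathrm{cap}_p(E,X)>0$ for every set $E\subset X$ with $C_p(E)>0$, (iv) $\mathrm{cap}_p(X,X)>0$, (v) $\mathrm{cap}_p(X,X)=\infty$.
   Context: $X=(X,d,\mu)$ is a metric space equipped with a positive complete Borel measure $\mu$ with $0<\mu(B)<\infty$ for every ball $B$. Balls are open and come with a fixed centre and radius; $\lambda B(x,r):=B(x,\lambda r)$. $\overline{\mathbf{R}}=[-\infty,\infty]$ and $\chi_A$ is the characteristic function of $A$. Upper gradients. A curve is a nonconstant compact rectifiable curve, parameterized by arc length $ds$. A property holds for $p$-almost every curve if there is a nonnegative $\rho\in L^p(X)$ with $\int_\gamma\rho\,ds=\infty$ for every curve $\gamma$ for which it fails. A measurable $g:X\to[0,\infty]$ is a $p$-weak upper gradient of $f:X\to\overline{\mathbf{R}}$ if for $p$-almost all curves $\gamma:[0,l_\gamma]\to X$, $|f(\gamma(0))-f(\gamma(l_\gamma))|\le\int_\gamma g\,ds$, where the left-hand side is $\infty$ if at least one of the terms is infinite. If $f$ has a $p$-weak upper gradient in $L^p_{\rm loc}(X)$, then $g_f$ denotes its minimal $p$-weak upper gradient ($g_f\le g$ a.e. for every $p$-weak upper gradient $g\in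 L^p_{\rm loc}(X)$ of $f$). $N^{1,p}(X)$ is the space of measurable $f$, defined everywhere with values in $\overline{\mathbf{R}}$, with $\|f\|_{N^{1,p}(X)}^p=\int_X|f|^p\,d\mu+\inf_g\int_X g^p\,d\mu<\infty$, infimum over all $p$-weak upper gradients $g$ of $f$. For measurable $E\subset X$ these notions are defined by regarding $(E,d|_E,\mu|_E)$ as a metric space. The Sobolev capacity is $C_p(E)=\inf\|f\|_{N^{1,p}(X)}^p$ over $f\in N^{1,p}(X)$ with $f\ge1$ on $E$. Doubling and Poincaré. $\mu$ is doubling within an open set $U$ if there is $C>0$ with $\mu(2B)\le C\mu(B)$ for all balls $B\subset U$. The $p$-Poincaré inequality holds within $U$ if there are $C>0$, $\lambda\ge1$ such that for all balls $B\subset U$ with radius $r_B$, all integrable $u$ on $\lambda B$ and all $p$-weak upper gradients $g$ of $u$ in $\lambda B$, $\frac1{\mu(B)}\int_B|u-u_B|\,d\mu\le Cr_B\bigl(\frac1{\mu(\lambda B)}\int_{\lambda B}g^p\,d\mu\bigr)^{1/p}$, where $u_B=\frac1{\mu(B)}\int_B u\,d\mu$. Each property is local if for every $x\in X$ there is $r>0$ such that it holds within $B(x,r)$. $X$ is proper if all closed bounded sets are compact. Condenser capacity. For open $\Omega$ and bounded $E\subset\Omega$, $\mathrm{cap}_p(E,\Omega)=\inf_u\int_\Omega g_u^p\,d\mu$ over $u\in N^{1,p}(X)$ with $\chi_E\le u\le\chi_\Omega$ ($=\infty$ if there is no such $u$); for unbounded $E\subset\Omega$, $\mathrm{cap}_p(E,\Omega)=\lim_{j\to\infty}\mathrm{cap}_p(E\cap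 B(x_0,j),\Omega)$, where $x_0\in X$ is any fixed point (the limit does not depend on it). If $X$ is unbounded, it is $p$-parabolic if $\mathrm{cap}_p(K,X)=0$ for all compact $K\subset X$, and otherwise $p$-hyperbolic (a bounded $X$ is not $p$-hyperbolic). *)

theory Defs
  imports "HOL-Analysis.Analysis"
begin

section \<open>Metric measure spaces\<close>

text \<open>
  A metric space \<open>(E, d|\<^sub>E, \<mu>|\<^sub>E)\<close> with measure is represented by a measure \<open>M\<close> on a type of class
  \<open>metric_space\<close> with \<open>space M = E\<close>. The whole space \<open>X\<close> is the type itself, and a measurable subset
  \<open>E\<close> of it, regarded as a metric space in its own right, is \<open>restrict_space M E\<close>.

  A complete Borel measure is the completion of a measure on the Borel sigma-algebra.
\<close>

definition complete_borel_measure :: "'a::metric_space measure \<Rightarrow> bool" where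
  "complete_borel_measure M \<longleftrightarrow> (\<exists>N. sets N = sets borel \<and> M = completion N)"

definition metric_measure_space :: "'a::metric_space measure \<Rightarrow> bool" where
  "metric_measure_space M \<longleftrightarrow> complete_borel_measure M \<and>
     (\<forall>x r. 0 < r \<longrightarrow> 0 < emeasure M (ball x r) \<and> emeasure M (ball x r) < \<infinity>)"

text \<open>Real powers of extended nonnegative numbers, used for positive exponents only.\<close>

definition ennpow :: "ennreal \<Rightarrow> real \<Rightarrow> ennreal" where
  "ennpow a p = (if a = \<infinity> then \<infinity> else ennreal (enn2real a powr p))"


section \<open>Curves\<close>

definition curve_length :: "(real \<Rightarrow> 'a::metric_space) \<Rightarrow> real \<Rightarrow> real \<Rightarrow> ennreal" where
  "curve_length \<gamma> a b =
     (SUP (n, t) \<in> {(n, t :: nat \<Rightarrow> real). mono_on {..n} t \<and> t ` {..n} \<subseteq> {a..b}}.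
        \<Sum>i<n. ennreal (dist (\<gamma> (t i)) (\<gamma> (t (Suc i)))))"

text \<open>
  Arc length parameterized curves \<open>\<gamma> : [0,l] \<rightarrow> S\<close>. The last condition makes \<open>\<gamma>\<close> 1-Lipschitz,
  hence continuous, on \<open>[0,l]\<close>, and together with \<open>0 < l\<close> it makes \<open>\<gamma>\<close> nonconstant. The values of
  \<open>\<gamma>\<close> outside \<open>[0,l]\<close> play no role.
\<close>

definition arc_length_curve :: "'a::metric_space set \<Rightarrow> (real \<Rightarrow> 'a) \<Rightarrow> real \<Rightarrow> bool" where
  "arc_length_curve S \<gamma> l \<longleftrightarrow> 0 < l \<and> \<gamma> ` {0..l} \<subseteq> S \<and>
     (\<forall>s t. 0 \<le> s \<and> s \<le> t \<and> t \<le> l \<longrightarrow> curve_length \<gamma> s t = ennreal (t - s))"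

text \<open>
  If \<open>\<rho>\<close> is only \<open>\<mu>\<close>-measurable, then \<open>\<rho> \<circ> \<gamma>\<close> may fail to be measurable, and the following is a lower
  integral. This happens only for a family of curves that is exceptional in the sense below
  (as \<open>\<rho>\<close> agrees with a Borel function outside a Borel null set), so it has no influence on
  the notions based on it.
\<close>

definition curve_integral :: "('a \<Rightarrow> ennreal) \<Rightarrow> (real \<Rightarrow> 'a) \<Rightarrow> real \<Rightarrow> ennreal" where
  "curve_integral \<rho> \<gamma> l = (\<integral>\<^sup>+t\<in>{0..l}. \<rho> (\<gamma> t) \<partial>lebesgue)"

definition almost_every_curve ::
  "real \<Rightarrow> 'a::metric_space measure \<Rightarrow> ((real \<Rightarrow> 'a) \<Rightarrow> real \<Rightarrow> bool) \<Rightarrow> bool" where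
  "almost_every_curve p M P \<longleftrightarrow>
     (\<exists>\<rho> \<in> borel_measurable M. (\<integral>\<^sup>+x. ennpow (\<rho> x) p \<partial>M) < \<infinity> \<and>
        (\<forall>\<gamma> l. arc_length_curve (space M) \<gamma> l \<and> \<not> P \<gamma> l \<longrightarrow> curve_integral \<rho> \<gamma> l = \<infinity>))"


section \<open>Upper gradients and Sobolev functions\<close>

definition weak_upper_gradient ::
  "real \<Rightarrow> 'a::metric_space measure \<Rightarrow> ('a \<Rightarrow> ereal) \<Rightarrow> ('a \<Rightarrow> ennreal) \<Rightarrow> bool" where
  "weak_upper_gradient p M f g \<longleftrightarrow> g \<in> borel_measurable M \<and>
     almost_every_curve p M (\<lambda>\<gamma> l.
       (if \<bar>f (\<gamma> 0)\<bar> = \<infinity> \<or> \<bar>f (\<gamma> l)\<bar> = \<infinity> then \<infinity> else e2ennreal \<bar>f (\<gamma> 0) - f (\<gamma> l)\<bar>)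
         \<le> curve_integral g \<gamma> l)"

definition Lp_loc :: "real \<Rightarrow> 'a::metric_space measure \<Rightarrow> ('a \<Rightarrow> ennreal) set" where
  "Lp_loc p M = {g \<in> borel_measurable M.
     \<forall>x\<in>space M. \<exists>r>0. (\<integral>\<^sup>+y\<in>ball x r. ennpow (g y) p \<partial>M) < \<infinity>}"

definition is_minimal_weak_upper_gradient ::
  "real \<Rightarrow> 'a::metric_space measure \<Rightarrow> ('a \<Rightarrow> ereal) \<Rightarrow> ('a \<Rightarrow> ennreal) \<Rightarrow> bool" where
  "is_minimal_weak_upper_gradient p M f g \<longleftrightarrow> weak_upper_gradient p M f g \<and> g \<in> Lp_loc p M \<and>
     (\<forall>g' \<in> Lp_loc p M. weak_upper_gradient p M f g' \<longrightarrow> (AE x in M. g x \<le> g' x))"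

text \<open>The minimal \<open>p\<close>-weak upper gradient \<open>g\<^sub>f\<close>, which is unique up to sets of measure zero.\<close>

definition minimal_weak_upper_gradient ::
  "real \<Rightarrow> 'a::metric_space measure \<Rightarrow> ('a \<Rightarrow> ereal) \<Rightarrow> 'a \<Rightarrow> ennreal" where
  "minimal_weak_upper_gradient p M f = (SOME g. is_minimal_weak_upper_gradient p M f g)"

text \<open>The \<open>p\<close>-th power of the norm of \<open>N\<^sup>1\<^sup>,\<^sup>p\<close>.\<close>

definition sobolev_norm_pow ::
  "real \<Rightarrow> 'a::metric_space measure \<Rightarrow> ('a \<Rightarrow> ereal) \<Rightarrow> ennreal" where
  "sobolev_norm_pow p M f = (\<integral>\<^sup>+x. ennpow (e2ennreal \<bar>f x\<bar>) p \<partial>M) +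
     (INF g \<in> {g. weak_upper_gradient p M f g}. \<integral>\<^sup>+x. ennpow (g x) p \<partial>M)"

definition sobolev_space :: "real \<Rightarrow> 'a::metric_space measure \<Rightarrow> ('a \<Rightarrow> ereal) set" where
  "sobolev_space p M = {f \<in> borel_measurable M. sobolev_norm_pow p M f < \<infinity>}"

definition sobolev_capacity :: "real \<Rightarrow> 'a::metric_space measure \<Rightarrow> 'a set \<Rightarrow> ennreal" where
  "sobolev_capacity p M E =
     (INF f \<in> {f \<in> sobolev_space p M. \<forall>x\<in>E. 1 \<le> f x}. sobolev_norm_pow p M f)"


section \<open>Local doubling and local Poincare inequality\<close>

definition doubling_within :: "'a::metric_space measure \<Rightarrow> 'a set \<Rightarrow> bool" where
  "doubling_within M U \<longleftrightarrow>
     (\<exists>C::real. 0 < C \<and> (\<forall>x r. 0 < r \<and> ball x r \<subseteq> U \<longrightarrow>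
        emeasure M (ball x (2 * r)) \<le> ennreal C * emeasure M (ball x r)))"

definition locally_doubling :: "'a::metric_space measure \<Rightarrow> bool" where
  "locally_doubling M \<longleftrightarrow> (\<forall>x. \<exists>r>0. doubling_within M (ball x r))"

definition mean_value :: "'a measure \<Rightarrow> 'a set \<Rightarrow> ('a \<Rightarrow> ereal) \<Rightarrow> real" where
  "mean_value M B u = (LINT x:B|M. real_of_ereal (u x)) / measure M B"

text \<open>
  Integrable functions may take the values \<open>\<plusminus>\<infinity>\<close> (necessarily on a null set, which is why
  \<open>real_of_ereal\<close> is harmless above).
\<close>

definition poincare_within :: "real \<Rightarrow> 'a::metric_space measure \<Rightarrow> 'a set \<Rightarrow> bool" where
  "poincare_within p M U \<longleftrightarrow>
     (\<exists>(C::real) (\<tau>::real). 0 < C \<and> 1 \<le> \<tau> \<and>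
       (\<forall>x r u g. 0 < r \<and> ball x r \<subseteq> U \<and>
          u \<in> borel_measurable (restrict_space M (ball x (\<tau> * r))) \<and>
          (\<integral>\<^sup>+y\<in>ball x (\<tau> * r). e2ennreal \<bar>u y\<bar> \<partial>M) < \<infinity> \<and>
          weak_upper_gradient p (restrict_space M (ball x (\<tau> * r))) u g \<longrightarrow>
          (\<integral>\<^sup>+y\<in>ball x r. e2ennreal \<bar>u y - ereal (mean_value M (ball x r) u)\<bar> \<partial>M)
              / emeasure M (ball x r)
            \<le> ennreal (C * r) *
              ennpow ((\<integral>\<^sup>+y\<in>ball x (\<tau> * r). ennpow (g y) p \<partial>M)
                        / emeasure M (ball x (\<tau> * r))) (1 / p)))"

definition locally_poincare :: "real \<Rightarrow> 'a::metric_space measure \<Rightarrow> bool" where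
  "locally_poincare p M \<longleftrightarrow> (\<forall>x. \<exists>r>0. poincare_within p M (ball x r))"


section \<open>Condenser capacity and hyperbolicity\<close>

definition bounded_condenser_capacity ::
  "real \<Rightarrow> 'a::metric_space measure \<Rightarrow> 'a set \<Rightarrow> 'a set \<Rightarrow> ennreal" where
  "bounded_condenser_capacity p M E \<Omega> =
     (INF u \<in> {u \<in> sobolev_space p M. \<forall>x. indicator E x \<le> u x \<and> u x \<le> indicator \<Omega> x}.
        \<integral>\<^sup>+x\<in>\<Omega>. ennpow (minimal_weak_upper_gradient p M u x) p \<partial>M)"

text \<open>For unbounded \<open>E\<close> this is the limit along balls, whose centre is immaterial.\<close>

definition condenser_capacity ::
  "real \<Rightarrow> 'a::metric_space measure \<Rightarrow> 'a set \<Rightarrow> 'a set \<Rightarrow> ennreal" where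
  "condenser_capacity p M E \<Omega> =
     (if bounded E then bounded_condenser_capacity p M E \<Omega>
      else (THE c. \<forall>x\<^sub>0.
        (\<lambda>j::nat. bounded_condenser_capacity p M (E \<inter> ball x\<^sub>0 (real j)) \<Omega>) \<longlonglongrightarrow> c))"

definition p_parabolic :: "real \<Rightarrow> 'a::metric_space measure \<Rightarrow> bool" where
  "p_parabolic p M \<longleftrightarrow> \<not> bounded (UNIV :: 'a set) \<and>
     (\<forall>K. compact K \<longrightarrow> condenser_capacity p M K UNIV = 0)"

definition p_hyperbolic :: "real \<Rightarrow> 'a::metric_space measure \<Rightarrow> bool" where
  "p_hyperbolic p M \<longleftrightarrow> \<not> bounded (UNIV :: 'a set) \<and> \<not> p_parabolic p M"

end

(*
  The implication from (i) to (iii) goes by contraposition. If cap_p(E,X) = 0, there are u_k with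
  values in [0,1], u_k = 1 on larger and larger parts of E, and energy tending to 0. By the local
  Poincare inequality and connectedness a subsequence converges in L^1 on balls to a constant c.
  If c = 1, truncations of the form min(1, max(2 u_k, eta)) with a cutoff eta show that compact sets
  have zero condenser capacity; if c < 1, truncations of u_k above a level between c and 1 show that
  C_p(E) = 0. Taking minima and maxima instead of products, one gets by with estimates on short pieces
  of curves, on which a function with integrable upper gradient oscillates little.

  For (v), suppose that the capacities of all balls are at most I < oo. Average a nearly optimal
  function for a ball with one for a much larger ball: the second gradient vanishes on
  the large ball, and the first is small off it, so the energy of the average is about 2^(-p) (I + I)
  at most. As p > 1, this forces I = 0.

  The definition of the capacity requires minimal weak upper gradients to exist; they are limits of
  decreasing minimizing sequences, since the minimum of two weak upper gradients is again one.
*)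

theory Submission
  imports Defs
begin

section \<open>Real powers\<close>

text \<open>Two obstacles shape the proof. Along a curve only Borel gradients can be integrated
  reliably, whereas the definitions ask for measurability with respect to the completed measure; so
  gradients are first replaced by larger Borel functions of the same energy. And Sobolev functions
  are defined everywhere but need not be continuous; hence all arguments on curves use only the
  inequality between end points, on every subinterval, and no derivative or Leibniz rule occurs. The
  cutoff is 1-Lipschitz, so it costs at most the length of the piece of curve on which it varies.
  Truncating \<open>u_k\<close> confines this cost to points where \<open>u_k\<close> is away from
  its limit \<open>c\<close>, and L^1 convergence on balls makes the measure of that set small;
  neither L^p nor pointwise convergence is required. Two levels are used, since the gap between them
  leaves room for the oscillation of \<open>u_k\<close> along a short piece. A bounded X is never
  hyperbolic by definition; this agrees with the other conditions because the constant 1 then has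
  finite norm and all condenser capacities vanish.\<close>

lemma ennpow_top [simp]: "ennpow \<infinity> p = \<infinity>"
  by (simp add: ennpow_def)

lemma ennpow_top' [simp]: "ennpow top p = top"
  by (simp add: ennpow_def)

lemma ennpow_ennreal: "0 \<le> x \<Longrightarrow> ennpow (ennreal x) p = ennreal (x powr p)"
  by (simp add: ennpow_def)

lemma ennpow_0 [simp]: "ennpow 0 p = 0"
  by (simp add: ennpow_def)

lemma ennpow_1 [simp]: "ennpow 1 p = 1"
  by (simp add: ennpow_def)

lemma ennpow_indicator: "ennpow (indicator A x) p = indicator A x"
  by (simp add: indicator_def)

lemma ennpow_indicator_mult: "ennpow (f x * indicator A x) p = ennpow (f x) p * indicator A x"
  by (simp add: indicator_def)

lemma ennpow_mono: "0 \<le> p \<Longrightarrow> a \<le> b \<Longrightarrow> ennpow a p \<le> ennpow b p"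
  by (cases a; cases b) (auto simp: ennpow_ennreal powr_mono2 top_unique)

lemma ennpow_strict_mono: "0 < p \<Longrightarrow> a < b \<Longrightarrow> ennpow a p < ennpow b p"
  by (cases a; cases b) (auto simp: ennpow_ennreal powr_less_mono2 ennreal_less_iff)

lemma ennpow_ennpow: "0 < p \<Longrightarrow> 0 < q \<Longrightarrow> ennpow (ennpow a p) q = ennpow a (p * q)"
  by (cases a) (auto simp: ennpow_ennreal powr_powr)

lemma ennpow_one [simp]: "ennpow a 1 = a"
  by (cases a) (auto simp: ennpow_ennreal)

lemma ennpow_cmult:
  assumes "0 < c"
  shows "ennpow (ennreal c * a) p = ennreal (c powr p) * ennpow a p"
proof (cases a)
  case (real r)
  then show ?thesis
    using assms by (simp add: ennpow_ennreal powr_mult flip: ennreal_mult)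
next
  case top
  then show ?thesis
    using assms by (simp add: ennreal_mult_top)
qed

lemma borel_measurable_ennpow [measurable (raw)]:
  "f \<in> borel_measurable M \<Longrightarrow> (\<lambda>x. ennpow (f x) p) \<in> borel_measurable M"
proof -
  assume f [measurable]: "f \<in> borel_measurable M"
  have [measurable]: "Measurable.pred M (\<lambda>x. f x = \<infinity>)"
    by (simp add: pred_def)
  show ?thesis unfolding ennpow_def by measurable
qed

text \<open>Either \<open>x \<le> s * y\<close> or \<open>y \<le> x / s\<close>, so the sum is at
  most a multiple of one of its terms. The parameter lets the factor of \<open>y\<close> come close
  to 1 at the expense of \<open>x\<close>, as the averaging argument requires; \<open>s = 1\<close>
  gives the usual \<open>2 powr p\<close>.\<close>

lemma ennpow_add_le:
  assumes "0 < p" "0 < s"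
  shows "ennpow (x + y) p \<le> ennreal ((1 + 1 / s) powr p) * ennpow x p + ennreal ((1 + s) powr p) * ennpow y p"
proof -
  have "x + y \<le> ennreal (1 + 1 / s) * x \<or> x + y \<le> ennreal (1 + s) * y"
  proof (cases "x \<le> ennreal s * y")
    case True
    have "x + y \<le> ennreal s * y + ennreal 1 * y"
      using True by (simp add: add_right_mono)
    also have "\<dots> = ennreal (1 + s) * y"
      using assms by (simp add: add.commute distrib_right[symmetric] ennreal_plus[symmetric] del: ennreal_plus ennreal_1)
    finally show ?thesis by blast
  next
    case False
    then have "ennreal (1 / s) * (ennreal s * y) \<le> ennreal (1 / s) * x"
      by (intro mult_left_mono) auto
    then have "y \<le> ennreal (1 / s) * x"
      using assms by (simp add: mult.assoc[symmetric] flip: ennreal_mult)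
    then have "x + y \<le> ennreal 1 * x + ennreal (1 / s) * x"
      by (simp add: add_left_mono)
    also have "\<dots> = ennreal (1 + 1 / s) * x"
      using assms by (simp add: distrib_right[symmetric] ennreal_plus[symmetric] del: ennreal_plus ennreal_1)
    finally show ?thesis by blast
  qed
  then show ?thesis
  proof
    assume "x + y \<le> ennreal (1 + 1 / s) * x"
    then have "ennpow (x + y) p \<le> ennpow (ennreal (1 + 1 / s) * x) p"
      using assms by (intro ennpow_mono) auto
    also have "\<dots> = ennreal ((1 + 1 / s) powr p) * ennpow x p"
      using assms by (intro ennpow_cmult) (simp add: add_pos_pos)
    finally show ?thesis by (simp add: add_increasing2)
  next
    assume "x + y \<le> ennreal (1 + s) * y"
    then have "ennpow (x + y) p \<le> ennpow (ennreal (1 + s) * y) p"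
      using assms by (intro ennpow_mono) auto
    also have "\<dots> = ennreal ((1 + s) powr p) * ennpow y p"
      using assms by (intro ennpow_cmult) (simp add: add_pos_pos)
    finally show ?thesis by (simp add: add_increasing)
  qed
qed

text \<open>Each \<open>f j\<close> is at most the \<open>(1 / p)\<close>-th power of the right-hand
  side. This is why sequences are combined by suprema below: the energy of a supremum is at most the
  sum of the energies.\<close>

lemma ennpow_SUP_le:
  assumes "0 < p"
  shows "ennpow (SUP j. f j) p \<le> (\<Sum>j. ennpow (f j) p)"
proof -
  let ?S = "\<Sum>j. ennpow (f j) p"
  have "f j \<le> ennpow ?S (1 / p)" for j
  proof -
    have "ennpow (f j) p \<le> ?S"
      using sum_le_suminf[of "\<lambda>j. ennpow (f j) p" "{j}"] by simp
    then have "ennpow (ennpow (f j) p) (1 / p) \<le> ennpow ?S (1 / p)"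
      using assms by (intro ennpow_mono) auto
    then show ?thesis using assms by (simp add: ennpow_ennpow)
  qed
  then have "ennpow (SUP j. f j) p \<le> ennpow (ennpow ?S (1 / p)) p"
    using assms by (intro ennpow_mono SUP_least) auto
  then show ?thesis using assms by (simp add: ennpow_ennpow)
qed

section \<open>Curves\<close>

text \<open>Both sides are lower integrals, which agree for arbitrary integrands.\<close>

lemma curve_integral_lborel: "curve_integral \<rho> \<gamma> l = (\<integral>\<^sup>+t\<in>{0..l}. \<rho> (\<gamma> t) \<partial>lborel)"
  unfolding curve_integral_def by (rule nn_integral_completion)

lemma curve_integral_mono: "(\<And>x. \<rho> x \<le> \<sigma> x) \<Longrightarrow> curve_integral \<rho> \<gamma> l \<le> curve_integral \<sigma> \<gamma> l"
  unfolding curve_integral_def by (intro nn_integral_mono mult_right_mono) auto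

lemma arc_length_curve_dist_le:
  assumes "arc_length_curve S \<gamma> l" "0 \<le> s" "s \<le> t" "t \<le> l"
  shows "dist (\<gamma> s) (\<gamma> t) \<le> t - s"
proof -
  let ?t = "\<lambda>i::nat. if i = 0 then s else t"
  have "(1::nat, ?t :: nat \<Rightarrow> real) \<in> {(n, \<tau>). mono_on {..n} \<tau> \<and> \<tau> ` {..n} \<subseteq> {s..t}}"
    using assms by (auto simp: mono_on_def)
  then have "(\<Sum>i<(1::nat). ennreal (dist (\<gamma> (?t i)) (\<gamma> (?t (Suc i))))) \<le> curve_length \<gamma> s t"
    unfolding curve_length_def
    by (rule SUP_upper2) simp
  also have "\<dots> = ennreal (t - s)"
    using assms by (auto simp: arc_length_curve_def)
  finally show ?thesis
    using assms by simp
qed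

lemma arc_length_curve_lipschitz:
  assumes "arc_length_curve S \<gamma> l" "s \<in> {0..l}" "t \<in> {0..l}"
  shows "dist (\<gamma> s) (\<gamma> t) \<le> \<bar>s - t\<bar>"
  using arc_length_curve_dist_le[OF assms(1), of s t] arc_length_curve_dist_le[OF assms(1), of t s] assms
  by (cases "s \<le> t") (auto simp: dist_commute)

lemma continuous_on_arc_length_curve:
  assumes "arc_length_curve S \<gamma> l"
  shows "continuous_on {0..l} \<gamma>"
  unfolding continuous_on_iff
  using arc_length_curve_lipschitz[OF assms] by (metis dist_commute dist_real_def le_less_trans)

lemma curve_length_shift_le: "curve_length (\<lambda>t. \<gamma> (a + t)) s t \<le> curve_length \<gamma> (a + s) (a + t)"
  unfolding curve_length_def
proof (rule SUP_least, clarify)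
  fix n :: nat and \<tau> :: "nat \<Rightarrow> real"
  assume "mono_on {..n} \<tau>" "\<tau> ` {..n} \<subseteq> {s..t}"
  then have "(n, \<lambda>i. a + \<tau> i) \<in> {(n, \<tau>). mono_on {..n} \<tau> \<and> \<tau> ` {..n} \<subseteq> {a + s..a + t}}"
    by (auto simp: mono_on_def)
  then show "(\<Sum>i<n. ennreal (dist (\<gamma> (a + \<tau> i)) (\<gamma> (a + \<tau> (Suc i)))))
    \<le> (SUP (n, t)\<in>{(n, \<tau>). mono_on {..n} \<tau> \<and> \<tau> ` {..n} \<subseteq> {a + s..a + t}}.
          \<Sum>i<n. ennreal (dist (\<gamma> (t i)) (\<gamma> (t (Suc i)))))"
    by (rule SUP_upper2) simp
qed

lemma curve_length_shift: "curve_length (\<lambda>t. \<gamma> (a + t)) s t = curve_length \<gamma> (a + s) (a + t)"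
  using curve_length_shift_le[of \<gamma> a s t] curve_length_shift_le[of "\<lambda>t. \<gamma> (a + t)" "- a" "a + s" "a + t"]
  by simp

lemma arc_length_curve_subcurve:
  assumes "arc_length_curve S \<gamma> l" "0 \<le> a" "a < b" "b \<le> l"
  shows "arc_length_curve S (\<lambda>t. \<gamma> (a + t)) (b - a)"
  using assms unfolding arc_length_curve_def by (force simp: curve_length_shift)

lemma borel_measurable_arc_length_curve:
  fixes \<rho> :: "'a::metric_space \<Rightarrow> ennreal"
  assumes \<gamma>: "arc_length_curve S \<gamma> l" and \<rho>: "\<rho> \<in> borel_measurable borel"
  shows "(\<lambda>t. \<rho> (\<gamma> t) * indicator {0..l} t) \<in> borel_measurable borel"
proof -
  have l: "0 < l" using \<gamma> by (simp add: arc_length_curve_def)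
  \<comment> \<open>Outside \<open>[0,l]\<close> the values of the curve are arbitrary. Clamping the
    parameter gives a continuous map on the whole line that agrees with the curve on
    \<open>[0,l]\<close>.\<close>
  have "continuous_on UNIV (\<lambda>t. \<gamma> (max 0 (min l t)))"
    using l by (intro continuous_on_compose2[OF continuous_on_arc_length_curve[OF \<gamma>]] continuous_intros) auto
  then have "(\<lambda>t. \<gamma> (max 0 (min l t))) \<in> borel_measurable borel"
    by (rule borel_measurable_continuous_onI)
  from measurable_compose[OF this \<rho>]
  have "(\<lambda>t. \<rho> (\<gamma> (max 0 (min l t))) * indicator {0..l} t) \<in> borel_measurable borel"
    by measurable
  also have "(\<lambda>t. \<rho> (\<gamma> (max 0 (min l t))) * indicator {0..l} t) = (\<lambda>t. \<rho> (\<gamma> t) * indicator {0..l} t)"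
    by (auto simp: fun_eq_iff indicator_def)
  finally show ?thesis .
qed

lemma nn_integral_subcurve:
  fixes \<rho> :: "'a::metric_space \<Rightarrow> ennreal"
  assumes \<gamma>: "arc_length_curve S \<gamma> l" and \<rho>: "\<rho> \<in> borel_measurable borel"
    and ab: "0 \<le> a" "a < b" "b \<le> l"
  shows "curve_integral \<rho> (\<lambda>t. \<gamma> (a + t)) (b - a) = (\<integral>\<^sup>+t\<in>{a..b}. \<rho> (\<gamma> t) \<partial>lborel)"
proof -
  have "(\<lambda>t. \<rho> (\<gamma> t) * indicator {0..l} t * indicator {a..b} t) \<in> borel_measurable borel"
    using borel_measurable_arc_length_curve[OF \<gamma> \<rho>] by measurable
  also have "(\<lambda>t. \<rho> (\<gamma> t) * indicator {0..l} t * indicator {a..b} t) = (\<lambda>t. \<rho> (\<gamma> t) * indicator {a..b} t)"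
    using ab by (auto simp: fun_eq_iff indicator_def)
  finally have "(\<integral>\<^sup>+t\<in>{a..b}. \<rho> (\<gamma> t) \<partial>lborel)
      = (\<integral>\<^sup>+t. \<rho> (\<gamma> (a + t)) * indicator {a..b} (a + t) \<partial>lborel)"
    using nn_integral_real_affine[of "\<lambda>t. \<rho> (\<gamma> t) * indicator {a..b} t" 1 a] by simp
  also have "\<dots> = curve_integral \<rho> (\<lambda>t. \<gamma> (a + t)) (b - a)"
    unfolding curve_integral_lborel by (intro nn_integral_cong) (auto simp: indicator_def)
  finally show ?thesis ..
qed

section \<open>Estimates on intervals\<close>

text \<open>Cut the interval into pieces shorter than \<open>\<delta>\<close> and add up by the
  triangle inequality; neighbouring closed pieces share one point, a null set. \<open>\<phi>\<close>
  is an arbitrary function, since it will be a Sobolev function along a curve.\<close>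

lemma chain_estimate:
  fixes \<phi> :: "real \<Rightarrow> real" and h :: "real \<Rightarrow> ennreal"
  assumes h [measurable]: "h \<in> borel_measurable borel" and ab: "a \<le> b" and \<delta>: "0 < \<delta>"
    and loc: "\<And>s t. a \<le> s \<Longrightarrow> s \<le> t \<Longrightarrow> t \<le> b \<Longrightarrow> t - s < \<delta> \<Longrightarrow>
      ennreal \<bar>\<phi> s - \<phi> t\<bar> \<le> (\<integral>\<^sup>+x\<in>{s..t}. h x \<partial>lborel)"
  shows "ennreal \<bar>\<phi> a - \<phi> b\<bar> \<le> (\<integral>\<^sup>+x\<in>{a..b}. h x \<partial>lborel)"
proof -
  obtain n :: nat where n: "(b - a) / \<delta> < n" "0 < n"
    by (metis reals_Archimedean2 less_trans of_nat_0_less_iff of_nat_less_0_iff linorder_neqE_nat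
        not_less_iff_gr_or_eq zero_less_Suc of_nat_less_iff lessI)
  define \<tau> where "\<tau> i = a + i * ((b - a) / n)" for i :: nat
  have step: "\<tau> (Suc i) - \<tau> i = (b - a) / n" for i
    by (simp add: \<tau>_def distrib_right add_divide_distrib)
  have small: "(b - a) / n < \<delta>"
    using n \<delta> by (simp add: field_simps)
  have mono: "\<tau> i \<le> \<tau> (Suc i)" for i
    using step[of i] ab n by (smt (verit) divide_nonneg_nonneg of_nat_0_le_iff)
  have a_le: "a \<le> \<tau> i" for i
    using ab by (simp add: \<tau>_def)
  have le_b: "\<tau> i \<le> b" if "i \<le> n" for i
  proof -
    have "i * ((b - a) / n) \<le> n * ((b - a) / n)"
      using that ab by (intro mult_right_mono) auto
    then show ?thesis using n by (simp add: \<tau>_def)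
  qed
  have "ennreal \<bar>\<phi> a - \<phi> (\<tau> i)\<bar> \<le> (\<integral>\<^sup>+x\<in>{a..\<tau> i}. h x \<partial>lborel)" if "i \<le> n" for i
    using that
  proof (induction i)
    case 0
    then show ?case by (simp add: \<tau>_def)
  next
    case (Suc i)
    have "ennreal \<bar>\<phi> a - \<phi> (\<tau> (Suc i))\<bar> \<le> ennreal (\<bar>\<phi> a - \<phi> (\<tau> i)\<bar> + \<bar>\<phi> (\<tau> i) - \<phi> (\<tau> (Suc i))\<bar>)"
      by (intro ennreal_leI) auto
    also have "\<dots> = ennreal \<bar>\<phi> a - \<phi> (\<tau> i)\<bar> + ennreal \<bar>\<phi> (\<tau> i) - \<phi> (\<tau> (Suc i))\<bar>"
      by simp
    also have "\<dots> \<le> (\<integral>\<^sup>+x\<in>{a..\<tau> i}. h x \<partial>lborel) + (\<integral>\<^sup>+x\<in>{\<tau> i..\<tau> (Suc i)}. h x \<partial>lborel)"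
      using Suc a_le mono le_b step small by (intro add_mono[OF _ loc]) auto
    also have "\<dots> = (\<integral>\<^sup>+x. h x * indicator {a..\<tau> i} x + h x * indicator {\<tau> i..\<tau> (Suc i)} x \<partial>lborel)"
      by (rule nn_integral_add[symmetric]) auto
    also have "\<dots> = (\<integral>\<^sup>+x\<in>{a..\<tau> (Suc i)}. h x \<partial>lborel)"
    proof (rule nn_integral_cong_AE)
      show "AE x in lborel. h x * indicator {a..\<tau> i} x + h x * indicator {\<tau> i..\<tau> (Suc i)} x
          = h x * indicator {a..\<tau> (Suc i)} x"
        using AE_lborel_singleton[of "\<tau> i"]
      proof eventually_elim
        case (elim x)
        then show ?case using a_le[of i] mono[of i] by (auto simp: indicator_def)
      qed
    qed
    finally show ?case .
  qed
  from this[of n] show ?thesis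
    using n by (simp add: \<tau>_def)
qed

text \<open>Absolute continuity of the integral: \<open>h\<close> splits into a part bounded by
  \<open>N\<close>, which contributes at most \<open>N\<close> times the length, and a remainder of
  total integral at most \<open>e / 2\<close>.\<close>

lemma small_interval_integral:
  fixes h :: "real \<Rightarrow> ennreal"
  assumes h [measurable]: "h \<in> borel_measurable borel"
    and fin: "(\<integral>\<^sup>+x\<in>{a..b}. h x \<partial>lborel) < \<infinity>" and e: "0 < e"
  shows "\<exists>\<delta>>0. \<forall>s t. a \<le> s \<longrightarrow> s \<le> t \<longrightarrow> t \<le> b \<longrightarrow> t - s < \<delta> \<longrightarrow> (\<integral>\<^sup>+x\<in>{s..t}. h x \<partial>lborel) \<le> ennreal e"
proof -
  define k where "k N x = min (h x) (of_nat N) * indicator {a..b} x" for N :: nat and x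
  have k [measurable]: "k N \<in> borel_measurable borel" for N
    unfolding k_def by measurable
  have "(SUP N. k N x) = h x * indicator {a..b} x" for x
  proof (cases "x \<in> {a..b}")
    case True
    have "(SUP N. min (h x) (of_nat N)) = min (h x) (SUP N. of_nat N)"
      using inf_SUP[of "h x" "\<lambda>N. of_nat N :: ennreal" UNIV] by (simp add: inf_min)
    then show ?thesis using True by (simp add: k_def ennreal_SUP_of_nat_eq_top)
  qed (simp add: k_def)
  moreover have "incseq k"
    unfolding incseq_def le_fun_def k_def by (intro allI impI mult_right_mono min.mono of_nat_mono) auto
  ultimately have sup: "(\<integral>\<^sup>+x\<in>{a..b}. h x \<partial>lborel) = (SUP N. \<integral>\<^sup>+x. k N x \<partial>lborel)"
    using nn_integral_monotone_convergence_SUP[of k lborel] by simp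
  obtain N where N: "(\<integral>\<^sup>+x\<in>{a..b}. h x \<partial>lborel) < (\<integral>\<^sup>+x. k N x \<partial>lborel) + ennreal (e / 2)"
    using SUP_approx_ennreal[OF _ _ sup, of "e / 2"] e fin by (auto simp: less_top)
  define r where "r x = h x * indicator {a..b} x - k N x" for x
  have [measurable]: "r \<in> borel_measurable borel"
    unfolding r_def by measurable
  have k_le: "k N x \<le> h x * indicator {a..b} x" for x
    by (auto simp: k_def indicator_def)
  have fin_k: "(\<integral>\<^sup>+x. k N x \<partial>lborel) < \<infinity>"
    using nn_integral_mono[of lborel "k N" "\<lambda>x. h x * indicator {a..b} x"] k_le fin by (auto intro: le_less_trans)
  have "(\<integral>\<^sup>+x. r x \<partial>lborel) = (\<integral>\<^sup>+x\<in>{a..b}. h x \<partial>lborel) - (\<integral>\<^sup>+x. k N x \<partial>lborel)"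
    unfolding r_def using fin_k k_le by (intro nn_integral_diff) auto
  also have "\<dots> \<le> ennreal (e / 2)"
    using N fin_k by (intro ennreal_minus_le_iff[THEN iffD2]) auto
  finally have r: "(\<integral>\<^sup>+x. r x \<partial>lborel) \<le> ennreal (e / 2)" .
  \<comment> \<open>The bounded part contributes at most \<open>e / 2\<close> on an interval this
    short; \<open>N + 1\<close> keeps the divisor positive.\<close>
  define \<delta> where "\<delta> = e / (2 * (real N + 1))"
  have "(\<integral>\<^sup>+x\<in>{s..t}. h x \<partial>lborel) \<le> ennreal e"
    if st: "a \<le> s" "s \<le> t" "t \<le> b" "t - s < \<delta>" for s t
  proof -
    have "h x * indicator {s..t} x \<le> of_nat N * indicator {s..t} x + r x" for x
    proof (cases "x \<in> {s..t}")
      case True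
      have "h x \<le> min (h x) (of_nat N) + (h x - min (h x) (of_nat N))"
        by (subst add_diff_inverse_ennreal) auto
      also have "\<dots> \<le> of_nat N + (h x - min (h x) (of_nat N))"
        by (intro add_right_mono) auto
      finally show ?thesis
        using True st by (simp add: r_def k_def)
    qed simp
    then have "(\<integral>\<^sup>+x\<in>{s..t}. h x \<partial>lborel) \<le> (\<integral>\<^sup>+x. of_nat N * indicator {s..t} x + r x \<partial>lborel)"
      by (rule nn_integral_mono)
    also have "\<dots> = of_nat N * ennreal (t - s) + (\<integral>\<^sup>+x. r x \<partial>lborel)"
      using st by (simp add: nn_integral_add nn_integral_cmult_indicator)
    also have "\<dots> \<le> ennreal (e / 2) + ennreal (e / 2)"
    proof (intro add_mono r)
      have "real N * (t - s) \<le> (real N + 1) * \<delta>"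
        using st e by (intro mult_mono) (auto simp: \<delta>_def)
      also have "\<dots> = e / 2" using e by (simp add: \<delta>_def field_simps)
      finally show "of_nat N * ennreal (t - s) \<le> ennreal (e / 2)"
        using st by (simp add: ennreal_of_nat_eq_real_of_nat ennreal_mult[symmetric] ennreal_leI)
    qed
    also have "\<dots> = ennreal e" using e by (simp flip: ennreal_plus)
    finally show ?thesis .
  qed
  moreover have "0 < \<delta>" using e by (simp add: \<delta>_def)
  ultimately show ?thesis by blast
qed

lemma finite_borel_measure_compact_approx:
  fixes \<nu> :: "real measure"
  assumes "sets \<nu> = sets borel" "emeasure \<nu> (space \<nu>) \<noteq> \<infinity>" "F \<in> sets borel" "0 < e"
  obtains K where "K \<subseteq> F" "compact K" "emeasure \<nu> (F - K) \<le> ennreal e"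
proof -
  have eq: "emeasure \<nu> F = (SUP K \<in> {K. K \<subseteq> F \<and> compact K}. emeasure \<nu> K)"
    by (rule inner_regular) (use assms in auto)
  interpret finite_measure \<nu> by standard (use assms in auto)
  obtain K where K: "K \<subseteq> F" "compact K" "emeasure \<nu> F < emeasure \<nu> K + ennreal e"
    using SUP_approx_ennreal[OF assms(4) _ eq] compact_empty by (simp del: compact_empty) blast
  have "K \<in> sets \<nu>" using K assms by (simp add: compact_imp_closed)
  then have "emeasure \<nu> (F - K) = emeasure \<nu> F - emeasure \<nu> K"
    using K assms by (intro emeasure_Diff) auto
  also have "\<dots> \<le> ennreal e"
    using K by (intro ennreal_minus_le_iff[THEN iffD2]) auto
  finally show ?thesis using that K by blast
qed

text \<open>
  Up to a small error the interval is covered by disjoint compact sets on which the minimum is the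
  first, respectively the second, function. A short interval meets at most one of them.
\<close>

lemma min_estimate:
  fixes \<phi> :: "real \<Rightarrow> real" and h h' :: "real \<Rightarrow> ennreal"
  assumes h [measurable]: "h \<in> borel_measurable borel" "h' \<in> borel_measurable borel" and ab: "a \<le> b"
    and fin: "(\<integral>\<^sup>+x\<in>{a..b}. h x \<partial>lborel) < \<infinity>" "(\<integral>\<^sup>+x\<in>{a..b}. h' x \<partial>lborel) < \<infinity>"
    and est: "\<And>s t. a \<le> s \<Longrightarrow> s \<le> t \<Longrightarrow> t \<le> b \<Longrightarrow> ennreal \<bar>\<phi> s - \<phi> t\<bar> \<le> (\<integral>\<^sup>+x\<in>{s..t}. h x \<partial>lborel)"
      "\<And>s t. a \<le> s \<Longrightarrow> s \<le> t \<Longrightarrow> t \<le> b \<Longrightarrow> ennreal \<bar>\<phi> s - \<phi> t\<bar> \<le> (\<integral>\<^sup>+x\<in>{s..t}. h' x \<partial>lborel)"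
  shows "ennreal \<bar>\<phi> a - \<phi> b\<bar> \<le> (\<integral>\<^sup>+x\<in>{a..b}. min (h x) (h' x) \<partial>lborel)"
proof (rule ennreal_le_epsilon)
  fix e :: real assume e: "0 < e"
  \<comment> \<open>One finite measure carries both integrals, so that inner regularity applies and
    a single error bound serves for \<open>h\<close> and \<open>h'\<close>.\<close>
  define \<nu> where "\<nu> = density lborel (\<lambda>x. (h x + h' x) * indicator {a..b} x)"
  define F where "F = {x. h x \<le> h' x}"
  have sets_\<nu>: "sets \<nu> = sets borel" by (simp add: \<nu>_def)
  have F [measurable]: "F \<in> sets borel" unfolding F_def by measurable
  have "(\<integral>\<^sup>+x. (h x + h' x) * indicator {a..b} x \<partial>lborel)
      = (\<integral>\<^sup>+x. h x * indicator {a..b} x + h' x * indicator {a..b} x \<partial>lborel)"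
    by (simp add: distrib_right)
  also have "\<dots> = (\<integral>\<^sup>+x\<in>{a..b}. h x \<partial>lborel) + (\<integral>\<^sup>+x\<in>{a..b}. h' x \<partial>lborel)"
    by (rule nn_integral_add) auto
  finally have "emeasure \<nu> (space \<nu>) \<noteq> \<infinity>"
    using fin by (simp add: \<nu>_def emeasure_density less_top)
  note approx = finite_borel_measure_compact_approx[OF sets_\<nu> this]
  obtain A where A: "A \<subseteq> F" "compact A" "emeasure \<nu> (F - A) \<le> ennreal (e / 2)"
    using approx[of F "e / 2"] e F by auto
  obtain B where B: "B \<subseteq> - F" "compact B" "emeasure \<nu> (- F - B) \<le> ennreal (e / 2)"
    using approx[of "- F" "e / 2"] e F by auto
  have [measurable]: "A \<in> sets borel" "B \<in> sets borel"
    using A B by (auto intro: compact_imp_closed borel_closed)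
  have "A \<inter> B = {}" using A B by auto
  then obtain \<delta> where \<delta>: "0 < \<delta>" "\<And>x y. x \<in> A \<Longrightarrow> y \<in> B \<Longrightarrow> \<delta> \<le> dist x y"
    using separate_compact_closed[OF A(2) compact_imp_closed[OF B(2)]] by metis
  \<comment> \<open>\<open>G\<close> is the minimum on \<open>A \<union> B\<close> and at least
    \<open>h + h'\<close> elsewhere, so it dominates \<open>h\<close> off \<open>B\<close> and
    \<open>h'\<close> off \<open>A\<close>.\<close>
  define G where "G x = min (h x) (h' x) + (h x + h' x) * indicator (- (A \<union> B)) x" for x
  have [measurable]: "G \<in> borel_measurable borel" unfolding G_def by measurable
  have "ennreal \<bar>\<phi> a - \<phi> b\<bar> \<le> (\<integral>\<^sup>+x\<in>{a..b}. G x \<partial>lborel)"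
  proof (rule chain_estimate[OF _ ab \<delta>(1)])
    fix s t assume st: "a \<le> s" "s \<le> t" "t \<le> b" "t - s < \<delta>"
    consider "{s..t} \<inter> B = {}" | "{s..t} \<inter> A = {}"
    proof (cases "{s..t} \<inter> B = {} \<or> {s..t} \<inter> A = {}")
      case False
      then obtain x y where xy: "x \<in> A" "y \<in> B" "x \<in> {s..t}" "y \<in> {s..t}"
        by (meson disjoint_iff)
      then have "dist x y < \<delta>" using st by (auto simp: dist_real_def)
      then show ?thesis using \<delta>(2)[of x y] xy by auto
    qed (use that in blast)
    then show "ennreal \<bar>\<phi> s - \<phi> t\<bar> \<le> (\<integral>\<^sup>+x\<in>{s..t}. G x \<partial>lborel)"
    proof cases
      case 1
      have "h x * indicator {s..t} x \<le> G x * indicator {s..t} x" for x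
        using 1 A unfolding G_def F_def
        by (cases "x \<in> A") (auto simp: indicator_def min_def add_increasing add_increasing2)
      then show ?thesis using est(1)[OF st(1-3)] by (meson nn_integral_mono order_trans)
    next
      case 2
      have "h' x * indicator {s..t} x \<le> G x * indicator {s..t} x" for x
        using 2 B unfolding G_def F_def
        by (cases "x \<in> B") (auto simp: indicator_def min_def add_increasing add_increasing2)
      then show ?thesis using est(2)[OF st(1-3)] by (meson nn_integral_mono order_trans)
    qed
  qed simp
  also have "\<dots> = (\<integral>\<^sup>+x. min (h x) (h' x) * indicator {a..b} x
      + (h x + h' x) * indicator {a..b} x * indicator (- (A \<union> B)) x \<partial>lborel)"
    by (intro nn_integral_cong) (auto simp: G_def indicator_def)
  also have "\<dots> = (\<integral>\<^sup>+x\<in>{a..b}. min (h x) (h' x) \<partial>lborel) + emeasure \<nu> (- (A \<union> B))"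
    unfolding \<nu>_def by (subst nn_integral_add) (auto simp: emeasure_density)
  also have "emeasure \<nu> (- (A \<union> B)) \<le> emeasure \<nu> ((F - A) \<union> (- F - B))"
    using sets_\<nu> by (intro emeasure_mono) auto
  also have "\<dots> \<le> emeasure \<nu> (F - A) + emeasure \<nu> (- F - B)"
    by (rule emeasure_subadditive) (auto simp: sets_\<nu>)
  also have "\<dots> \<le> ennreal (e / 2) + ennreal (e / 2)"
    using A B by (intro add_mono)
  also have "\<dots> = ennreal e" using e by (simp flip: ennreal_plus)
  finally show "ennreal \<bar>\<phi> a - \<phi> b\<bar> \<le> (\<integral>\<^sup>+x\<in>{a..b}. min (h x) (h' x) \<partial>lborel) + ennreal e"
    by (simp add: add_left_mono)
qed

section \<open>Weak upper gradients\<close>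

text \<open>For Borel \<open>g\<close> with finite integral over the curve this says that
  \<open>u\<close> is absolutely continuous along it, with derivative bounded by \<open>g\<close>
  almost everywhere. Having all subintervals at once is what makes local arguments possible.\<close>

definition segment_upper_gradient ::
  "('a \<Rightarrow> real) \<Rightarrow> ('a \<Rightarrow> ennreal) \<Rightarrow> (real \<Rightarrow> 'a) \<Rightarrow> real \<Rightarrow> bool" where
  "segment_upper_gradient u g \<gamma> l \<longleftrightarrow>
     (\<forall>a b. 0 \<le> a \<longrightarrow> a \<le> b \<longrightarrow> b \<le> l \<longrightarrow> ennreal \<bar>u (\<gamma> a) - u (\<gamma> b)\<bar> \<le> (\<integral>\<^sup>+t\<in>{a..b}. g (\<gamma> t) \<partial>lborel))"

lemma suminf_geometric_ennreal:
  assumes "0 \<le> e"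
  shows "(\<Sum>i. ennreal (e * (1 / 2) ^ Suc i)) = ennreal e"
proof -
  have *: "(\<lambda>i. e * (1 / 2) ^ Suc i) sums (e * 1)"
    by (intro sums_mult power_half_series)
  have "(\<Sum>i. ennreal (e * (1 / 2) ^ Suc i)) = ennreal (\<Sum>i. e * (1 / 2) ^ Suc i)"
    using assms by (intro suminf_ennreal2 sums_summable[OF *]) simp
  also have "(\<Sum>i. e * (1 / 2) ^ Suc i) = e"
    using sums_unique[OF *] by (simp del: power_Suc)
  finally show ?thesis .
qed

section \<open>Completed Borel measures and Borel replacements\<close>

locale metric_measure =
  fixes p :: real and M :: "'a::metric_space measure"
  assumes p_gt_1: "1 < p"
    and mms: "metric_measure_space M"
begin

lemma p_pos [simp]: "0 < p" "0 \<le> p" "p \<noteq> 0"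
  using p_gt_1 by auto

lemma complete_borel_measureE:
  obtains N where "sets N = sets borel" "M = completion N"
  using mms unfolding metric_measure_space_def complete_borel_measure_def by blast

lemma space_M [simp]: "space M = UNIV"
  by (rule complete_borel_measureE) (metis space_borel space_completion sets_eq_imp_space_eq)

lemma sets_M: "A \<in> sets borel \<Longrightarrow> A \<in> sets M"
  by (rule complete_borel_measureE) (auto simp: sets_completionI_sets)

lemma measurable_M: "f \<in> measurable borel N \<Longrightarrow> f \<in> measurable M N"
  using sets_M by (auto simp: measurable_def)

lemma sets_ball [measurable, simp]: "ball x r \<in> sets M"
  by (simp add: sets_M)

lemma emeasure_ball_less_top: "emeasure M (ball x r) < \<infinity>"
  using mms unfolding metric_measure_space_def by (cases "0 < r") (auto simp: ball_empty)

lemma emeasure_ball_pos: "0 < r \<Longrightarrow> 0 < emeasure M (ball x r)"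
  using mms unfolding metric_measure_space_def by auto

text \<open>\<open>g\<close> agrees with a Borel function off a Borel null set, on which the value
  \<open>\<infinity>\<close> is taken instead. Equality almost everywhere alone would not do: a null
  set can carry curves, and only an increase is certain to preserve the upper gradient
  inequality.\<close>

lemma borel_majorant:
  fixes g :: "'a \<Rightarrow> ennreal"
  assumes "g \<in> borel_measurable M"
  obtains g' where "g' \<in> borel_measurable borel" "\<And>x. g x \<le> g' x" "AE x in M. g x = g' x"
proof (rule complete_borel_measureE)
  fix N assume N: "sets N = sets borel" "M = completion N"
  obtain f where f: "f \<in> borel_measurable N" "AE x in N. g x = f x"
    using completion_ex_borel_measurable[of g N] assms unfolding N(2) by blast
  from AE_E[OF f(2)] obtain Z where Z: "{x \<in> space N. \<not> g x = f x} \<subseteq> Z" "emeasure N Z = 0" "Z \<in> sets N"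
    by blast
  define g' where "g' x = (if x \<in> Z then \<infinity> else f x)" for x
  have sp: "space N = UNIV" using N(1) by (metis space_borel sets_eq_imp_space_eq)
  have "g' \<in> borel_measurable N"
    using f Z unfolding g'_def by measurable
  then have "g' \<in> borel_measurable borel"
    using N(1) by (metis measurable_cong_sets)
  moreover have eq: "g x = f x" if "x \<notin> Z" for x
    using Z(1) sp that by blast
  then have "g x \<le> g' x" for x
    by (simp add: g'_def)
  moreover have "AE x in N. x \<notin> Z"
    using Z by (intro AE_not_in) auto
  then have "AE x in N. g x = g' x"
    using f(2) by eventually_elim (auto simp: g'_def)
  then have "AE x in M. g x = g' x"
    unfolding N(2) by (rule AE_completion)
  ultimately show ?thesis using that by blast
qed

text \<open>Meant for sets whose indicator enters a gradient, which has to be Borel. The null part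
  of \<open>S\<close> is enlarged to a Borel null set.\<close>

lemma borel_outer_approx:
  assumes "S \<in> sets M"
  obtains S' where "S' \<in> sets borel" "S \<subseteq> S'" "emeasure M S' = emeasure M S"
proof (rule complete_borel_measureE)
  fix N assume N: "sets N = sets borel" "M = completion N"
  obtain A B Z where *: "S = A \<union> B" "B \<subseteq> Z" "Z \<in> null_sets N" "A \<in> sets N"
    using sets_completionE assms N by metis
  have Z: "Z \<in> null_sets M"
    using * N by (simp add: null_sets_completionI)
  have "A \<union> Z = S \<union> Z" using * by auto
  then have "emeasure M (A \<union> Z) = emeasure M S"
    using emeasure_Un_null_set[OF assms Z] by simp
  moreover have "A \<union> Z \<in> sets borel" using * N by auto
  ultimately show ?thesis using that[of "A \<union> Z"] * by auto
qed

section \<open>Calculus of almost every curve\<close>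

abbreviation "aec \<equiv> almost_every_curve p M"

lemma aec_iff:
  "aec P \<longleftrightarrow> (\<exists>\<rho>\<in>borel_measurable M. (\<integral>\<^sup>+x. ennpow (\<rho> x) p \<partial>M) < \<infinity> \<and>
    (\<forall>\<gamma> l. arc_length_curve UNIV \<gamma> l \<longrightarrow> curve_integral \<rho> \<gamma> l < \<infinity> \<longrightarrow> P \<gamma> l))"
  unfolding almost_every_curve_def space_M infinity_ennreal_def less_top[symmetric] by metis

lemma aecI:
  assumes "\<rho> \<in> borel_measurable M" "(\<integral>\<^sup>+x. ennpow (\<rho> x) p \<partial>M) < \<infinity>"
    and "\<And>\<gamma> l. arc_length_curve UNIV \<gamma> l \<Longrightarrow> curve_integral \<rho> \<gamma> l < \<infinity> \<Longrightarrow> P \<gamma> l"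
  shows "aec P"
  unfolding aec_iff using assms by blast

text \<open>Passing to a Borel majorant keeps the energy and only enlarges the family of curves with
  infinite integral.\<close>

lemma aecE:
  assumes "aec P"
  obtains \<rho> where "\<rho> \<in> borel_measurable borel" "(\<integral>\<^sup>+x. ennpow (\<rho> x) p \<partial>M) < \<infinity>"
    "\<And>\<gamma> l. arc_length_curve UNIV \<gamma> l \<Longrightarrow> curve_integral \<rho> \<gamma> l < \<infinity> \<Longrightarrow> P \<gamma> l"
proof -
  obtain \<sigma> where \<sigma>: "\<sigma> \<in> borel_measurable M" "(\<integral>\<^sup>+x. ennpow (\<sigma> x) p \<partial>M) < \<infinity>"
    "\<And>\<gamma> l. arc_length_curve UNIV \<gamma> l \<Longrightarrow> curve_integral \<sigma> \<gamma> l < \<infinity> \<Longrightarrow> P \<gamma> l"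
    using assms unfolding aec_iff by blast
  obtain \<rho> where \<rho>: "\<rho> \<in> borel_measurable borel" "\<And>x. \<sigma> x \<le> \<rho> x" "AE x in M. \<sigma> x = \<rho> x"
    using borel_majorant[OF \<sigma>(1)] by metis
  have "(\<integral>\<^sup>+x. ennpow (\<rho> x) p \<partial>M) = (\<integral>\<^sup>+x. ennpow (\<sigma> x) p \<partial>M)"
    using \<rho>(3) by (intro nn_integral_cong_AE) auto
  moreover have "P \<gamma> l" if "arc_length_curve UNIV \<gamma> l" "curve_integral \<rho> \<gamma> l < \<infinity>" for \<gamma> l
    using \<sigma>(3)[OF that(1)] that(2) curve_integral_mono[of \<sigma> \<rho> \<gamma> l] \<rho>(2) by (simp add: le_less_trans)
  ultimately show ?thesis using that \<rho>(1) \<sigma>(2) by simp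
qed

lemma aec_mono:
  assumes "aec P" "\<And>\<gamma> l. arc_length_curve UNIV \<gamma> l \<Longrightarrow> P \<gamma> l \<Longrightarrow> Q \<gamma> l"
  shows "aec Q"
  using assms(1) unfolding aec_iff using assms(2) by meson

text \<open>Countable unions of exceptional families are exceptional. A weighted supremum of the
  \<open>\<rho> i\<close> has finite energy, and since all weights are positive, its integral is
  infinite along any curve where that of some \<open>\<rho> i\<close> is.\<close>

lemma aec_all:
  assumes "\<And>i::nat. aec (P i)"
  shows "aec (\<lambda>\<gamma> l. \<forall>i. P i \<gamma> l)"
proof -
  have "\<exists>\<rho>. \<rho> \<in> borel_measurable borel \<and> (\<integral>\<^sup>+x. ennpow (\<rho> x) p \<partial>M) < \<infinity> \<and>
      (\<forall>\<gamma> l. arc_length_curve UNIV \<gamma> l \<longrightarrow> curve_integral \<rho> \<gamma> l < \<infinity> \<longrightarrow> P i \<gamma> l)" for i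
    using aecE[OF assms[of i]] by metis
  then obtain \<rho> where \<rho> [measurable]: "\<And>i. \<rho> i \<in> borel_measurable borel"
    and fin: "\<And>i. (\<integral>\<^sup>+x. ennpow (\<rho> i x) p \<partial>M) < \<infinity>"
    and P: "\<And>i \<gamma> l. arc_length_curve UNIV \<gamma> l \<Longrightarrow> curve_integral (\<rho> i) \<gamma> l < \<infinity> \<Longrightarrow> P i \<gamma> l"
    by metis
  define A where "A i = enn2real (\<integral>\<^sup>+x. ennpow (\<rho> i x) p \<partial>M)" for i
  have A: "(\<integral>\<^sup>+x. ennpow (\<rho> i x) p \<partial>M) = ennreal (A i)" "0 \<le> A i" for i
    using fin[of i] by (auto simp: A_def)
  \<comment> \<open>These weights bring the i-th energy down to at most
    \<open>(1 / 2) ^ Suc i\<close>; the divisor \<open>1 + A i\<close> is positive even if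
    \<open>A i\<close> vanishes.\<close>
  define c where "c i = ((1 / 2) ^ Suc i / (1 + A i)) powr (1 / p)" for i
  have c: "0 < c i" "c i powr p = (1 / 2) ^ Suc i / (1 + A i)" for i
    using A(2)[of i] by (auto simp: c_def powr_powr)
  have cA: "c i powr p * A i \<le> 1 * (1 / 2) ^ Suc i" for i
    using A(2)[of i] by (simp add: c divide_simps)
  define \<sigma> where "\<sigma> x = (SUP i. ennreal (c i) * \<rho> i x)" for x
  have \<sigma> [measurable]: "\<sigma> \<in> borel_measurable borel"
    unfolding \<sigma>_def by measurable
  have [measurable]: "\<rho> i \<in> borel_measurable M" for i
    by (rule measurable_M) simp
  have "(\<integral>\<^sup>+x. ennpow (\<sigma> x) p \<partial>M) \<le> (\<integral>\<^sup>+x. (\<Sum>i. ennpow (ennreal (c i) * \<rho> i x) p) \<partial>M)"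
    unfolding \<sigma>_def by (intro nn_integral_mono ennpow_SUP_le) simp
  also have "\<dots> = (\<Sum>i. \<integral>\<^sup>+x. ennpow (ennreal (c i) * \<rho> i x) p \<partial>M)"
    by (rule nn_integral_suminf) measurable
  also have "\<dots> = (\<Sum>i. ennreal (c i powr p) * ennreal (A i))"
    by (simp add: ennpow_cmult c nn_integral_cmult flip: A)
  also have "\<dots> \<le> (\<Sum>i. ennreal (1 * (1 / 2) ^ Suc i))"
    using cA A(2) by (intro suminf_le) (auto simp: ennreal_mult[symmetric] simp del: power_Suc intro!: ennreal_leI)
  also have "\<dots> < \<infinity>" by (subst suminf_geometric_ennreal) auto
  finally have fin_\<sigma>: "(\<integral>\<^sup>+x. ennpow (\<sigma> x) p \<partial>M) < \<infinity>" .
  show ?thesis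
  proof (rule aecI[OF _ fin_\<sigma>])
    show "\<sigma> \<in> borel_measurable M" by (rule measurable_M) simp
    fix \<gamma> l assume \<gamma>: "arc_length_curve UNIV \<gamma> l" and "curve_integral \<sigma> \<gamma> l < \<infinity>"
    have "P i \<gamma> l" for i
    proof (rule P[OF \<gamma>])
      have "ennreal (c i) * curve_integral (\<rho> i) \<gamma> l
          = (\<integral>\<^sup>+t. ennreal (c i) * (\<rho> i (\<gamma> t) * indicator {0..l} t) \<partial>lborel)"
        unfolding curve_integral_lborel
        using borel_measurable_arc_length_curve[OF \<gamma> \<rho>] by (simp add: nn_integral_cmult)
      also have "\<dots> = curve_integral (\<lambda>x. ennreal (c i) * \<rho> i x) \<gamma> l"
        by (simp add: curve_integral_lborel mult.assoc)
      also have "\<dots> \<le> curve_integral \<sigma> \<gamma> l"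
        unfolding \<sigma>_def by (intro curve_integral_mono SUP_upper) simp
      also have "\<dots> < \<infinity>" by fact
      finally show "curve_integral (\<rho> i) \<gamma> l < \<infinity>"
        using c(1)[of i] by (auto simp: ennreal_mult_less_top)
    qed
    then show "\<forall>i. P i \<gamma> l" ..
  qed
qed

lemma aec_conj:
  assumes "aec P" "aec Q"
  shows "aec (\<lambda>\<gamma> l. P \<gamma> l \<and> Q \<gamma> l)"
proof -
  have "aec (\<lambda>\<gamma> l. if i = 0 then P \<gamma> l else Q \<gamma> l)" for i :: nat
    using assms by (cases "i = 0") auto
  from aec_all[OF this] show ?thesis
  proof (rule aec_mono)
    fix \<gamma> l assume "\<forall>i::nat. if i = 0 then P \<gamma> l else Q \<gamma> l"
    from spec[OF this, of 0] spec[OF this, of 1] show "P \<gamma> l \<and> Q \<gamma> l" by simp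
  qed
qed

text \<open>The same \<open>\<rho>\<close> works, since its integral over a subcurve is at most that
  over the curve.\<close>

lemma aec_subcurves:
  assumes "aec P"
  shows "aec (\<lambda>\<gamma> l. \<forall>a b. 0 \<le> a \<longrightarrow> a < b \<longrightarrow> b \<le> l \<longrightarrow> P (\<lambda>t. \<gamma> (a + t)) (b - a))"
proof (rule aecE[OF assms])
  fix \<rho> :: "'a \<Rightarrow> ennreal"
  assume \<rho>: "\<rho> \<in> borel_measurable borel" "(\<integral>\<^sup>+x. ennpow (\<rho> x) p \<partial>M) < \<infinity>"
    and P: "\<And>\<gamma> l. arc_length_curve UNIV \<gamma> l \<Longrightarrow> curve_integral \<rho> \<gamma> l < \<infinity> \<Longrightarrow> P \<gamma> l"
  show ?thesis
  proof (rule aecI[OF measurable_M[OF \<rho>(1)] \<rho>(2)], intro allI impI)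
    fix \<gamma> l a b
    assume \<gamma>: "arc_length_curve UNIV \<gamma> l" "curve_integral \<rho> \<gamma> l < \<infinity>" and ab: "0 \<le> a" "a < b" "b \<le> l"
    have "curve_integral \<rho> (\<lambda>t. \<gamma> (a + t)) (b - a) = (\<integral>\<^sup>+t\<in>{a..b}. \<rho> (\<gamma> t) \<partial>lborel)"
      by (rule nn_integral_subcurve[OF \<gamma>(1) \<rho>(1) ab])
    also have "\<dots> \<le> curve_integral \<rho> \<gamma> l"
      unfolding curve_integral_lborel using ab by (intro nn_integral_mono) (auto simp: indicator_def)
    also note \<gamma>(2)
    finally show "P (\<lambda>t. \<gamma> (a + t)) (b - a)"
      using arc_length_curve_subcurve[OF \<gamma>(1) ab] by (intro P) auto
  qed
qed

lemma aec_curve_integral_finite: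
  "g \<in> borel_measurable M \<Longrightarrow> (\<integral>\<^sup>+x. ennpow (g x) p \<partial>M) < \<infinity> \<Longrightarrow> aec (\<lambda>\<gamma> l. curve_integral g \<gamma> l < \<infinity>)"
  by (rule aecI)

section \<open>Weak upper gradients of real-valued functions\<close>

lemma weak_upper_gradient_real:
  "weak_upper_gradient p M (\<lambda>x. ereal (u x)) g \<longleftrightarrow> g \<in> borel_measurable M \<and>
    aec (\<lambda>\<gamma> l. ennreal \<bar>u (\<gamma> 0) - u (\<gamma> l)\<bar> \<le> curve_integral g \<gamma> l)"
  unfolding weak_upper_gradient_def by (simp add: ereal_minus(1) flip: ennreal.abs_eq)

lemma weak_upper_gradient_mono:
  assumes "weak_upper_gradient p M (\<lambda>x. ereal (u x)) g" "\<And>x. g x \<le> g' x" "g' \<in> borel_measurable M"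
  shows "weak_upper_gradient p M (\<lambda>x. ereal (u x)) g'"
proof -
  have "aec (\<lambda>\<gamma> l. ennreal \<bar>u (\<gamma> 0) - u (\<gamma> l)\<bar> \<le> curve_integral g \<gamma> l)"
    using assms by (simp add: weak_upper_gradient_real)
  then have "aec (\<lambda>\<gamma> l. ennreal \<bar>u (\<gamma> 0) - u (\<gamma> l)\<bar> \<le> curve_integral g' \<gamma> l)"
    by (rule aec_mono) (rule order_trans[OF _ curve_integral_mono[OF assms(2)]])
  then show ?thesis using assms by (simp add: weak_upper_gradient_real)
qed

text \<open>The curves with a bad subcurve form an exceptional family too. Hence on almost every
  curve the inequality holds between any two parameters simultaneously, and not only between the end
  points.\<close>

lemma weak_upper_gradient_segment:
  assumes g: "g \<in> borel_measurable borel"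
  shows "weak_upper_gradient p M (\<lambda>x. ereal (u x)) g \<longleftrightarrow> aec (segment_upper_gradient u g)"
proof
  assume "weak_upper_gradient p M (\<lambda>x. ereal (u x)) g"
  then have "aec (\<lambda>\<gamma> l. ennreal \<bar>u (\<gamma> 0) - u (\<gamma> l)\<bar> \<le> curve_integral g \<gamma> l)"
    by (simp add: weak_upper_gradient_real)
  from aec_subcurves[OF this] show "aec (segment_upper_gradient u g)"
  proof (rule aec_mono)
    fix \<gamma> l assume \<gamma>: "arc_length_curve UNIV \<gamma> l"
      and *: "\<forall>a b. 0 \<le> a \<longrightarrow> a < b \<longrightarrow> b \<le> l \<longrightarrow>
        ennreal \<bar>u (\<gamma> (a + 0)) - u (\<gamma> (a + (b - a)))\<bar> \<le> curve_integral g (\<lambda>t. \<gamma> (a + t)) (b - a)"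
    show "segment_upper_gradient u g \<gamma> l"
      unfolding segment_upper_gradient_def
    proof (intro allI impI)
      fix a b assume "0 \<le> a" "a \<le> b" "b \<le> l"
      then show "ennreal \<bar>u (\<gamma> a) - u (\<gamma> b)\<bar> \<le> (\<integral>\<^sup>+t\<in>{a..b}. g (\<gamma> t) \<partial>lborel)"
        \<comment> \<open>A degenerate interval carries no curve, so \<open>a = b\<close> is a case
          of its own.\<close>
        using *[rule_format, of a b] nn_integral_subcurve[OF \<gamma> g, of a b] by (cases "a = b") auto
    qed
  qed
next
  assume "aec (segment_upper_gradient u g)"
  then have "aec (\<lambda>\<gamma> l. ennreal \<bar>u (\<gamma> 0) - u (\<gamma> l)\<bar> \<le> curve_integral g \<gamma> l)"
    by (rule aec_mono) (simp add: segment_upper_gradient_def curve_integral_lborel arc_length_curve_def)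
  then show "weak_upper_gradient p M (\<lambda>x. ereal (u x)) g"
    using g by (simp add: weak_upper_gradient_real measurable_M)
qed

text \<open>Lets a gradient be verified on short pieces. How short may depend on the curve, as it
  does when absolute continuity of an integral along the curve is invoked.\<close>

lemma weak_upper_gradient_localI:
  assumes G: "G \<in> borel_measurable borel"
    and "aec P"
    and loc: "\<And>\<gamma> l. arc_length_curve UNIV \<gamma> l \<Longrightarrow> P \<gamma> l \<Longrightarrow> \<exists>\<delta>>0. \<forall>s t. 0 \<le> s \<longrightarrow> s \<le> t \<longrightarrow> t \<le> l \<longrightarrow> t - s < \<delta> \<longrightarrow>
      ennreal \<bar>u (\<gamma> s) - u (\<gamma> t)\<bar> \<le> (\<integral>\<^sup>+x\<in>{s..t}. G (\<gamma> x) \<partial>lborel)"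
  shows "weak_upper_gradient p M (\<lambda>x. ereal (u x)) G"
  unfolding weak_upper_gradient_real
proof (intro conjI measurable_M[OF G] aec_mono[OF \<open>aec P\<close>])
  fix \<gamma> l assume \<gamma>: "arc_length_curve UNIV \<gamma> l" and "P \<gamma> l"
  from loc[OF this] obtain \<delta> where \<delta>: "0 < \<delta>" "\<And>s t. 0 \<le> s \<Longrightarrow> s \<le> t \<Longrightarrow> t \<le> l \<Longrightarrow> t - s < \<delta> \<Longrightarrow>
      ennreal \<bar>u (\<gamma> s) - u (\<gamma> t)\<bar> \<le> (\<integral>\<^sup>+x\<in>{s..t}. G (\<gamma> x) \<partial>lborel)"
    by auto
  have "ennreal \<bar>u (\<gamma> 0) - u (\<gamma> l)\<bar> \<le> (\<integral>\<^sup>+x\<in>{0..l}. G (\<gamma> x) * indicator {0..l} x \<partial>lborel)"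
  proof (rule chain_estimate[where \<phi> = "\<lambda>t. u (\<gamma> t)", OF borel_measurable_arc_length_curve[OF \<gamma> G] _ \<delta>(1)])
    fix s t assume st: "0 \<le> s" "s \<le> t" "t \<le> l" "t - s < \<delta>"
    have "(\<integral>\<^sup>+x\<in>{s..t}. G (\<gamma> x) \<partial>lborel) = (\<integral>\<^sup>+x\<in>{s..t}. G (\<gamma> x) * indicator {0..l} x \<partial>lborel)"
      using st by (intro nn_integral_cong) (auto simp: indicator_def)
    then show "ennreal \<bar>u (\<gamma> s) - u (\<gamma> t)\<bar> \<le> (\<integral>\<^sup>+x\<in>{s..t}. G (\<gamma> x) * indicator {0..l} x \<partial>lborel)"
      using \<delta>(2)[OF st] by simp
  qed (use \<gamma> in \<open>simp add: arc_length_curve_def\<close>)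
  also have "\<dots> = curve_integral G \<gamma> l"
    unfolding curve_integral_lborel by (intro nn_integral_cong) (auto simp: indicator_def)
  finally show "ennreal \<bar>u (\<gamma> 0) - u (\<gamma> l)\<bar> \<le> curve_integral G \<gamma> l" .
qed

text \<open>Almost every curve satisfies both inequalities on all subintervals with both integrals
  finite, which is the setting of \<open>min_estimate\<close>. Finiteness is asked along curves and
  not of the energies, so that gradients that are only in \<open>Lp_loc\<close> are covered.\<close>

lemma weak_upper_gradient_min:
  assumes g: "g \<in> borel_measurable borel" "weak_upper_gradient p M (\<lambda>x. ereal (u x)) g"
      "aec (\<lambda>\<gamma> l. curve_integral g \<gamma> l < \<infinity>)"
    and g': "g' \<in> borel_measurable borel" "weak_upper_gradient p M (\<lambda>x. ereal (u x)) g'"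
      "aec (\<lambda>\<gamma> l. curve_integral g' \<gamma> l < \<infinity>)"
  shows "weak_upper_gradient p M (\<lambda>x. ereal (u x)) (\<lambda>x. min (g x) (g' x))"
proof -
  have "aec (\<lambda>\<gamma> l. (segment_upper_gradient u g \<gamma> l \<and> segment_upper_gradient u g' \<gamma> l) \<and>
      (curve_integral g \<gamma> l < \<infinity> \<and> curve_integral g' \<gamma> l < \<infinity>))"
    using assms by (intro aec_conj) (auto simp: weak_upper_gradient_segment)
  then have "aec (\<lambda>\<gamma> l. ennreal \<bar>u (\<gamma> 0) - u (\<gamma> l)\<bar> \<le> curve_integral (\<lambda>x. min (g x) (g' x)) \<gamma> l)"
  proof (rule aec_mono, elim conjE)
    fix \<gamma> l assume \<gamma>: "arc_length_curve UNIV \<gamma> l"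
      and seg: "segment_upper_gradient u g \<gamma> l" "segment_upper_gradient u g' \<gamma> l"
      and fin: "curve_integral g \<gamma> l < \<infinity>" "curve_integral g' \<gamma> l < \<infinity>"
    define h where "h f t = (f (\<gamma> t) * indicator {0..l} t)" for f :: "'a \<Rightarrow> ennreal" and t
    have h: "(\<integral>\<^sup>+x\<in>{s..t}. h f x \<partial>lborel) = (\<integral>\<^sup>+x\<in>{s..t}. f (\<gamma> x) \<partial>lborel)" if "0 \<le> s" "t \<le> l" for s t f
      using that by (intro nn_integral_cong) (auto simp: h_def indicator_def)
    have m: "h f \<in> borel_measurable borel" if "f \<in> borel_measurable borel" for f
      unfolding h_def using borel_measurable_arc_length_curve[OF \<gamma> that] by simp
    have "ennreal \<bar>u (\<gamma> 0) - u (\<gamma> l)\<bar> \<le> (\<integral>\<^sup>+x\<in>{0..l}. min (h g x) (h g' x) \<partial>lborel)"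
      using seg fin \<gamma> g g'
      by (intro min_estimate[where \<phi> = "\<lambda>t. u (\<gamma> t)"] m)
        (auto simp: h arc_length_curve_def segment_upper_gradient_def curve_integral_lborel)
    also have "\<dots> = curve_integral (\<lambda>x. min (g x) (g' x)) \<gamma> l"
      unfolding curve_integral_lborel by (intro nn_integral_cong) (auto simp: indicator_def h_def)
    finally show "ennreal \<bar>u (\<gamma> 0) - u (\<gamma> l)\<bar> \<le> curve_integral (\<lambda>x. min (g x) (g' x)) \<gamma> l" .
  qed
  moreover have "(\<lambda>x. min (g x) (g' x)) \<in> borel_measurable M"
    using g(1) g'(1) by (intro borel_measurable_min measurable_M)
  ultimately show ?thesis by (simp add: weak_upper_gradient_real)
qed

section \<open>Minimal weak upper gradients and condenser capacity\<close>

abbreviation energy :: "('a \<Rightarrow> ennreal) \<Rightarrow> ennreal" where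
  "energy g \<equiv> (\<integral>\<^sup>+x. ennpow (g x) p \<partial>M)"

lemma energy_mono: "(\<And>x. g x \<le> h x) \<Longrightarrow> energy g \<le> energy h"
  by (intro nn_integral_mono ennpow_mono) auto

lemma energy_cong_AE: "AE x in M. g x = h x \<Longrightarrow> energy g = energy h"
  by (intro nn_integral_cong_AE) auto

lemma Lp_loc_if_energy_finite:
  assumes "g \<in> borel_measurable M" "energy g < \<infinity>"
  shows "g \<in> Lp_loc p M"
proof -
  have "(\<integral>\<^sup>+y\<in>ball x 1. ennpow (g y) p \<partial>M) \<le> energy g" for x
    by (intro nn_integral_mono) (auto simp: indicator_def)
  then show ?thesis
    using assms unfolding Lp_loc_def by (auto intro!: exI[of _ 1] intro: le_less_trans)
qed

end

section \<open>Existence of minimal weak upper gradients in proper spaces\<close>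

locale proper_metric_measure = metric_measure +
  assumes proper: "\<And>S :: 'a set. closed S \<Longrightarrow> bounded S \<Longrightarrow> compact S"
begin

text \<open>Properness turns local integrability into integrability on balls, by a finite subcover
  of the closed ball.\<close>

lemma Lp_loc_ball:
  assumes g: "g \<in> Lp_loc p M"
  shows "(\<integral>\<^sup>+y\<in>ball x r. ennpow (g y) p \<partial>M) < \<infinity>"
proof -
  have [measurable]: "g \<in> borel_measurable M"
    using g by (simp add: Lp_loc_def)
  have "\<forall>y. \<exists>s>0. (\<integral>\<^sup>+z\<in>ball y s. ennpow (g z) p \<partial>M) < \<infinity>"
    using g by (simp add: Lp_loc_def)
  then obtain R where R: "\<And>y. 0 < R y" "\<And>y. (\<integral>\<^sup>+z\<in>ball y (R y). ennpow (g z) p \<partial>M) < \<infinity>"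
    by metis
  have "compact (cball x r)" by (intro proper) auto
  moreover have "cball x r \<subseteq> (\<Union>y\<in>cball x r. ball y (R y))"
    using R(1) by (auto intro!: bexI centre_in_ball[THEN iffD2])
  ultimately obtain C where C: "finite C" "cball x r \<subseteq> (\<Union>y\<in>C. ball y (R y))"
    by (rule compactE_image[OF _ open_ball]) simp
  have "(\<integral>\<^sup>+y\<in>ball x r. ennpow (g y) p \<partial>M) \<le> (\<integral>\<^sup>+z. (\<Sum>y\<in>C. ennpow (g z) p * indicator (ball y (R y)) z) \<partial>M)"
  proof (rule nn_integral_mono)
    fix z
    show "ennpow (g z) p * indicator (ball x r) z \<le> (\<Sum>y\<in>C. ennpow (g z) p * indicator (ball y (R y)) z)"
    proof (cases "z \<in> ball x r")
      case True
      then have "z \<in> cball x r" by simp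
      with C(2) obtain y where y: "y \<in> C" "z \<in> ball y (R y)"
        by blast
      then have "ennpow (g z) p * indicator (ball x r) z \<le> ennpow (g z) p * indicator (ball y (R y)) z"
        by (simp add: indicator_def)
      also have "\<dots> \<le> (\<Sum>y\<in>C. ennpow (g z) p * indicator (ball y (R y)) z)"
        by (rule member_le_sum[OF y(1) _ C(1)]) simp
      finally show ?thesis .
    qed simp
  qed
  also have "\<dots> = (\<Sum>y\<in>C. \<integral>\<^sup>+z\<in>ball y (R y). ennpow (g z) p \<partial>M)"
    by (rule nn_integral_sum) measurable
  also have "\<dots> < \<infinity>"
    using R(2) C(1) by simp
  finally show ?thesis .
qed

text \<open>A curve stays within distance \<open>l\<close> of its starting point, hence in some ball
  of integer radius about \<open>x\<^sub>0\<close>. So countably many restrictions of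
  \<open>g\<close>, each of finite energy, take care of all curves.\<close>

lemma aec_Lp_loc:
  assumes g: "g \<in> Lp_loc p M"
  shows "aec (\<lambda>\<gamma> l. curve_integral g \<gamma> l < \<infinity>)"
proof -
  fix x\<^sub>0 :: 'a
  have [measurable]: "g \<in> borel_measurable M"
    using g by (simp add: Lp_loc_def)
  define gj where "gj j x = g x * indicator (ball x\<^sub>0 (real j)) x" for j x
  have "aec (\<lambda>\<gamma> l. curve_integral (gj j) \<gamma> l < \<infinity>)" for j
  proof (rule aec_curve_integral_finite)
    show "gj j \<in> borel_measurable M" unfolding gj_def by measurable
    show "energy (gj j) < \<infinity>"
      using Lp_loc_ball[OF g, of x\<^sub>0 j] by (simp add: gj_def ennpow_indicator_mult)
  qed
  from aec_all[OF this] show ?thesis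
  proof (rule aec_mono)
    fix \<gamma> l assume \<gamma>: "arc_length_curve UNIV \<gamma> l" and fin: "\<forall>j. curve_integral (gj j) \<gamma> l < \<infinity>"
    obtain j :: nat where j: "dist x\<^sub>0 (\<gamma> 0) + l < j"
      using reals_Archimedean2 by blast
    have "\<gamma> t \<in> ball x\<^sub>0 j" if "t \<in> {0..l}" for t
    proof -
      have "dist x\<^sub>0 (\<gamma> t) \<le> dist x\<^sub>0 (\<gamma> 0) + dist (\<gamma> 0) (\<gamma> t)"
        by (rule dist_triangle)
      also have "dist (\<gamma> 0) (\<gamma> t) \<le> l"
        using arc_length_curve_dist_le[OF \<gamma>, of 0 t] that by auto
      finally show ?thesis using j by simp
    qed
    then have "curve_integral g \<gamma> l = curve_integral (gj j) \<gamma> l"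
      unfolding curve_integral_def by (intro nn_integral_cong) (auto simp: indicator_def gj_def)
    then show "curve_integral g \<gamma> l < \<infinity>" using fin by simp
  qed
qed

lemma ex_minimal_weak_upper_gradient:
  assumes "weak_upper_gradient p M (\<lambda>x. ereal (u x)) g\<^sub>0" "energy g\<^sub>0 < \<infinity>"
  shows "\<exists>h. is_minimal_weak_upper_gradient p M (\<lambda>x. ereal (u x)) h"
proof -
  let ?wug = "weak_upper_gradient p M (\<lambda>x. ereal (u x))"
  define \<G> where "\<G> = {g. g \<in> borel_measurable borel \<and> ?wug g \<and> energy g < \<infinity>}"
  have "g\<^sub>0 \<in> borel_measurable M" using assms by (simp add: weak_upper_gradient_real)
  then obtain g\<^sub>1 where g\<^sub>1: "g\<^sub>1 \<in> borel_measurable borel" "\<And>x. g\<^sub>0 x \<le> g\<^sub>1 x" "AE x in M. g\<^sub>0 x = g\<^sub>1 x"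
    using borel_majorant by metis
  have "g\<^sub>1 \<in> \<G>"
    using g\<^sub>1 assms weak_upper_gradient_mono[OF assms(1) g\<^sub>1(2) measurable_M[OF g\<^sub>1(1)]] energy_cong_AE[OF g\<^sub>1(3)]
    by (simp add: \<G>_def)
  then obtain f where f: "range f \<subseteq> energy ` \<G>" "(INF g\<in>\<G>. energy g) = (INF i::nat. f i)"
    using ennreal_Inf_countable_INF[of "energy ` \<G>"] by auto
  have "\<exists>g. g \<in> \<G> \<and> energy g = f i" for i
  proof -
    have "f i \<in> energy ` \<G>" using f(1) by blast
    then show ?thesis by (auto simp: image_iff)
  qed
  then obtain g where g: "\<And>i. g i \<in> \<G>" "\<And>i. energy (g i) = f i" by metis
  have [measurable]: "g i \<in> borel_measurable borel" for i using g(1) by (simp add: \<G>_def)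
  define h where "h n x = (INF i\<in>{..n}. g i x)" for n :: nat and x
  have h_Suc: "h (Suc n) = (\<lambda>x. min (h n x) (g (Suc n) x))" for n
    by (auto simp: h_def atMost_Suc inf_min min.commute)
  have h_meas [measurable]: "h n \<in> borel_measurable borel" for n
    unfolding h_def by measurable
  have h_le: "h n x \<le> g n x" for n x
    unfolding h_def by (intro INF_lower) simp
  have h_fin: "energy (h n) < \<infinity>" for n
    using le_less_trans[OF energy_mono[of "h n" "g n"]] h_le g(1)[of n] by (simp add: \<G>_def)
  have aec_fin: "aec (\<lambda>\<gamma> l. curve_integral k \<gamma> l < \<infinity>)" if "k \<in> borel_measurable borel" "energy k < \<infinity>" for k
    using that by (intro aec_curve_integral_finite measurable_M) auto
  have h_wug: "?wug (h n)" for n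
  proof (induction n)
    case 0
    then show ?case using g(1)[of 0] by (simp add: h_def \<G>_def)
  next
    case (Suc n)
    then show ?case unfolding h_Suc
      using g(1)[of "Suc n"] h_fin[of n] by (intro weak_upper_gradient_min aec_fin) (auto simp: \<G>_def)
  qed
  define H where "H x = (INF n. h n x)" for x
  have H_meas [measurable]: "H \<in> borel_measurable borel" unfolding H_def by measurable
  have H_le: "H x \<le> g n x" for n x
    unfolding H_def using h_le[of n x] by (intro INF_lower2[of n]) auto
  have H_inf: "energy H \<le> energy k" if "k \<in> \<G>" for k
  proof -
    have "energy H \<le> (INF i. f i)"
      using H_le by (intro INF_greatest) (metis energy_mono g(2))
    also have "\<dots> \<le> energy k" unfolding f(2)[symmetric] by (rule INF_lower) fact
    finally show ?thesis .
  qed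
  have H_fin: "energy H < \<infinity>"
    using H_inf[OF \<open>g\<^sub>1 \<in> \<G>\<close>] \<open>g\<^sub>1 \<in> \<G>\<close> by (auto simp: \<G>_def intro: le_less_trans)
  have decseq_h: "decseq (\<lambda>n. h n x)" for x
    unfolding decseq_def h_def by (auto intro!: INF_superset_mono)
  have "aec (\<lambda>\<gamma> l. (\<forall>n. ennreal \<bar>u (\<gamma> 0) - u (\<gamma> l)\<bar> \<le> curve_integral (h n) \<gamma> l) \<and> curve_integral (h 0) \<gamma> l < \<infinity>)"
    using h_wug h_fin by (intro aec_conj aec_all aec_fin) (auto simp: weak_upper_gradient_real)
  then have "aec (\<lambda>\<gamma> l. ennreal \<bar>u (\<gamma> 0) - u (\<gamma> l)\<bar> \<le> curve_integral H \<gamma> l)"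
  proof (rule aec_mono, elim conjE)
    fix \<gamma> l assume \<gamma>: "arc_length_curve UNIV \<gamma> l"
      and le: "\<forall>n. ennreal \<bar>u (\<gamma> 0) - u (\<gamma> l)\<bar> \<le> curve_integral (h n) \<gamma> l" and fin: "curve_integral (h 0) \<gamma> l < \<infinity>"
    have "ennreal \<bar>u (\<gamma> 0) - u (\<gamma> l)\<bar> \<le> (INF n. curve_integral (h n) \<gamma> l)"
      using le by (intro INF_greatest) auto
    also have "\<dots> = (\<integral>\<^sup>+t. (INF n. h n (\<gamma> t) * indicator {0..l} t) \<partial>lborel)"
      unfolding curve_integral_lborel
    \<comment> \<open>Monotone convergence for decreasing functions starts from a finite integral,
      which almost every curve provides because \<open>h 0\<close> has finite energy.\<close>
    proof (rule nn_integral_monotone_convergence_INF_decseq[where i = 0, symmetric])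
      show "decseq (\<lambda>n t. h n (\<gamma> t) * indicator {0..l} t)"
        by (intro decseq_SucI le_funI mult_right_mono decseq_SucD[OF decseq_h]) simp
      show "(\<lambda>t. h i (\<gamma> t) * indicator {0..l} t) \<in> borel_measurable lborel" for i
        using borel_measurable_arc_length_curve[OF \<gamma> h_meas] by simp
      show "(\<integral>\<^sup>+t\<in>{0..l}. h 0 (\<gamma> t) \<partial>lborel) < \<infinity>"
        using fin by (simp add: curve_integral_lborel)
    qed
    also have "\<dots> = curve_integral H \<gamma> l"
      unfolding curve_integral_lborel H_def by (intro nn_integral_cong) (auto simp: indicator_def)
    finally show "ennreal \<bar>u (\<gamma> 0) - u (\<gamma> l)\<bar> \<le> curve_integral H \<gamma> l" .
  qed
  then have H_wug: "?wug H" by (simp add: weak_upper_gradient_real measurable_M)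
  have "AE x in M. H x \<le> g' x" if g': "g' \<in> Lp_loc p M" "?wug g'" for g'
  proof -
    have g'_meas: "g' \<in> borel_measurable M" using g' by (simp add: Lp_loc_def)
    obtain g'' where g'': "g'' \<in> borel_measurable borel" "\<And>x. g' x \<le> g'' x" "AE x in M. g' x = g'' x"
      using borel_majorant[OF g'_meas] by metis
    have "g'' \<in> Lp_loc p M"
    proof -
      have "(\<integral>\<^sup>+y\<in>ball x r. ennpow (g'' y) p \<partial>M) = (\<integral>\<^sup>+y\<in>ball x r. ennpow (g' y) p \<partial>M)" for x r
        using g''(3) by (intro nn_integral_cong_AE) auto
      then show ?thesis using g'(1) measurable_M[OF g''(1)] by (simp add: Lp_loc_def)
    qed
    then have wug_min: "?wug (\<lambda>x. min (H x) (g'' x))"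
      using g'' H_wug H_fin weak_upper_gradient_mono[OF g'(2) g''(2) measurable_M[OF g''(1)]]
      by (intro weak_upper_gradient_min aec_fin aec_Lp_loc) auto
    \<comment> \<open>\<open>g'\<close> is only locally in L^p, but its minimum with
      \<open>H\<close> has finite energy and therefore competes with \<open>H\<close>. As
      \<open>H\<close> has least energy, the minimum equals \<open>H\<close> almost
      everywhere.\<close>
    define m where "m x = min (H x) (g'' x)" for x
    have m_meas: "m \<in> borel_measurable borel"
      unfolding m_def using g''(1) by measurable
    have [measurable]: "m \<in> borel_measurable M" "H \<in> borel_measurable M"
      using m_meas by (auto intro!: measurable_M)
    have m_le: "ennpow (m x) p \<le> ennpow (H x) p" for x
      by (intro ennpow_mono) (auto simp: m_def)
    have m_fin: "energy m < \<infinity>"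
      using nn_integral_mono[of M "\<lambda>x. ennpow (m x) p" "\<lambda>x. ennpow (H x) p"] m_le H_fin
      by (auto intro: le_less_trans)
    then have "m \<in> \<G>" using wug_min m_meas by (simp add: \<G>_def m_def[abs_def])
    then have "energy H \<le> energy m" by (rule H_inf)
    have "(\<integral>\<^sup>+x. ennpow (H x) p - ennpow (m x) p \<partial>M) = energy H - energy m"
      using m_le m_fin by (intro nn_integral_diff) auto
    also have "\<dots> = 0"
      using \<open>energy H \<le> energy m\<close> H_fin by (simp add: diff_eq_0_iff_ennreal)
    finally have "AE x in M. ennpow (H x) p - ennpow (m x) p = 0"
      by (subst (asm) nn_integral_0_iff_AE) auto
    moreover have "AE x in M. ennpow (H x) p \<noteq> \<infinity>"
      by (rule nn_integral_noteq_infinite) (use H_fin in \<open>auto simp: less_top\<close>)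
    ultimately show ?thesis using g''(3)
    proof eventually_elim
      case (elim x)
      then have "ennpow (H x) p \<le> ennpow (m x) p" by (simp add: diff_eq_0_iff_ennreal less_top)
      then have "H x \<le> m x" using ennpow_strict_mono[of p "m x" "H x"] by (auto simp: not_less[symmetric])
      then show ?case using elim by (simp add: m_def)
    qed
  qed
  then show ?thesis
    using H_wug Lp_loc_if_energy_finite[OF measurable_M[OF H_meas] H_fin]
    unfolding is_minimal_weak_upper_gradient_def by blast
qed

lemma minimal_weak_upper_gradient:
  assumes "weak_upper_gradient p M (\<lambda>x. ereal (u x)) g" "energy g < \<infinity>"
  shows "weak_upper_gradient p M (\<lambda>x. ereal (u x)) (minimal_weak_upper_gradient p M (\<lambda>x. ereal (u x)))"
    and "energy (minimal_weak_upper_gradient p M (\<lambda>x. ereal (u x))) \<le> energy g"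
proof -
  let ?g = "minimal_weak_upper_gradient p M (\<lambda>x. ereal (u x))"
  have min: "is_minimal_weak_upper_gradient p M (\<lambda>x. ereal (u x)) ?g"
    unfolding minimal_weak_upper_gradient_def by (rule someI_ex[OF ex_minimal_weak_upper_gradient[OF assms]])
  then show "weak_upper_gradient p M (\<lambda>x. ereal (u x)) ?g"
    by (simp add: is_minimal_weak_upper_gradient_def)
  have "g \<in> Lp_loc p M"
    using assms by (intro Lp_loc_if_energy_finite) (auto simp: weak_upper_gradient_real)
  then have "AE x in M. ?g x \<le> g x"
    using min assms by (simp add: is_minimal_weak_upper_gradient_def)
  then show "energy ?g \<le> energy g"
    by (intro nn_integral_mono_AE) (auto elim!: eventually_mono intro: ennpow_mono)
qed

text \<open>A competitor together with any Borel weak upper gradient of finite energy. By the lemmas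
  that follow, the capacity of \<open>E\<close> in X is the infimum of \<open>energy g\<close> over
  such pairs, so minimal weak upper gradients can be forgotten afterwards.\<close>

definition admissible :: "'a set \<Rightarrow> ('a \<Rightarrow> real) \<Rightarrow> ('a \<Rightarrow> ennreal) \<Rightarrow> bool" where
  "admissible E u g \<longleftrightarrow> u \<in> borel_measurable M \<and> (\<forall>x. 0 \<le> u x \<and> u x \<le> 1) \<and> (\<forall>x\<in>E. u x = 1) \<and>
     energy (\<lambda>x. ennreal (u x)) < \<infinity> \<and> g \<in> borel_measurable borel \<and>
     weak_upper_gradient p M (\<lambda>x. ereal (u x)) g \<and> energy g < \<infinity>"

lemma sobolev_norm_pow_real_le:
  assumes "\<And>x. 0 \<le> u x" "weak_upper_gradient p M (\<lambda>x. ereal (u x)) g"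
  shows "sobolev_norm_pow p M (\<lambda>x. ereal (u x)) \<le> energy (\<lambda>x. ennreal (u x)) + energy g"
  unfolding sobolev_norm_pow_def
proof (intro add_mono INF_lower)
  show "(\<integral>\<^sup>+x. ennpow (e2ennreal \<bar>ereal (u x)\<bar>) p \<partial>M) \<le> energy (\<lambda>x. ennreal (u x))"
    using assms by (simp flip: ennreal.abs_eq)
qed (use assms in auto)

lemma bounded_condenser_capacity_le:
  assumes "admissible E u g"
  shows "bounded_condenser_capacity p M E UNIV \<le> energy g"
proof -
  note * = assms[unfolded admissible_def]
  have "sobolev_norm_pow p M (\<lambda>x. ereal (u x)) < \<infinity>"
    using sobolev_norm_pow_real_le[of u g] * by (auto intro: le_less_trans)
  moreover have "(\<lambda>x. ereal (u x)) \<in> borel_measurable M"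
    using * by (intro borel_measurable_ereal) simp
  ultimately have "(\<lambda>x. ereal (u x)) \<in> sobolev_space p M"
    by (simp add: sobolev_space_def)
  moreover have "indicator E x \<le> ereal (u x) \<and> ereal (u x) \<le> indicator UNIV x" for x
    using * by (auto simp: indicator_def)
  ultimately have "bounded_condenser_capacity p M E UNIV
      \<le> (\<integral>\<^sup>+x\<in>UNIV. ennpow (minimal_weak_upper_gradient p M (\<lambda>x. ereal (u x)) x) p \<partial>M)"
    unfolding bounded_condenser_capacity_def by (intro INF_lower) auto
  also have "\<dots> \<le> energy g"
    using minimal_weak_upper_gradient(2)[of u g] * by simp
  finally show ?thesis .
qed

text \<open>A competitor lies between 0 and 1 and is thus real-valued. Its minimal weak upper
  gradient exists since its Sobolev norm is finite, and a Borel majorant of it has the same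
  energy.\<close>

lemma bounded_condenser_capacity_lessE:
  assumes "bounded_condenser_capacity p M E UNIV < c"
  obtains u g where "admissible E u g" "energy g < c"
proof -
  obtain f where f: "f \<in> sobolev_space p M" "\<And>x. indicator E x \<le> f x" "\<And>x. f x \<le> 1"
    "energy (minimal_weak_upper_gradient p M f) < c"
    using assms unfolding bounded_condenser_capacity_def by (auto simp: INF_less_iff)
  define u where "u x = real_of_ereal (f x)" for x
  have f_ge: "0 \<le> f x" for x
    using f(2)[of x] by (rule order_trans[rotated]) (simp add: indicator_def)
  have fu: "f = (\<lambda>x. ereal (u x))"
  proof
    fix x
    show "f x = ereal (u x)"
      using f_ge[of x] f(3)[of x] by (cases "f x") (auto simp: u_def)
  qed
  have bounds: "0 \<le> u x" "u x \<le> 1" for x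
    using f_ge[of x] f(3)[of x] by (auto simp: fu)
  have on_E: "u x = 1" if "x \<in> E" for x
    using f(2)[of x] bounds[of x] that by (auto simp: fu)
  have meas: "u \<in> borel_measurable M"
    using f(1) unfolding u_def sobolev_space_def by (auto intro: borel_measurable_real_of_ereal)
  have norm: "sobolev_norm_pow p M f < \<infinity>"
    using f(1) by (simp add: sobolev_space_def)
  have "energy (\<lambda>x. ennreal (u x)) = (\<integral>\<^sup>+x. ennpow (e2ennreal \<bar>f x\<bar>) p \<partial>M)"
    using bounds by (simp add: fu flip: ennreal.abs_eq)
  then have fin: "energy (\<lambda>x. ennreal (u x)) < \<infinity>"
    using norm by (simp add: sobolev_norm_pow_def)
  obtain g where g: "weak_upper_gradient p M f g" "energy g < \<infinity>"
    using norm by (auto simp: sobolev_norm_pow_def INF_less_iff)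
  note min = minimal_weak_upper_gradient[OF g[unfolded fu]]
  obtain h where h: "h \<in> borel_measurable borel" "\<And>x. minimal_weak_upper_gradient p M f x \<le> h x"
    "AE x in M. minimal_weak_upper_gradient p M f x = h x"
    using borel_majorant[of "minimal_weak_upper_gradient p M f"] min(1) by (auto simp: fu weak_upper_gradient_real)
  have "weak_upper_gradient p M (\<lambda>x. ereal (u x)) h"
    using weak_upper_gradient_mono[OF min(1)] h measurable_M[OF h(1)] by (simp add: fu)
  moreover have "energy h = energy (minimal_weak_upper_gradient p M f)"
    by (rule energy_cong_AE[symmetric]) fact
  moreover have "energy h < \<infinity>"
    using calculation min(2) g(2) by (simp add: fu le_less_trans)
  ultimately have "admissible E u h"
    using bounds on_E meas fin h(1) by (simp add: admissible_def)
  then show ?thesis using that f(4) \<open>energy h = _\<close> by metis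
qed

lemma bounded_condenser_capacity_mono:
  assumes "E \<subseteq> F"
  shows "bounded_condenser_capacity p M E UNIV \<le> bounded_condenser_capacity p M F UNIV"
proof -
  have "indicator E x \<le> (indicator F x :: ereal)" for x
    using assms by (auto simp: indicator_def)
  then show ?thesis
    unfolding bounded_condenser_capacity_def
    by (intro INF_superset_mono) (auto intro: order_trans)
qed

text \<open>Shows that the definite description in the definition is meaningful. The capacities
  increase with the radius, and every ball about one centre lies in a ball of integer radius about
  any other, so the limit is a supremum independent of the centre.\<close>

lemma condenser_capacity_eq_SUP:
  assumes "\<not> bounded E"
  shows "condenser_capacity p M E UNIV = (SUP j::nat. bounded_condenser_capacity p M (E \<inter> ball x\<^sub>0 (real j)) UNIV)"
proof -
  define c where "c x = (SUP j::nat. bounded_condenser_capacity p M (E \<inter> ball x (real j)) UNIV)" for x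
  have c_le: "c x \<le> c y" for x y
    unfolding c_def
  proof (rule SUP_least)
    fix j :: nat
    obtain k :: nat where k: "dist x y + j \<le> k"
      using real_arch_simple by blast
    have "ball x j \<subseteq> ball y k"
    proof
      fix z assume "z \<in> ball x j"
      then show "z \<in> ball y k" using k dist_triangle[of y z x] by (simp add: dist_commute)
    qed
    then show "bounded_condenser_capacity p M (E \<inter> ball x (real j)) UNIV
        \<le> (SUP j::nat. bounded_condenser_capacity p M (E \<inter> ball y (real j)) UNIV)"
      by (intro SUP_upper2[of k] bounded_condenser_capacity_mono) auto
  qed
  have lim: "(\<lambda>j::nat. bounded_condenser_capacity p M (E \<inter> ball x (real j)) UNIV) \<longlonglongrightarrow> c x" for x
    unfolding c_def by (intro LIMSEQ_SUP monoI bounded_condenser_capacity_mono) auto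
  have "(THE c. \<forall>x. (\<lambda>j::nat. bounded_condenser_capacity p M (E \<inter> ball x (real j)) UNIV) \<longlonglongrightarrow> c) = c x\<^sub>0"
  proof (rule the_equality)
    show "\<forall>x. (\<lambda>j::nat. bounded_condenser_capacity p M (E \<inter> ball x (real j)) UNIV) \<longlonglongrightarrow> c x\<^sub>0"
    proof
      fix x
      have "c x = c x\<^sub>0" by (intro order_antisym c_le)
      then show "(\<lambda>j::nat. bounded_condenser_capacity p M (E \<inter> ball x (real j)) UNIV) \<longlonglongrightarrow> c x\<^sub>0"
        using lim[of x] by simp
    qed
    show "d = c x\<^sub>0" if "\<forall>x. (\<lambda>j::nat. bounded_condenser_capacity p M (E \<inter> ball x (real j)) UNIV) \<longlonglongrightarrow> d" for d
      using that lim by (blast intro: LIMSEQ_unique)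
  qed
  then show ?thesis using assms by (simp add: condenser_capacity_def c_def)
qed

text \<open>A positive limit is already positive on some bounded piece, and the closure of a bounded
  set is compact in a proper space.\<close>

lemma condenser_capacity_posE:
  assumes "0 < condenser_capacity p M E UNIV"
  obtains K where "compact K" "0 < condenser_capacity p M K UNIV"
proof -
  fix x\<^sub>0 :: 'a
  have *: thesis if "bounded F" "0 < bounded_condenser_capacity p M F UNIV" for F
  proof (rule \<open>\<And>K. compact K \<Longrightarrow> 0 < condenser_capacity p M K UNIV \<Longrightarrow> thesis\<close>)
    show "compact (closure F)" using that by (intro proper) auto
    show "0 < condenser_capacity p M (closure F) UNIV"
      using that bounded_condenser_capacity_mono[OF closure_subset[of F]]
      by (simp add: condenser_capacity_def bounded_closure less_le_trans)
  qed
  show thesis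
  proof (cases "bounded E")
    case True
    then show ?thesis using * assms by (simp add: condenser_capacity_def)
  next
    case False
    then obtain j :: nat where "0 < bounded_condenser_capacity p M (E \<inter> ball x\<^sub>0 (real j)) UNIV"
      using assms condenser_capacity_eq_SUP[OF False, of x\<^sub>0] by (auto simp: less_SUP_iff)
    then show ?thesis by (intro *) (auto intro: bounded_subset[OF bounded_ball])
  qed
qed

lemma bounded_condenser_capacity_ball_le:
  "bounded_condenser_capacity p M (E \<inter> ball x\<^sub>0 (real j)) UNIV \<le> condenser_capacity p M E UNIV"
proof (cases "bounded E")
  case True
  then show ?thesis by (auto simp: condenser_capacity_def intro: bounded_condenser_capacity_mono)
next
  case False
  then show ?thesis unfolding condenser_capacity_eq_SUP[OF False, of x\<^sub>0] by (intro SUP_upper) simp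
qed

end

section \<open>Truncation and averaging\<close>

lemma ennreal_tendsto_0_le:
  fixes f g :: "nat \<Rightarrow> ennreal"
  assumes "\<And>k. f k \<le> g k" "g \<longlonglongrightarrow> 0"
  shows "f \<longlonglongrightarrow> 0"
  using assms by (intro tendsto_sandwich[of "\<lambda>_. 0" f sequentially g 0]) auto

context metric_measure
begin

text \<open>Take a piece of curve shorter than 1 on which \<open>f\<close> oscillates by at most
  \<open>c' - c\<close>. If \<open>f\<close> never exceeds \<open>c'\<close> on it, the new function
  vanishes at both ends. Otherwise \<open>f\<close> exceeds \<open>c\<close> throughout. Then a
  piece inside \<open>ball x\<^sub>0 (R + 1)\<close> runs in \<open>S\<close>, where the 1-Lipschitz
  \<open>\<eta>\<close> changes by at most the length; a piece leaving that ball misses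
  \<open>ball x\<^sub>0 R\<close>, off which \<open>\<eta>\<close> is constant. Dividing by
  \<open>1 - c'\<close> restores the value 1 where \<open>f\<close> is 1.\<close>

lemma weak_upper_gradient_truncation:
  assumes g: "g \<in> borel_measurable borel" "weak_upper_gradient p M (\<lambda>x. ereal (f x)) g" "energy g < \<infinity>"
    and c: "c < c'" "c' < 1"
    and \<eta>: "\<And>x. 0 \<le> \<eta> x" "\<And>x y. \<bar>\<eta> x - \<eta> y\<bar> \<le> dist x y" "\<And>x. x \<notin> ball x\<^sub>0 R \<Longrightarrow> \<eta> x = e"
    and S: "S \<in> sets borel" "{x \<in> ball x\<^sub>0 (R + 1). c < f x} \<subseteq> S"
  shows "weak_upper_gradient p M (\<lambda>x. ereal (min (max 0 ((f x - c') / (1 - c'))) (\<eta> x)))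
    (\<lambda>x. ennreal (1 / (1 - c')) * g x + indicator S x)"
proof (rule weak_upper_gradient_localI)
  show "(\<lambda>x. ennreal (1 / (1 - c')) * g x + indicator S x) \<in> borel_measurable borel"
    using g S by measurable
  show "aec (\<lambda>\<gamma> l. segment_upper_gradient f g \<gamma> l \<and> curve_integral g \<gamma> l < \<infinity>)"
    using g by (intro aec_conj aec_curve_integral_finite measurable_M) (auto simp: weak_upper_gradient_segment)
  fix \<gamma> l
  assume \<gamma>: "arc_length_curve UNIV \<gamma> l" and "segment_upper_gradient f g \<gamma> l \<and> curve_integral g \<gamma> l < \<infinity>"
  then have seg: "\<And>s t. 0 \<le> s \<Longrightarrow> s \<le> t \<Longrightarrow> t \<le> l \<Longrightarrow> ennreal \<bar>f (\<gamma> s) - f (\<gamma> t)\<bar> \<le> (\<integral>\<^sup>+x\<in>{s..t}. g (\<gamma> x) \<partial>lborel)"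
    and fin: "curve_integral g \<gamma> l < \<infinity>"
    by (auto simp: segment_upper_gradient_def)
  define h where "h k t = k (\<gamma> t) * indicator {0..l} t" for k :: "'a \<Rightarrow> ennreal" and t
  have h_meas: "h k \<in> borel_measurable borel" if "k \<in> borel_measurable borel" for k
    unfolding h_def using borel_measurable_arc_length_curve[OF \<gamma> that] .
  have h: "(\<integral>\<^sup>+x\<in>{s..t}. k (\<gamma> x) \<partial>lborel) = (\<integral>\<^sup>+x\<in>{s..t}. h k x \<partial>lborel)" if "0 \<le> s" "t \<le> l" for s t k
    using that by (intro nn_integral_cong) (auto simp: h_def indicator_def)
  have "(\<integral>\<^sup>+x\<in>{0..l}. h g x \<partial>lborel) < \<infinity>"
    using fin by (simp add: curve_integral_lborel flip: h)
  from small_interval_integral[OF h_meas[OF g(1)] this, of "c' - c"] c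
  obtain \<delta> where \<delta>: "0 < \<delta>" "\<And>s t. 0 \<le> s \<Longrightarrow> s \<le> t \<Longrightarrow> t \<le> l \<Longrightarrow> t - s < \<delta> \<Longrightarrow> (\<integral>\<^sup>+x\<in>{s..t}. h g x \<partial>lborel) \<le> ennreal (c' - c)"
    by auto
  have osc': "\<bar>f (\<gamma> s) - f (\<gamma> t)\<bar> \<le> c' - c" if "0 \<le> s" "s \<le> t" "t \<le> l" "t - s < \<delta>" for s t
    using order_trans[OF seg[OF that(1-3)], of "ennreal (c' - c)"] \<delta>(2)[OF that] that c by (simp add: h ennreal_le_iff)
  have osc: "\<bar>f (\<gamma> s) - f (\<gamma> t)\<bar> \<le> c' - c" if "s \<in> {0..l}" "t \<in> {0..l}" "\<bar>t - s\<bar> < \<delta>" for s t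
    using that osc'[of s t] osc'[of t s] by (cases "s \<le> t") (auto simp: abs_minus_commute)
  define v where "v x = min (max 0 ((f x - c') / (1 - c'))) (\<eta> x)" for x
  have "ennreal \<bar>v (\<gamma> s) - v (\<gamma> t)\<bar> \<le> (\<integral>\<^sup>+x\<in>{s..t}. (ennreal (1 / (1 - c')) * g (\<gamma> x) + indicator S (\<gamma> x)) \<partial>lborel)"
    if st: "0 \<le> s" "s \<le> t" "t \<le> l" "t - s < min \<delta> 1" for s t
  proof (cases "\<forall>x\<in>{s..t}. f (\<gamma> x) \<le> c'")
    case True
    then have "v (\<gamma> s) = 0" "v (\<gamma> t) = 0"
      using st c \<eta>(1) by (auto simp: v_def max_absorb1 divide_nonpos_pos)
    then show ?thesis by simp
  next
    case False
    then obtain x where x: "x \<in> {s..t}" "c' < f (\<gamma> x)" by (auto simp: not_le)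
    have above: "c < f (\<gamma> y)" if "y \<in> {s..t}" for y
    proof -
      have "\<bar>f (\<gamma> x) - f (\<gamma> y)\<bar> \<le> c' - c"
        using x that st by (intro osc) auto
      then show ?thesis using x by linarith
    qed
    have "ennreal \<bar>\<eta> (\<gamma> s) - \<eta> (\<gamma> t)\<bar> \<le> (\<integral>\<^sup>+x\<in>{s..t}. indicator S (\<gamma> x) \<partial>lborel)"
    proof (cases "\<forall>y\<in>{s..t}. \<gamma> y \<in> ball x\<^sub>0 (R + 1)")
      case True
      have "ennreal \<bar>\<eta> (\<gamma> s) - \<eta> (\<gamma> t)\<bar> \<le> ennreal (t - s)"
        using \<eta>(2)[of "\<gamma> s" "\<gamma> t"] arc_length_curve_dist_le[OF \<gamma> st(1-3)] by (intro ennreal_leI) simp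
      also have "\<dots> = (\<integral>\<^sup>+x. indicator {s..t} x \<partial>lborel)"
        using st by simp
      also have "\<dots> \<le> (\<integral>\<^sup>+x\<in>{s..t}. indicator S (\<gamma> x) \<partial>lborel)"
      proof (intro nn_integral_mono)
        fix y
        show "indicator {s..t} y \<le> (indicator S (\<gamma> y) * indicator {s..t} y :: ennreal)"
        proof (cases "y \<in> {s..t}")
          case y: True
          then have "\<gamma> y \<in> S" using above[OF y] True S(2) by blast
          then show ?thesis by simp
        qed simp
      qed
      finally show ?thesis .
    next
      case False
      then obtain y where y: "y \<in> {s..t}" "\<gamma> y \<notin> ball x\<^sub>0 (R + 1)" by auto
      have "\<gamma> z \<notin> ball x\<^sub>0 R" if "z \<in> {s..t}" for z
        using arc_length_curve_lipschitz[OF \<gamma>, of z y] y that st dist_triangle[of x\<^sub>0 "\<gamma> y" "\<gamma> z"]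
        by auto
      then have "\<eta> (\<gamma> s) = \<eta> (\<gamma> t)" using st \<eta>(3) by simp
      then show ?thesis by simp
    qed
    moreover have "ennreal (\<bar>f (\<gamma> s) - f (\<gamma> t)\<bar>) \<le> (\<integral>\<^sup>+x\<in>{s..t}. g (\<gamma> x) \<partial>lborel)"
      using seg st by simp
    moreover have "\<bar>v (\<gamma> s) - v (\<gamma> t)\<bar> \<le> 1 / (1 - c') * \<bar>f (\<gamma> s) - f (\<gamma> t)\<bar> + \<bar>\<eta> (\<gamma> s) - \<eta> (\<gamma> t)\<bar>"
    proof -
      have "1 / (1 - c') * \<bar>f (\<gamma> s) - f (\<gamma> t)\<bar> = \<bar>(f (\<gamma> s) - c') / (1 - c') - (f (\<gamma> t) - c') / (1 - c')\<bar>"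
        using c by (simp add: diff_divide_distrib[symmetric])
      then show ?thesis unfolding v_def by linarith
    qed
    then have "ennreal \<bar>v (\<gamma> s) - v (\<gamma> t)\<bar>
        \<le> ennreal (1 / (1 - c')) * ennreal \<bar>f (\<gamma> s) - f (\<gamma> t)\<bar> + ennreal \<bar>\<eta> (\<gamma> s) - \<eta> (\<gamma> t)\<bar>"
      using c by (simp add: ennreal_mult[symmetric] ennreal_plus[symmetric] ennreal_leI del: ennreal_plus)
    ultimately have "ennreal \<bar>v (\<gamma> s) - v (\<gamma> t)\<bar>
        \<le> ennreal (1 / (1 - c')) * (\<integral>\<^sup>+x\<in>{s..t}. h g x \<partial>lborel) + (\<integral>\<^sup>+x\<in>{s..t}. h (indicator S) x \<partial>lborel)"
      using st by (simp add: h) (meson add_mono mult_left_mono order_trans zero_le)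
    also have "\<dots> = (\<integral>\<^sup>+x. ennreal (1 / (1 - c')) * (h g x * indicator {s..t} x) + h (indicator S) x * indicator {s..t} x \<partial>lborel)"
      using h_meas[of g] h_meas[of "indicator S"] g(1) S(1)
      by (subst nn_integral_add) (auto simp: nn_integral_cmult)
    also have "\<dots> = (\<integral>\<^sup>+x\<in>{s..t}. (ennreal (1 / (1 - c')) * g (\<gamma> x) + indicator S (\<gamma> x)) \<partial>lborel)"
      using st by (intro nn_integral_cong) (auto simp: h_def indicator_def)
    finally show ?thesis .
  qed
  then show "\<exists>\<delta>>0. \<forall>s t. 0 \<le> s \<longrightarrow> s \<le> t \<longrightarrow> t \<le> l \<longrightarrow> t - s < \<delta> \<longrightarrow>
      ennreal \<bar>min (max 0 ((f (\<gamma> s) - c') / (1 - c'))) (\<eta> (\<gamma> s)) - min (max 0 ((f (\<gamma> t) - c') / (1 - c'))) (\<eta> (\<gamma> t))\<bar>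
      \<le> (\<integral>\<^sup>+x\<in>{s..t}. (ennreal (1 / (1 - c')) * g (\<gamma> x) + indicator S (\<gamma> x)) \<partial>lborel)"
    using \<delta>(1) unfolding v_def by (intro exI[of _ "min \<delta> 1"]) auto
qed

text \<open>A piece of curve shorter than 1 that meets \<open>ball x\<^sub>0 R\<close> stays in the
  ball of radius \<open>R + 1\<close>, where \<open>u\<close> is constant; any other piece avoids
  the region where the gradient is set to 0.\<close>

lemma weak_upper_gradient_const_ball:
  assumes g: "g \<in> borel_measurable borel" "weak_upper_gradient p M (\<lambda>x. ereal (u x)) g"
    and u: "\<And>x. x \<in> ball x\<^sub>0 (R + 1) \<Longrightarrow> u x = e"
  shows "weak_upper_gradient p M (\<lambda>x. ereal (u x)) (\<lambda>x. g x * indicator (- ball x\<^sub>0 R) x)"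
proof (rule weak_upper_gradient_localI)
  show "(\<lambda>x. g x * indicator (- ball x\<^sub>0 R) x) \<in> borel_measurable borel"
    using g by measurable
  show "aec (segment_upper_gradient u g)"
    using g by (simp add: weak_upper_gradient_segment)
  fix \<gamma> l assume \<gamma>: "arc_length_curve UNIV \<gamma> l" and seg: "segment_upper_gradient u g \<gamma> l"
  have "ennreal \<bar>u (\<gamma> s) - u (\<gamma> t)\<bar> \<le> (\<integral>\<^sup>+x\<in>{s..t}. (g (\<gamma> x) * indicator (- ball x\<^sub>0 R) (\<gamma> x)) \<partial>lborel)"
    if st: "0 \<le> s" "s \<le> t" "t \<le> l" "t - s < 1" for s t
  proof (cases "\<exists>y\<in>{s..t}. \<gamma> y \<in> ball x\<^sub>0 R")
    case True
    then obtain y where y: "y \<in> {s..t}" "\<gamma> y \<in> ball x\<^sub>0 R" by auto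
    have "\<gamma> z \<in> ball x\<^sub>0 (R + 1)" if "z \<in> {s..t}" for z
      using arc_length_curve_lipschitz[OF \<gamma>, of y z] y that st dist_triangle[of x\<^sub>0 "\<gamma> z" "\<gamma> y"]
      by auto
    then show ?thesis using st u by simp
  next
    case False
    have "ennreal \<bar>u (\<gamma> s) - u (\<gamma> t)\<bar> \<le> (\<integral>\<^sup>+x\<in>{s..t}. g (\<gamma> x) \<partial>lborel)"
      using seg st by (simp add: segment_upper_gradient_def)
    also have "\<dots> = (\<integral>\<^sup>+x\<in>{s..t}. (g (\<gamma> x) * indicator (- ball x\<^sub>0 R) (\<gamma> x)) \<partial>lborel)"
      using False by (intro nn_integral_cong) (auto simp: indicator_def)
    finally show ?thesis .
  qed
  then show "\<exists>\<delta>>0. \<forall>s t. 0 \<le> s \<longrightarrow> s \<le> t \<longrightarrow> t \<le> l \<longrightarrow> t - s < \<delta> \<longrightarrow>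
      ennreal \<bar>u (\<gamma> s) - u (\<gamma> t)\<bar> \<le> (\<integral>\<^sup>+x\<in>{s..t}. (g (\<gamma> x) * indicator (- ball x\<^sub>0 R) (\<gamma> x)) \<partial>lborel)"
    by (intro exI[of _ 1]) auto
qed

lemma weak_upper_gradient_average:
  assumes g: "g \<in> borel_measurable borel" "weak_upper_gradient p M (\<lambda>x. ereal (u x)) g"
    and h: "h \<in> borel_measurable borel" "weak_upper_gradient p M (\<lambda>x. ereal (v x)) h"
  shows "weak_upper_gradient p M (\<lambda>x. ereal ((u x + v x) / 2)) (\<lambda>x. ennreal (1 / 2) * (g x + h x))"
  unfolding weak_upper_gradient_real
proof
  show "(\<lambda>x. ennreal (1 / 2) * (g x + h x)) \<in> borel_measurable M"
    using g h by (intro measurable_M) measurable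
  have "aec (\<lambda>\<gamma> l. ennreal \<bar>u (\<gamma> 0) - u (\<gamma> l)\<bar> \<le> curve_integral g \<gamma> l \<and> ennreal \<bar>v (\<gamma> 0) - v (\<gamma> l)\<bar> \<le> curve_integral h \<gamma> l)"
    using g h by (intro aec_conj) (auto simp: weak_upper_gradient_real)
  then show "aec (\<lambda>\<gamma> l. ennreal \<bar>(u (\<gamma> 0) + v (\<gamma> 0)) / 2 - (u (\<gamma> l) + v (\<gamma> l)) / 2\<bar>
      \<le> curve_integral (\<lambda>x. ennreal (1 / 2) * (g x + h x)) \<gamma> l)"
  proof (rule aec_mono)
    fix \<gamma> l assume \<gamma>: "arc_length_curve UNIV \<gamma> l"
      and *: "ennreal \<bar>u (\<gamma> 0) - u (\<gamma> l)\<bar> \<le> curve_integral g \<gamma> l \<and> ennreal \<bar>v (\<gamma> 0) - v (\<gamma> l)\<bar> \<le> curve_integral h \<gamma> l"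
    note m = borel_measurable_arc_length_curve[OF \<gamma>]
    have "ennreal \<bar>(u (\<gamma> 0) + v (\<gamma> 0)) / 2 - (u (\<gamma> l) + v (\<gamma> l)) / 2\<bar>
        \<le> ennreal (1 / 2 * (\<bar>u (\<gamma> 0) - u (\<gamma> l)\<bar> + \<bar>v (\<gamma> 0) - v (\<gamma> l)\<bar>))"
    proof (intro ennreal_leI)
      have "(u (\<gamma> 0) + v (\<gamma> 0)) / 2 - (u (\<gamma> l) + v (\<gamma> l)) / 2 = 1 / 2 * ((u (\<gamma> 0) - u (\<gamma> l)) + (v (\<gamma> 0) - v (\<gamma> l)))"
        by (simp add: field_simps)
      then show "\<bar>(u (\<gamma> 0) + v (\<gamma> 0)) / 2 - (u (\<gamma> l) + v (\<gamma> l)) / 2\<bar>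
          \<le> 1 / 2 * (\<bar>u (\<gamma> 0) - u (\<gamma> l)\<bar> + \<bar>v (\<gamma> 0) - v (\<gamma> l)\<bar>)"
        by (simp only: abs_mult) (intro mult_mono abs_triangle_ineq, auto)
    qed
    also have "\<dots> = ennreal (1 / 2) * (ennreal \<bar>u (\<gamma> 0) - u (\<gamma> l)\<bar> + ennreal \<bar>v (\<gamma> 0) - v (\<gamma> l)\<bar>)"
      by (subst ennreal_mult) auto
    also have "\<dots> \<le> ennreal (1 / 2) * (curve_integral g \<gamma> l + curve_integral h \<gamma> l)"
      using * by (intro mult_left_mono add_mono) auto
    also have "\<dots> = (\<integral>\<^sup>+t. ennreal (1 / 2) * (g (\<gamma> t) * indicator {0..l} t + h (\<gamma> t) * indicator {0..l} t) \<partial>lborel)"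
      unfolding curve_integral_lborel using m[OF g(1)] m[OF h(1)]
      by (subst nn_integral_cmult) (auto simp: nn_integral_add)
    also have "\<dots> = curve_integral (\<lambda>x. ennreal (1 / 2) * (g x + h x)) \<gamma> l"
      unfolding curve_integral_lborel by (intro nn_integral_cong) (auto simp: indicator_def)
    finally show "ennreal \<bar>(u (\<gamma> 0) + v (\<gamma> 0)) / 2 - (u (\<gamma> l) + v (\<gamma> l)) / 2\<bar>
        \<le> curve_integral (\<lambda>x. ennreal (1 / 2) * (g x + h x)) \<gamma> l" .
  qed
qed

lemma energy_tail:
  assumes [measurable]: "g \<in> borel_measurable M" and fin: "energy g < \<infinity>" and e: "0 < e"
  obtains n :: nat where "(\<integral>\<^sup>+x\<in>- ball x\<^sub>0 n. ennpow (g x) p \<partial>M) < ennreal e"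
proof -
  define k where "k n x = ennpow (g x) p * indicator (- ball x\<^sub>0 (real n)) x" for n x
  have [measurable]: "- ball x\<^sub>0 r \<in> sets M" for r by (intro sets_M) auto
  have k_meas: "k n \<in> borel_measurable M" for n
    unfolding k_def by measurable
  have "decseq k"
    by (intro decseq_SucI le_funI) (auto simp: k_def indicator_def)
  moreover have "integral\<^sup>N M (k 0) < \<infinity>"
    using le_less_trans[OF nn_integral_mono[of M "k 0" "\<lambda>x. ennpow (g x) p"] fin]
    by (auto simp: k_def indicator_def)
  ultimately have "(\<integral>\<^sup>+x. (INF n. k n x) \<partial>M) = (INF n. integral\<^sup>N M (k n))"
    by (intro nn_integral_monotone_convergence_INF_decseq k_meas)
  moreover have "(INF n. k n x) = 0" for x
  proof -
    obtain n :: nat where "dist x\<^sub>0 x < n" using reals_Archimedean2 by blast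
    then have "k n x = 0" by (simp add: k_def)
    then show ?thesis by (metis INF_lower UNIV_I le_zero_eq)
  qed
  ultimately have "(INF n. integral\<^sup>N M (k n)) < ennreal e" using e by simp
  then show ?thesis using that by (auto simp: INF_less_iff k_def[abs_def])
qed

end

section \<open>Finite capacity of X forces the capacities of balls to vanish\<close>

context proper_metric_measure
begin

text \<open>The pair is the average of the two functions with half the sum of the gradients, the
  second one removed on \<open>ball x\<^sub>0 R\<close>. Both gradients meet only off that ball,
  where \<open>g\<close> is to be small; its large factor \<open>(1 + 1 / s) powr p\<close> is
  therefore harmless, and \<open>energy h\<close> gets a factor close to 1.\<close>

lemma admissible_average_tail:
  assumes u: "admissible E u g" and v: "admissible (ball x\<^sub>0 (R + 1)) v h" and E: "E \<subseteq> ball x\<^sub>0 (R + 1)" and s: "0 < s"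
  obtains w k where "admissible E w k"
    "energy k \<le> ennreal ((1 / 2) powr p) * (energy g + ennreal ((1 + 1 / s) powr p) * (\<integral>\<^sup>+x\<in>- ball x\<^sub>0 R. ennpow (g x) p \<partial>M)
      + ennreal ((1 + s) powr p) * energy h)"
proof -
  define w where "w x = (u x + v x) / 2" for x
  define h' where "h' x = h x * indicator (- ball x\<^sub>0 R) x" for x
  define k where "k x = ennreal (1 / 2) * (g x + h' x)" for x
  note u' = u[unfolded admissible_def] and v' = v[unfolded admissible_def]
  have g [measurable]: "g \<in> borel_measurable borel" "g \<in> borel_measurable M"
    using u' by (auto intro: measurable_M)
  have h [measurable]: "h \<in> borel_measurable borel" "h \<in> borel_measurable M"
    using v' by (auto intro: measurable_M)
  have [measurable]: "- ball x\<^sub>0 R \<in> sets M" by (intro sets_M) auto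
  have h'_meas: "h' \<in> borel_measurable borel" unfolding h'_def by measurable
  have "weak_upper_gradient p M (\<lambda>x. ereal (v x)) h'"
    unfolding h'_def using v' by (intro weak_upper_gradient_const_ball) auto
  then have wug: "weak_upper_gradient p M (\<lambda>x. ereal (w x)) k"
    unfolding w_def k_def using u' h'_meas by (intro weak_upper_gradient_average) auto
  have k_meas: "k \<in> borel_measurable borel" unfolding k_def using h'_meas by measurable
  let ?B = "ennreal ((1 / 2) powr p) * (energy g + ennreal ((1 + 1 / s) powr p) * (\<integral>\<^sup>+x\<in>- ball x\<^sub>0 R. ennpow (g x) p \<partial>M)
      + ennreal ((1 + s) powr p) * energy h)"
  have "energy k \<le> (\<integral>\<^sup>+x. ennreal ((1 / 2) powr p) * (ennpow (g x) p
      + ennreal ((1 + 1 / s) powr p) * (ennpow (g x) p * indicator (- ball x\<^sub>0 R) x) + ennreal ((1 + s) powr p) * ennpow (h x) p) \<partial>M)"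
  proof (rule nn_integral_mono)
    fix x
    have "ennpow (g x + h' x) p \<le> ennpow (g x) p + ennreal ((1 + 1 / s) powr p) * (ennpow (g x) p * indicator (- ball x\<^sub>0 R) x)
        + ennreal ((1 + s) powr p) * ennpow (h x) p"
    proof (cases "x \<in> ball x\<^sub>0 R")
      case True
      then show ?thesis by (simp add: h'_def)
    next
      case False
      then show ?thesis using ennpow_add_le[OF p_pos(1) s, of "g x" "h x"]
        by (simp add: h'_def add_increasing add.assoc)
    qed
    then show "ennpow (k x) p \<le> ennreal ((1 / 2) powr p) * (ennpow (g x) p
      + ennreal ((1 + 1 / s) powr p) * (ennpow (g x) p * indicator (- ball x\<^sub>0 R) x) + ennreal ((1 + s) powr p) * ennpow (h x) p)"
      unfolding k_def by (subst ennpow_cmult) (auto intro: mult_left_mono)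
  qed
  also have "\<dots> = ?B"
    by (simp add: nn_integral_cmult nn_integral_add)
  finally have energy_k: "energy k \<le> ?B" .
  have "(\<integral>\<^sup>+x\<in>- ball x\<^sub>0 R. ennpow (g x) p \<partial>M) \<le> energy g"
    by (intro nn_integral_mono) (auto simp: indicator_def)
  then have "?B < \<infinity>" using u' v' by (auto simp: ennreal_mult_less_top intro: le_less_trans)
  have "energy (\<lambda>x. ennreal (w x)) \<le> (\<integral>\<^sup>+x. ennpow (ennreal (u x)) p + ennpow (ennreal (v x)) p \<partial>M)"
  proof (rule nn_integral_mono)
    fix x
    have "w x \<le> max (u x) (v x)" by (simp add: w_def)
    then have "ennreal (w x) \<le> ennreal (u x) \<or> ennreal (w x) \<le> ennreal (v x)"
      by (auto simp: max_def intro: ennreal_leI split: if_splits)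
    then show "ennpow (ennreal (w x)) p \<le> ennpow (ennreal (u x)) p + ennpow (ennreal (v x)) p"
      using ennpow_mono[of p "ennreal (w x)" "ennreal (u x)"] ennpow_mono[of p "ennreal (w x)" "ennreal (v x)"]
      by (auto intro: add_increasing add_increasing2)
  qed
  also have "\<dots> = energy (\<lambda>x. ennreal (u x)) + energy (\<lambda>x. ennreal (v x))"
    using u' v' by (intro nn_integral_add) auto
  also have "\<dots> < \<infinity>" using u' v' by simp
  finally have "energy (\<lambda>x. ennreal (w x)) < \<infinity>" .
  moreover have "0 \<le> w x \<and> w x \<le> 1" for x
    using u' v' by (auto simp: w_def add_nonneg_nonneg intro: order_trans[OF add_mono[of "u x" 1 "v x" 1]])
  moreover have "w x = 1" if "x \<in> E" for x
    using u' v' E that by (auto simp: w_def)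
  moreover have "w \<in> borel_measurable M"
    unfolding w_def using u' v' by auto
  ultimately have "admissible E w k"
    using wug k_meas le_less_trans[OF energy_k \<open>?B < \<infinity>\<close>] by (simp add: admissible_def)
  then show ?thesis using that energy_k by blast
qed

text \<open>Averaging improves a common bound \<open>i\<close> for the capacities to
  \<open>\<kappa> * i\<close> with \<open>\<kappa> < 1\<close>, up to an error that tends to 0 with
  \<open>e\<close>. As \<open>i\<close> is the least bound, it is 0.\<close>

lemma SUP_capacity_ball_eq_0:
  assumes fin: "(SUP j::nat. bounded_condenser_capacity p M (ball x\<^sub>0 (real j)) UNIV) < \<infinity>"
  shows "(SUP j::nat. bounded_condenser_capacity p M (ball x\<^sub>0 (real j)) UNIV) = 0"
proof -
  define cap where "cap j = bounded_condenser_capacity p M (ball x\<^sub>0 (real j)) UNIV" for j :: nat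
  obtain i where i: "(SUP j. cap j) = ennreal i" "0 \<le> i"
    using fin unfolding cap_def by (cases "SUP j::nat. bounded_condenser_capacity p M (ball x\<^sub>0 (real j)) UNIV") auto
  \<comment> \<open>Any positive \<open>s\<close> with \<open>(1 + s) powr p < 2 powr p - 1\<close>
    would make \<open>\<kappa>\<close> less than 1. This one gives
    \<open>\<kappa> = 2 powr (- p) + 1 / 2\<close>, and \<open>p > 1\<close> makes both
    \<open>s\<close> positive and \<open>\<kappa>\<close> less than 1.\<close>
  define s where "s = (2 powr (p - 1)) powr (1 / p) - 1"
  have s: "0 < s" "(1 + s) powr p = 2 powr (p - 1)"
    using p_gt_1 by (auto simp: s_def powr_powr)
  define K where "K = (1 + 1 / s) powr p"
  define \<kappa> where "\<kappa> = (1 / 2) powr p * (1 + 2 powr (p - 1))"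
  have \<kappa>_eq: "\<kappa> = 2 powr (- p) + 1 / 2"
    by (simp add: \<kappa>_def powr_minus powr_diff powr_divide field_simps)
  have "2 powr (- p) < 2 powr (- 1 :: real)"
    using p_gt_1 by (intro powr_less_mono) auto
  then have \<kappa>: "0 \<le> \<kappa>" "\<kappa> < 1"
    unfolding \<kappa>_eq by (auto simp: powr_minus)
  have K: "0 \<le> K" by (simp add: K_def)
  have bound: "i \<le> \<kappa> * (i + e) + (1 / 2) powr p * (K * e)" if e: "0 < e" for e
  proof -
    have less: "cap j < ennreal (i + e)" for j
    proof -
      have "cap j \<le> ennreal i" unfolding i(1)[symmetric] by (rule SUP_upper) simp
      also have "\<dots> < ennreal (i + e)" using e i by (simp add: ennreal_less_iff)
      finally show ?thesis .
    qed
    have "cap j \<le> ennreal (\<kappa> * (i + e) + (1 / 2) powr p * (K * e))" for j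
    proof -
      obtain u g where u: "admissible (ball x\<^sub>0 (real j)) u g" "energy g < ennreal (i + e)"
        using bounded_condenser_capacity_lessE[OF less[of j, unfolded cap_def]] by metis
      have "g \<in> borel_measurable M" "energy g < \<infinity>"
        using u by (auto simp: admissible_def intro: measurable_M)
      from energy_tail[OF this e, of x\<^sub>0]
      obtain n :: nat where n: "(\<integral>\<^sup>+x\<in>- ball x\<^sub>0 n. ennpow (g x) p \<partial>M) < ennreal e" .
      \<comment> \<open>Large enough for the tail of \<open>g\<close> to be small and for
        \<open>ball x\<^sub>0 j\<close> to lie where \<open>v\<close> is 1. The pair
        \<open>v\<close>, \<open>h\<close> is taken for radius \<open>Suc m\<close>, since the
        gradient of \<open>v\<close> can be removed only on a ball whose radius is smaller by
        1.\<close>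
      define m where "m = max n j"
      have "(\<integral>\<^sup>+x\<in>- ball x\<^sub>0 m. ennpow (g x) p \<partial>M) \<le> (\<integral>\<^sup>+x\<in>- ball x\<^sub>0 n. ennpow (g x) p \<partial>M)"
        by (intro nn_integral_mono) (auto simp: indicator_def m_def)
      then have m: "(\<integral>\<^sup>+x\<in>- ball x\<^sub>0 m. ennpow (g x) p \<partial>M) \<le> ennreal e"
        using n by simp
      obtain v h where v: "admissible (ball x\<^sub>0 (real (Suc m))) v h" "energy h < ennreal (i + e)"
        using bounded_condenser_capacity_lessE[OF less[of "Suc m", unfolded cap_def]] by metis
      have "ball x\<^sub>0 (real j) \<subseteq> ball x\<^sub>0 (real m + 1)"
        by (intro subset_ball) (simp add: m_def)
      from admissible_average_tail[OF u(1) _ this s(1), of v h] v(1)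
      obtain w k where w: "admissible (ball x\<^sub>0 (real j)) w k"
        "energy k \<le> ennreal ((1 / 2) powr p) * (energy g + ennreal K * (\<integral>\<^sup>+x\<in>- ball x\<^sub>0 m. ennpow (g x) p \<partial>M)
          + ennreal (2 powr (p - 1)) * energy h)"
        unfolding K_def s(2) by (auto simp: add.commute)
      have "cap j \<le> energy k"
        unfolding cap_def by (rule bounded_condenser_capacity_le) fact
      also note w(2)
      also have "ennreal ((1 / 2) powr p) * (energy g + ennreal K * (\<integral>\<^sup>+x\<in>- ball x\<^sub>0 m. ennpow (g x) p \<partial>M)
          + ennreal (2 powr (p - 1)) * energy h)
          \<le> ennreal ((1 / 2) powr p) * (ennreal (i + e) + ennreal K * ennreal e + ennreal (2 powr (p - 1)) * ennreal (i + e))"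
        using u(2) v(2) m by (intro mult_left_mono add_mono) auto
      also have "\<dots> = ennreal ((1 / 2) powr p * ((i + e) + K * e + 2 powr (p - 1) * (i + e)))"
        using i e K by (simp add: ennreal_mult ennreal_plus)
      also have "(1 / 2) powr p * ((i + e) + K * e + 2 powr (p - 1) * (i + e)) = \<kappa> * (i + e) + (1 / 2) powr p * (K * e)"
        by (simp add: \<kappa>_def algebra_simps)
      finally show ?thesis .
    qed
    then have "ennreal i \<le> ennreal (\<kappa> * (i + e) + (1 / 2) powr p * (K * e))"
      unfolding i(1)[symmetric] by (intro SUP_least)
    then show ?thesis using \<kappa> K i e by (subst (asm) ennreal_le_iff) (auto intro!: add_nonneg_nonneg mult_nonneg_nonneg)
  qed
  define C where "C = \<kappa> + (1 / 2) powr p * K"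
  have C: "0 \<le> C" using \<kappa> K by (simp add: C_def)
  have "i \<le> \<kappa> * i"
  proof (rule field_le_epsilon)
    fix e :: real assume e: "0 < e"
    define d where "d = e / (C + 1)"
    have "i \<le> \<kappa> * i + C * d"
    proof -
      have "0 < d" using e C by (simp add: d_def)
      from bound[OF this] show ?thesis by (simp add: C_def algebra_simps)
    qed
    also have "C * d \<le> e" using e C by (simp add: d_def field_simps)
    finally show "i \<le> \<kappa> * i + e" by simp
  qed
  then have "(1 - \<kappa>) * i \<le> 0" by (simp add: algebra_simps)
  then have "i = 0" using \<kappa> i(2) by (simp add: mult_le_0_iff)
  then show ?thesis using i(1) by (simp add: cap_def)
qed

end

section \<open>Subsets as spaces of their own\<close>

context metric_measure
begin

text \<open>Curves in \<open>B\<close> are curves in X, and energies over \<open>B\<close> are at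
  most those over X. The Poincare inequality speaks of gradients on the dilated ball regarded as a
  space.\<close>

lemma weak_upper_gradient_restrict_space:
  assumes "weak_upper_gradient p M f g" "B \<in> sets M"
  shows "weak_upper_gradient p (restrict_space M B) f g"
proof -
  have *: "almost_every_curve p (restrict_space M B) P" if P: "aec P" for P
  proof (rule aecE[OF P])
    fix \<rho> :: "'a \<Rightarrow> ennreal"
    assume \<rho>: "\<rho> \<in> borel_measurable borel" "energy \<rho> < \<infinity>"
      "\<And>\<gamma> l. arc_length_curve UNIV \<gamma> l \<Longrightarrow> curve_integral \<rho> \<gamma> l < \<infinity> \<Longrightarrow> P \<gamma> l"
    have "(\<integral>\<^sup>+x. ennpow (\<rho> x) p \<partial>restrict_space M B) \<le> energy \<rho>"
      using assms(2) by (simp add: nn_integral_restrict_space)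
        (intro nn_integral_mono, auto simp: indicator_def)
    moreover have "curve_integral \<rho> \<gamma> l = \<infinity>"
      if "arc_length_curve (space (restrict_space M B)) \<gamma> l" "\<not> P \<gamma> l" for \<gamma> l
    proof -
      have "arc_length_curve UNIV \<gamma> l" using that(1) by (simp add: arc_length_curve_def)
      then have "\<not> curve_integral \<rho> \<gamma> l < \<infinity>" using \<rho>(3) that(2) by blast
      then show ?thesis by (simp add: less_top[symmetric])
    qed
    ultimately show ?thesis
      unfolding almost_every_curve_def using \<rho> measurable_M[OF \<rho>(1)]
      by (intro bexI[of _ \<rho>] measurable_restrict_space1) (auto intro: le_less_trans)
  qed
  show ?thesis
    using assms(1) unfolding weak_upper_gradient_def by (elim conjE) (intro conjI * measurable_restrict_space1)
qed

end

section \<open>Limits under a local Poincare inequality\<close>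

lemma tendsto_ennpow_0:
  assumes f: "(f \<longlongrightarrow> 0) F" and q: "0 < q"
  shows "((\<lambda>k. ennpow (f k) q) \<longlongrightarrow> 0) F"
proof (rule order_tendstoI)
  fix a :: ennreal assume "0 < a"
  then have "0 < ennpow a (1 / q)" using ennpow_strict_mono[of "1 / q" 0 a] q by simp
  with f have "\<forall>\<^sub>F k in F. f k < ennpow a (1 / q)" by (rule order_tendstoD)
  then show "\<forall>\<^sub>F k in F. ennpow (f k) q < a"
  proof eventually_elim
    case (elim k)
    then show ?case using ennpow_strict_mono[OF q, of "f k" "ennpow a (1 / q)"] q by (simp add: ennpow_ennpow)
  qed
qed simp

lemma ennreal_tendsto_cmult_0:
  fixes f :: "'b \<Rightarrow> ennreal"
  assumes "c < \<infinity>" "(f \<longlongrightarrow> 0) F"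
  shows "((\<lambda>k. c * f k) \<longlongrightarrow> 0) F"
  using ennreal_tendsto_cmult[of c f 0 F] assms by simp

lemma ennreal_tendsto_add_0:
  fixes f :: "'b \<Rightarrow> ennreal"
  assumes "(f \<longlongrightarrow> 0) F" "(g \<longlongrightarrow> 0) F"
  shows "((\<lambda>k. f k + g k) \<longlongrightarrow> 0) F"
  using tendsto_add[OF assms] by simp

context metric_measure
begin

text \<open>Convergence of \<open>u k - m k\<close> to 0 in L^1 on \<open>B\<close>. The constants
  depend on \<open>k\<close>, because the Poincare inequality controls only the distance to mean
  values, whose convergence is a separate matter.\<close>

definition L1_tends_on :: "'a set \<Rightarrow> (nat \<Rightarrow> 'a \<Rightarrow> real) \<Rightarrow> (nat \<Rightarrow> real) \<Rightarrow> bool" where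
  "L1_tends_on B u m \<longleftrightarrow> (\<lambda>k. \<integral>\<^sup>+y\<in>B. ennreal \<bar>u k y - m k\<bar> \<partial>M) \<longlonglongrightarrow> 0"

lemma L1_tends_on_subset:
  assumes "L1_tends_on B u m" "A \<subseteq> B"
  shows "L1_tends_on A u m"
proof -
  have "(\<integral>\<^sup>+y\<in>A. ennreal \<bar>u k y - m k\<bar> \<partial>M) \<le> (\<integral>\<^sup>+y\<in>B. ennreal \<bar>u k y - m k\<bar> \<partial>M)" for k
    using assms(2) by (intro nn_integral_mono) (auto simp: indicator_def)
  then show ?thesis
    using assms(1) unfolding L1_tends_on_def by (rule ennreal_tendsto_0_le)
qed

lemma L1_tends_on_subseq:
  "L1_tends_on B u m \<Longrightarrow> strict_mono r \<Longrightarrow> L1_tends_on B (\<lambda>k. u (r k)) (\<lambda>k. m (r k))"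
  unfolding L1_tends_on_def using LIMSEQ_subseq_LIMSEQ[of _ 0 r] by (fastforce simp: o_def)

lemma L1_tends_on_limit:
  assumes u: "\<And>k. u k \<in> borel_measurable M" and B: "B \<in> sets M" "emeasure M B < \<infinity>"
    and m: "L1_tends_on B u m" "m \<longlonglongrightarrow> c"
  shows "L1_tends_on B u (\<lambda>_. c)"
  unfolding L1_tends_on_def
proof (rule ennreal_tendsto_0_le)
  fix k
  have "(\<integral>\<^sup>+y\<in>B. ennreal \<bar>u k y - c\<bar> \<partial>M)
      \<le> (\<integral>\<^sup>+y. ennreal \<bar>u k y - m k\<bar> * indicator B y + ennreal \<bar>m k - c\<bar> * indicator B y \<partial>M)"
  proof (rule nn_integral_mono)
    fix y
    have "ennreal \<bar>u k y - c\<bar> \<le> ennreal (\<bar>u k y - m k\<bar> + \<bar>m k - c\<bar>)" by (intro ennreal_leI) auto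
    then show "ennreal \<bar>u k y - c\<bar> * indicator B y
        \<le> ennreal \<bar>u k y - m k\<bar> * indicator B y + ennreal \<bar>m k - c\<bar> * indicator B y"
      by (simp add: indicator_def)
  qed
  also have "\<dots> = (\<integral>\<^sup>+y\<in>B. ennreal \<bar>u k y - m k\<bar> \<partial>M) + emeasure M B * ennreal \<bar>m k - c\<bar>"
    using u[of k] B by (subst nn_integral_add) (auto simp: nn_integral_cmult_indicator mult.commute[of "emeasure M B"])
  finally show "(\<integral>\<^sup>+y\<in>B. ennreal \<bar>u k y - c\<bar> \<partial>M)
      \<le> (\<integral>\<^sup>+y\<in>B. ennreal \<bar>u k y - m k\<bar> \<partial>M) + emeasure M B * ennreal \<bar>m k - c\<bar>" .
next
  have "(\<lambda>k. \<bar>m k - c\<bar>) \<longlonglongrightarrow> 0"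
    using m(2) by (auto intro: tendsto_rabs_zero simp: LIM_zero_iff)
  then have "(\<lambda>k. ennreal \<bar>m k - c\<bar>) \<longlonglongrightarrow> 0"
    by (subst ennreal_tendsto_0_iff) auto
  then show "(\<lambda>k. (\<integral>\<^sup>+y\<in>B. ennreal \<bar>u k y - m k\<bar> \<partial>M) + emeasure M B * ennreal \<bar>m k - c\<bar>) \<longlonglongrightarrow> 0"
    using m(1) B by (intro ennreal_tendsto_add_0 ennreal_tendsto_cmult_0) (auto simp: L1_tends_on_def)
qed

text \<open>Integrating the triangle inequality for \<open>m k\<close>, \<open>u k\<close> and
  \<open>c\<close> over \<open>B\<close> bounds the measure of \<open>B\<close> times
  \<open>\<bar>m k - c\<bar>\<close>.\<close>

lemma L1_tends_on_unique:
  assumes u: "\<And>k. u k \<in> borel_measurable M" and B: "B \<in> sets M" "0 < emeasure M B" "emeasure M B < \<infinity>"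
    and m: "L1_tends_on B u m" and c: "L1_tends_on B u (\<lambda>_. c)"
  shows "m \<longlonglongrightarrow> c"
proof -
  obtain b where b: "emeasure M B = ennreal b" "0 < b"
    using B(2,3) by (cases "emeasure M B") auto
  have "(\<lambda>k. ennreal (b * \<bar>m k - c\<bar>)) \<longlonglongrightarrow> 0"
  proof (rule ennreal_tendsto_0_le)
    fix k
    have "ennreal (b * \<bar>m k - c\<bar>) = (\<integral>\<^sup>+y. ennreal \<bar>m k - c\<bar> * indicator B y \<partial>M)"
      using B b by (simp add: nn_integral_cmult_indicator ennreal_mult mult.commute[of "ennreal b"])
    also have "\<dots> \<le> (\<integral>\<^sup>+y. ennreal \<bar>u k y - m k\<bar> * indicator B y + ennreal \<bar>u k y - c\<bar> * indicator B y \<partial>M)"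
    proof (rule nn_integral_mono)
      fix y
      have "ennreal \<bar>m k - c\<bar> \<le> ennreal (\<bar>u k y - m k\<bar> + \<bar>u k y - c\<bar>)" by (intro ennreal_leI) auto
      then show "ennreal \<bar>m k - c\<bar> * indicator B y
          \<le> ennreal \<bar>u k y - m k\<bar> * indicator B y + ennreal \<bar>u k y - c\<bar> * indicator B y"
        by (simp add: indicator_def)
    qed
    also have "\<dots> = (\<integral>\<^sup>+y\<in>B. ennreal \<bar>u k y - m k\<bar> \<partial>M) + (\<integral>\<^sup>+y\<in>B. ennreal \<bar>u k y - c\<bar> \<partial>M)"
      using u[of k] B by (intro nn_integral_add) auto
    finally show "ennreal (b * \<bar>m k - c\<bar>) \<le> \<dots>" .
  next
    show "(\<lambda>k. (\<integral>\<^sup>+y\<in>B. ennreal \<bar>u k y - m k\<bar> \<partial>M) + (\<integral>\<^sup>+y\<in>B. ennreal \<bar>u k y - c\<bar> \<partial>M)) \<longlonglongrightarrow> 0"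
      using m c by (intro ennreal_tendsto_add_0) (auto simp: L1_tends_on_def)
  qed
  then have "(\<lambda>k. b * \<bar>m k - c\<bar>) \<longlonglongrightarrow> 0"
    using b by (subst (asm) ennreal_tendsto_0_iff) auto
  then have "(\<lambda>k. (1 / b) * (b * \<bar>m k - c\<bar>)) \<longlonglongrightarrow> (1 / b) * 0"
    by (rule tendsto_mult_left)
  then have "(\<lambda>k. \<bar>m k - c\<bar>) \<longlonglongrightarrow> 0" using b by simp
  then show ?thesis by (simp add: tendsto_rabs_zero_iff LIM_zero_iff)
qed

text \<open>Chebyshev's inequality. This is the form in which the truncations use L^1
  convergence.\<close>

lemma L1_tends_on_measure:
  assumes u: "\<And>k. u k \<in> borel_measurable M" and B: "B \<in> sets M"
    and c: "L1_tends_on B u (\<lambda>_. c)" and t: "0 < t"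
  shows "(\<lambda>k. emeasure M {y \<in> B. t < \<bar>u k y - c\<bar>}) \<longlonglongrightarrow> 0"
proof (rule ennreal_tendsto_0_le)
  fix k
  note [measurable] = u[of k] B
  have S: "{y \<in> B. t < \<bar>u k y - c\<bar>} \<in> sets M"
    by measurable
  have "emeasure M {y \<in> B. t < \<bar>u k y - c\<bar>} = (\<integral>\<^sup>+y. indicator {y \<in> B. t < \<bar>u k y - c\<bar>} y \<partial>M)"
    using S by simp
  also have "\<dots> \<le> (\<integral>\<^sup>+y. ennreal (1 / t) * (ennreal \<bar>u k y - c\<bar> * indicator B y) \<partial>M)"
  proof (rule nn_integral_mono)
    fix y
    show "indicator {y \<in> B. t < \<bar>u k y - c\<bar>} y \<le> ennreal (1 / t) * (ennreal \<bar>u k y - c\<bar> * indicator B y)"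
    proof (cases "y \<in> B \<and> t < \<bar>u k y - c\<bar>")
      case True
      then have "1 \<le> ennreal (1 / t * \<bar>u k y - c\<bar>)"
        using t by (simp add: field_simps)
      also have "\<dots> = ennreal (1 / t) * ennreal \<bar>u k y - c\<bar>"
        using t by (intro ennreal_mult) auto
      finally show ?thesis using True by simp
    qed auto
  qed
  also have "\<dots> = ennreal (1 / t) * (\<integral>\<^sup>+y\<in>B. ennreal \<bar>u k y - c\<bar> \<partial>M)"
    using u[of k] B by (intro nn_integral_cmult) auto
  finally show "emeasure M {y \<in> B. t < \<bar>u k y - c\<bar>} \<le> ennreal (1 / t) * (\<integral>\<^sup>+y\<in>B. ennreal \<bar>u k y - c\<bar> \<partial>M)" .
next
  show "(\<lambda>k. ennreal (1 / t) * (\<integral>\<^sup>+y\<in>B. ennreal \<bar>u k y - c\<bar> \<partial>M)) \<longlonglongrightarrow> 0"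
    using c unfolding L1_tends_on_def by (intro ennreal_tendsto_cmult_0) auto
qed

text \<open>The inequality is applied to the single ball \<open>ball z \<rho>\<close>, and the
  energy over the dilated ball is at most the total energy, which tends to 0.\<close>

lemma poincare_L1_tends_on:
  assumes P: "poincare_within p M (ball z \<rho>)" and \<rho>: "0 < \<rho>"
    and u: "\<And>k. u k \<in> borel_measurable M" "\<And>k x. 0 \<le> u k x \<and> u k x \<le> 1"
    and g: "\<And>k. weak_upper_gradient p M (\<lambda>x. ereal (u k x)) (g k)" "(\<lambda>k. energy (g k)) \<longlonglongrightarrow> 0"
  obtains m where "L1_tends_on (ball z \<rho>) u m" "\<And>k. m k \<in> {0..1}"
proof -
  obtain C \<tau> :: real where C: "0 < C" "1 \<le> \<tau>"
    and PI: "\<And>u g. u \<in> borel_measurable (restrict_space M (ball z (\<tau> * \<rho>))) \<Longrightarrow>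
      (\<integral>\<^sup>+y\<in>ball z (\<tau> * \<rho>). e2ennreal \<bar>u y\<bar> \<partial>M) < \<infinity> \<Longrightarrow>
      weak_upper_gradient p (restrict_space M (ball z (\<tau> * \<rho>))) u g \<Longrightarrow>
      (\<integral>\<^sup>+y\<in>ball z \<rho>. e2ennreal \<bar>u y - ereal (mean_value M (ball z \<rho>) u)\<bar> \<partial>M) / emeasure M (ball z \<rho>)
      \<le> ennreal (C * \<rho>) * ennpow ((\<integral>\<^sup>+y\<in>ball z (\<tau> * \<rho>). ennpow (g y) p \<partial>M) / emeasure M (ball z (\<tau> * \<rho>))) (1 / p)"
    using P \<rho> unfolding poincare_within_def by blast
  let ?B = "ball z \<rho>" and ?B' = "ball z (\<tau> * \<rho>)"
  define \<mu> where "\<mu> k = mean_value M ?B (\<lambda>x. ereal (u k x))" for k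
  obtain b where b: "emeasure M ?B = ennreal b" "0 < b"
    using emeasure_ball_pos[OF \<rho>, of z] emeasure_ball_less_top[of z \<rho>] by (cases "emeasure M ?B") auto
  obtain b' where b': "emeasure M ?B' = ennreal b'" "0 < b'"
    using emeasure_ball_pos[of "\<tau> * \<rho>" z] emeasure_ball_less_top[of z "\<tau> * \<rho>"] C \<rho>
    by (cases "emeasure M ?B'") auto
  define Y where "Y k = ennreal b * (ennreal (C * \<rho>) * ennpow (ennreal (1 / b') * energy (g k)) (1 / p))" for k
  have Y: "Y \<longlonglongrightarrow> 0"
    unfolding Y_def using g(2) by (intro ennreal_tendsto_cmult_0 tendsto_ennpow_0) auto
  have le_Y: "(\<integral>\<^sup>+y\<in>?B. ennreal \<bar>u k y - \<mu> k\<bar> \<partial>M) \<le> Y k" for k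
  proof -
    let ?X = "\<integral>\<^sup>+y\<in>?B. ennreal \<bar>u k y - \<mu> k\<bar> \<partial>M"
    have "(\<integral>\<^sup>+y\<in>?B'. e2ennreal \<bar>ereal (u k y)\<bar> \<partial>M) \<le> (\<integral>\<^sup>+y. indicator ?B' y \<partial>M)"
      using u(2) by (intro nn_integral_mono) (auto simp: indicator_def simp flip: ennreal.abs_eq)
    also have "\<dots> < \<infinity>" using emeasure_ball_less_top by simp
    finally have "(\<integral>\<^sup>+y\<in>?B'. e2ennreal \<bar>ereal (u k y)\<bar> \<partial>M) < \<infinity>" .
    moreover have "(\<lambda>x. ereal (u k x)) \<in> borel_measurable (restrict_space M ?B')"
      using u(1) by (intro measurable_restrict_space1 borel_measurable_ereal)
    moreover have "weak_upper_gradient p (restrict_space M ?B') (\<lambda>x. ereal (u k x)) (g k)"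
      using g(1) by (intro weak_upper_gradient_restrict_space) auto
    ultimately have "?X / ennreal b \<le> ennreal (C * \<rho>) * ennpow ((\<integral>\<^sup>+y\<in>?B'. ennpow (g k y) p \<partial>M) / ennreal b') (1 / p)"
      using PI[of "\<lambda>x. ereal (u k x)" "g k"] by (simp add: b b' \<mu>_def flip: ennreal.abs_eq)
    also have "\<dots> \<le> ennreal (C * \<rho>) * ennpow (ennreal (1 / b') * energy (g k)) (1 / p)"
    proof (intro mult_left_mono ennpow_mono)
      have "(\<integral>\<^sup>+y\<in>?B'. ennpow (g k y) p \<partial>M) / ennreal b' = ennreal (1 / b') * (\<integral>\<^sup>+y\<in>?B'. ennpow (g k y) p \<partial>M)"
        using b' by (simp add: divide_ennreal_def inverse_ennreal mult.commute inverse_eq_divide)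
      also have "\<dots> \<le> ennreal (1 / b') * energy (g k)"
        by (intro mult_left_mono nn_integral_mono) (auto simp: indicator_def)
      finally show "(\<integral>\<^sup>+y\<in>?B'. ennpow (g k y) p \<partial>M) / ennreal b' \<le> ennreal (1 / b') * energy (g k)" .
    qed auto
    finally have "ennreal b * (?X / ennreal b) \<le> Y k"
      unfolding Y_def by (rule mult_left_mono) simp
    also have "ennreal b * (?X / ennreal b) = ?X * (ennreal b / ennreal b)"
      by (subst mult.commute) (rule ennreal_divide_times)
    also have "\<dots> = ?X" using b by simp
    finally show ?thesis .
  qed
  \<comment> \<open>Clamping the mean values to \<open>[0,1]\<close> moves them no farther from
    \<open>u k\<close>, whose values lie there, and makes a convergent subsequence
    available.\<close>
  define m where "m k = max 0 (min 1 (\<mu> k))" for k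
  have "L1_tends_on ?B u m"
    unfolding L1_tends_on_def
  proof (rule ennreal_tendsto_0_le[OF _ Y])
    fix k
    have "(\<integral>\<^sup>+y\<in>?B. ennreal \<bar>u k y - m k\<bar> \<partial>M) \<le> (\<integral>\<^sup>+y\<in>?B. ennreal \<bar>u k y - \<mu> k\<bar> \<partial>M)"
    proof (intro nn_integral_mono mult_right_mono ennreal_leI)
      fix y show "\<bar>u k y - m k\<bar> \<le> \<bar>u k y - \<mu> k\<bar>"
        using u(2)[of k y] by (auto simp: m_def)
    qed simp
    then show "(\<integral>\<^sup>+y\<in>?B. ennreal \<bar>u k y - m k\<bar> \<partial>M) \<le> Y k"
      using le_Y[of k] by simp
  qed
  then show ?thesis using that[of m] by (auto simp: m_def)
qed

end

context proper_metric_measure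
begin

text \<open>The subsequence is chosen once, for the constants at \<open>x\<^sub>0\<close>. The set
  \<open>S\<close> of points near which the limit is \<open>c\<close> is open. It is also closed: if
  the ball of the Poincare inequality about \<open>z\<close> meets \<open>S\<close>, then its
  constants tend to \<open>c\<close> by comparison on the overlap, and \<open>c\<close> is the limit
  on that whole ball. By connectedness \<open>S\<close> is X, and finite covers give all
  balls.\<close>

lemma L1_tends_constant:
  fixes x\<^sub>0 :: 'a
  assumes conn: "connected (UNIV :: 'a set)" and P: "locally_poincare p M"
    and u: "\<And>k. u k \<in> borel_measurable M" "\<And>k x. 0 \<le> u k x \<and> u k x \<le> 1"
    and g: "\<And>k. weak_upper_gradient p M (\<lambda>x. ereal (u k x)) (g k)" "(\<lambda>k. energy (g k)) \<longlonglongrightarrow> 0"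
  obtains r c where "strict_mono r" "c \<in> {0..1}" "\<And>R. L1_tends_on (ball x\<^sub>0 R) (\<lambda>k. u (r k)) (\<lambda>_. c)"
proof -
  have loc: "\<exists>\<rho> m. 0 < \<rho> \<and> L1_tends_on (ball z \<rho>) u m \<and> (\<forall>k. m k \<in> {0..1})" for z
  proof -
    obtain \<rho> where "0 < \<rho>" "poincare_within p M (ball z \<rho>)"
      using P unfolding locally_poincare_def by blast
    then show ?thesis
      using poincare_L1_tends_on[of z \<rho> u g] u g by metis
  qed
  then obtain \<rho> m where \<rho>: "\<And>z. 0 < \<rho> z" "\<And>z. L1_tends_on (ball z (\<rho> z)) u (m z)" "\<And>z k. m z k \<in> {0..1}"
    by metis
  obtain c r where r: "c \<in> {0..1}" "strict_mono r" "(m x\<^sub>0 \<circ> r) \<longlonglongrightarrow> c"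
    using compact_Icc[of "0::real" 1] \<rho>(3)[of x\<^sub>0] unfolding compact_def by metis
  define v where "v k = u (r k)" for k
  have v: "v k \<in> borel_measurable M" for k using u by (simp add: v_def)
  have \<rho>r: "L1_tends_on (ball z (\<rho> z)) v (\<lambda>k. m z (r k))" for z
    unfolding v_def by (rule L1_tends_on_subseq[OF \<rho>(2) r(2)])
  define S where "S = {x. \<exists>s>0. L1_tends_on (ball x s) v (\<lambda>_. c)}"
  have "L1_tends_on (ball x\<^sub>0 (\<rho> x\<^sub>0)) v (\<lambda>_. c)"
    using v \<rho>r r(3) emeasure_ball_less_top by (intro L1_tends_on_limit[of v _ "\<lambda>k. m x\<^sub>0 (r k)"]) (auto simp: o_def)
  then have "x\<^sub>0 \<in> S" using \<rho>(1) by (auto simp: S_def)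
  have "open S"
    unfolding open_contains_ball
  proof
    fix x assume "x \<in> S"
    then obtain s where s: "0 < s" "L1_tends_on (ball x s) v (\<lambda>_. c)" by (auto simp: S_def)
    have "ball x s \<subseteq> S"
    proof
      fix y assume y: "y \<in> ball x s"
      then obtain t where "0 < t" "ball y t \<subseteq> ball x s"
        using open_ball open_contains_ball by metis
      then show "y \<in> S" using L1_tends_on_subset[OF s(2)] by (auto simp: S_def)
    qed
    then show "\<exists>e>0. ball x e \<subseteq> S" using s by blast
  qed
  moreover have "open (- S)"
    unfolding open_contains_ball
  proof
    fix z assume z: "z \<in> - S"
    have "ball z (\<rho> z) \<subseteq> - S"
    proof (rule ccontr)
      assume "\<not> ball z (\<rho> z) \<subseteq> - S"
      then obtain y where y: "y \<in> ball z (\<rho> z)" "y \<in> S" by auto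
      then obtain s where s: "0 < s" "L1_tends_on (ball y s) v (\<lambda>_. c)" by (auto simp: S_def)
      obtain t where t: "0 < t" "ball y t \<subseteq> ball z (\<rho> z)"
        using y(1) open_ball open_contains_ball by metis
      let ?B = "ball y (min s t)"
      have B: "?B \<subseteq> ball y s" "?B \<subseteq> ball z (\<rho> z)" using t by auto
      have "(\<lambda>k. m z (r k)) \<longlonglongrightarrow> c"
        using v emeasure_ball_pos[of "min s t" y] s t emeasure_ball_less_top
          L1_tends_on_subset[OF \<rho>r B(2)] L1_tends_on_subset[OF s(2) B(1)]
        by (intro L1_tends_on_unique[of v ?B]) auto
      then have "L1_tends_on (ball z (\<rho> z)) v (\<lambda>_. c)"
        using v \<rho>r emeasure_ball_less_top by (intro L1_tends_on_limit[of v _ "\<lambda>k. m z (r k)"]) auto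
      then show False using z \<rho>(1)[of z] by (auto simp: S_def)
    qed
    then show "\<exists>e>0. ball z e \<subseteq> - S" using \<rho>(1) by blast
  qed
  ultimately have "S = {} \<or> S = UNIV"
    using conn by (simp add: connected_clopen closed_def)
  then have "S = UNIV" using \<open>x\<^sub>0 \<in> S\<close> by auto
  then have "\<forall>x. \<exists>s>0. L1_tends_on (ball x s) v (\<lambda>_. c)" by (auto simp: S_def)
  then obtain s where s: "\<And>x. 0 < s x" "\<And>x. L1_tends_on (ball x (s x)) v (\<lambda>_. c)" by metis
  have "L1_tends_on (ball x\<^sub>0 R) v (\<lambda>_. c)" for R
  proof -
    have "compact (cball x\<^sub>0 R)" by (intro proper) auto
    moreover have "cball x\<^sub>0 R \<subseteq> (\<Union>y\<in>cball x\<^sub>0 R. ball y (s y))"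
      using s(1) by (auto intro!: bexI centre_in_ball[THEN iffD2])
    ultimately obtain D where D: "finite D" "cball x\<^sub>0 R \<subseteq> (\<Union>y\<in>D. ball y (s y))"
      by (rule compactE_image[OF _ open_ball]) simp
    have "(\<lambda>k. \<Sum>y\<in>D. \<integral>\<^sup>+z\<in>ball y (s y). ennreal \<bar>v k z - c\<bar> \<partial>M) \<longlonglongrightarrow> (\<Sum>y\<in>D. 0)"
      using s(2) by (intro tendsto_sum) (simp add: L1_tends_on_def)
    then have lim: "(\<lambda>k. \<Sum>y\<in>D. \<integral>\<^sup>+z\<in>ball y (s y). ennreal \<bar>v k z - c\<bar> \<partial>M) \<longlonglongrightarrow> 0" by simp
    show ?thesis unfolding L1_tends_on_def
    proof (rule ennreal_tendsto_0_le[OF _ lim])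
      fix k
      have "(\<integral>\<^sup>+z\<in>ball x\<^sub>0 R. ennreal \<bar>v k z - c\<bar> \<partial>M)
          \<le> (\<integral>\<^sup>+z. (\<Sum>y\<in>D. ennreal \<bar>v k z - c\<bar> * indicator (ball y (s y)) z) \<partial>M)"
      proof (rule nn_integral_mono)
        fix z
        show "ennreal \<bar>v k z - c\<bar> * indicator (ball x\<^sub>0 R) z
            \<le> (\<Sum>y\<in>D. ennreal \<bar>v k z - c\<bar> * indicator (ball y (s y)) z)"
        proof (cases "z \<in> ball x\<^sub>0 R")
          case True
          then have "z \<in> cball x\<^sub>0 R" by simp
          with D(2) obtain y where y: "y \<in> D" "z \<in> ball y (s y)" by blast
          then have "ennreal \<bar>v k z - c\<bar> * indicator (ball x\<^sub>0 R) z \<le> ennreal \<bar>v k z - c\<bar> * indicator (ball y (s y)) z"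
            by (simp add: indicator_def)
          also have "\<dots> \<le> (\<Sum>y\<in>D. ennreal \<bar>v k z - c\<bar> * indicator (ball y (s y)) z)"
            by (rule member_le_sum[OF y(1) _ D(1)]) simp
          finally show ?thesis .
        qed simp
      qed
      also have "\<dots> = (\<Sum>y\<in>D. \<integral>\<^sup>+z\<in>ball y (s y). ennreal \<bar>v k z - c\<bar> \<partial>M)"
        using v[of k] by (intro nn_integral_sum) auto
      finally show "(\<integral>\<^sup>+z\<in>ball x\<^sub>0 R. ennreal \<bar>v k z - c\<bar> \<partial>M)
          \<le> (\<Sum>y\<in>D. \<integral>\<^sup>+z\<in>ball y (s y). ennreal \<bar>v k z - c\<bar> \<partial>M)" .
    qed
  qed
  moreover have "v = (\<lambda>k. u (r k))" by (simp add: v_def fun_eq_iff)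
  ultimately show ?thesis by (intro that[OF r(2,1)]) simp
qed

end

section \<open>Sets of zero capacity\<close>

definition cutoff :: "'a::metric_space \<Rightarrow> real \<Rightarrow> 'a \<Rightarrow> real" where
  "cutoff x\<^sub>0 R x = max 0 (min 1 (R + 1 - dist x\<^sub>0 x))"

lemma cutoff_bounds: "0 \<le> cutoff x\<^sub>0 R x" "cutoff x\<^sub>0 R x \<le> 1"
  by (auto simp: cutoff_def)

lemma cutoff_eq_1: "x \<in> ball x\<^sub>0 R \<Longrightarrow> cutoff x\<^sub>0 R x = 1"
  by (simp add: cutoff_def)

lemma cutoff_eq_0: "x \<notin> ball x\<^sub>0 (R + 1) \<Longrightarrow> cutoff x\<^sub>0 R x = 0"
  by (simp add: cutoff_def)

lemma cutoff_lipschitz: "\<bar>cutoff x\<^sub>0 R x - cutoff x\<^sub>0 R y\<bar> \<le> dist x y"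
  using dist_triangle[of x\<^sub>0 x y] dist_triangle[of x\<^sub>0 y x] by (auto simp: cutoff_def dist_commute)

lemma borel_measurable_cutoff: "cutoff x\<^sub>0 R \<in> borel_measurable borel"
  unfolding cutoff_def by (intro borel_measurable_continuous_onI continuous_intros)

context metric_measure
begin

lemma energy_truncation_le:
  assumes "g \<in> borel_measurable borel" "S \<in> sets borel" "0 < a"
  shows "energy (\<lambda>x. ennreal a * g x + indicator S x)
    \<le> ennreal (2 powr p) * (ennreal (a powr p) * energy g + emeasure M S)"
proof -
  have [measurable]: "g \<in> borel_measurable M" "S \<in> sets M"
    using assms by (auto intro: measurable_M sets_M)
  have "energy (\<lambda>x. ennreal a * g x + indicator S x)
      \<le> (\<integral>\<^sup>+x. ennreal (2 powr p) * (ennreal (a powr p) * ennpow (g x) p + indicator S x) \<partial>M)"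
  proof (rule nn_integral_mono)
    fix x
    show "ennpow (ennreal a * g x + indicator S x) p \<le> ennreal (2 powr p) * (ennreal (a powr p) * ennpow (g x) p + indicator S x)"
      using ennpow_add_le[of p 1 "ennreal a * g x" "indicator S x"] assms
      by (simp add: ennpow_cmult ennpow_indicator distrib_left)
  qed
  also have "\<dots> = ennreal (2 powr p) * (ennreal (a powr p) * energy g + emeasure M S)"
    by (simp add: nn_integral_cmult nn_integral_add)
  finally show ?thesis .
qed

lemma weak_upper_gradient_one_minus:
  "weak_upper_gradient p M (\<lambda>x. ereal (1 - u x)) g \<longleftrightarrow> weak_upper_gradient p M (\<lambda>x. ereal (u x)) g"
  unfolding weak_upper_gradient_real by (simp add: abs_minus_commute)

end

section \<open>The cases of limit 1 and limit less than 1\<close>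

context proper_metric_measure
begin

text \<open>Passing to \<open>1 - u k\<close> turns the maximum with the cutoff into a minimum with
  its complement, so that one truncation lemma serves both cases. The cutoff provides the value 1 on
  \<open>K\<close>; its cost is confined to the points of a ball where \<open>u k < 3 / 4\<close>, a
  set whose measure tends to 0.\<close>

lemma compact_capacity_0_if_limit_1:
  assumes u: "\<And>k. admissible (E k) (u k) (g k)" and g: "(\<lambda>k. energy (g k)) \<longlonglongrightarrow> 0"
    and lim: "\<And>R. L1_tends_on (ball x\<^sub>0 R) u (\<lambda>_. 1)" and K: "compact K"
  shows "condenser_capacity p M K UNIV = 0"
proof -
  note u' = u[unfolded admissible_def]
  have u_meas [measurable]: "u k \<in> borel_measurable M" for k using u' by blast
  have u_bounds: "0 \<le> u k x" "u k x \<le> 1" for k x using u' by blast+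
  obtain R where R: "K \<subseteq> ball x\<^sub>0 R" "0 < R"
    using bounded_subset_ballD[OF compact_imp_bounded[OF K]] by metis
  \<comment> \<open>\<open>1 / 4\<close> leaves a gap below the truncation level
    \<open>1 / 2\<close>. The complement of the cutoff is constant off
    \<open>ball x\<^sub>0 (R + 1)\<close>, and the truncation lemma asks for control on a ball
    larger by 1, hence \<open>R + 2\<close>.\<close>
  define A where "A k = {x \<in> ball x\<^sub>0 (R + 2). 1 / 4 < 1 - u k x}" for k
  have A_meas: "A k \<in> sets M" for k
    unfolding A_def by measurable
  have A_lim: "(\<lambda>k. emeasure M (A k)) \<longlonglongrightarrow> 0"
  proof (rule ennreal_tendsto_0_le)
    show "emeasure M (A k) \<le> emeasure M {y \<in> ball x\<^sub>0 (R + 2). 1 / 4 < \<bar>u k y - 1\<bar>}" for k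
    proof (rule emeasure_mono)
      show "{y \<in> ball x\<^sub>0 (R + 2). 1 / 4 < \<bar>u k y - 1\<bar>} \<in> sets M" by measurable
    qed (auto simp: A_def)
    show "(\<lambda>k. emeasure M {y \<in> ball x\<^sub>0 (R + 2). 1 / 4 < \<bar>u k y - 1\<bar>}) \<longlonglongrightarrow> 0"
      using lim by (intro L1_tends_on_measure) auto
  qed
  have "bounded_condenser_capacity p M K UNIV
      \<le> ennreal (2 powr p) * (ennreal (2 powr p) * energy (g k) + emeasure M (A k))" for k
  proof -
    obtain S where S: "S \<in> sets borel" "A k \<subseteq> S" "emeasure M S = emeasure M (A k)"
      using borel_outer_approx[OF A_meas] by metis
    define v where "v x = min (max 0 ((1 - u k x - 1 / 2) / (1 - 1 / 2))) (1 - cutoff x\<^sub>0 R x)" for x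
    define G where "G x = ennreal 2 * g k x + indicator S x" for x
    have "weak_upper_gradient p M (\<lambda>x. ereal (v x)) (\<lambda>x. ennreal (1 / (1 - 1 / 2)) * g k x + indicator S x)"
      unfolding v_def
    proof (rule weak_upper_gradient_truncation[where c = "1 / 4" and x\<^sub>0 = x\<^sub>0 and R = "R + 1" and e = 1])
      show "weak_upper_gradient p M (\<lambda>x. ereal (1 - u k x)) (g k)"
        using u' by (simp add: weak_upper_gradient_one_minus)
      show "\<bar>1 - cutoff x\<^sub>0 R x - (1 - cutoff x\<^sub>0 R y)\<bar> \<le> dist x y" for x y
        using cutoff_lipschitz[of x\<^sub>0 R y x] by (simp add: dist_commute)
    qed (use u' S cutoff_bounds in \<open>auto simp: A_def cutoff_eq_0\<close>)
    then have wug: "weak_upper_gradient p M (\<lambda>x. ereal (1 - v x)) G"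
      by (simp add: weak_upper_gradient_one_minus G_def[abs_def])
    have G_meas: "G \<in> borel_measurable borel"
      unfolding G_def using u'[of k] S by (intro borel_measurable_add borel_measurable_times) auto
    have energy_G: "energy G \<le> ennreal (2 powr p) * (ennreal (2 powr p) * energy (g k) + emeasure M (A k))"
      unfolding G_def S(3)[symmetric] using u' S by (intro energy_truncation_le) auto
    have "emeasure M (A k) \<le> emeasure M (ball x\<^sub>0 (R + 2))"
      by (rule emeasure_mono) (auto simp: A_def)
    then have "emeasure M (A k) < \<infinity>"
      using emeasure_ball_less_top by (rule le_less_trans)
    then have "energy G < \<infinity>"
      using u' by (intro le_less_trans[OF energy_G]) (auto simp: ennreal_mult_less_top)
    moreover have "energy (\<lambda>x. ennreal (1 - v x)) < \<infinity>"
    proof -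
      have "energy (\<lambda>x. ennreal (1 - v x)) \<le> (\<integral>\<^sup>+x. ennreal (2 powr p) * ennpow (ennreal (u k x)) p + indicator (ball x\<^sub>0 (R + 1)) x \<partial>M)"
      proof (rule nn_integral_mono)
        fix x
        show "ennpow (ennreal (1 - v x)) p \<le> ennreal (2 powr p) * ennpow (ennreal (u k x)) p + indicator (ball x\<^sub>0 (R + 1)) x"
        proof (cases "x \<in> ball x\<^sub>0 (R + 1)")
          case True
          have "ennpow (ennreal (1 - v x)) p \<le> ennpow 1 p"
            using u_bounds[of k x] cutoff_bounds[of x\<^sub>0 R x] by (intro ennpow_mono) (auto simp: v_def)
          then show ?thesis using True by (simp add: add_increasing)
        next
          case False
          \<comment> \<open>Off this ball the cutoff vanishes and \<open>1 - v x\<close> is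
            \<open>min 1 (2 * u k x)\<close>, so its norm is controlled by that of
            \<open>u k\<close>.\<close>
          have "1 - v x \<le> 2 * u k x"
            using u_bounds[of k x] False by (auto simp: v_def cutoff_eq_0)
          then have "ennreal (1 - v x) \<le> ennreal (2 * u k x)"
            by (rule ennreal_leI)
          also have "\<dots> = ennreal 2 * ennreal (u k x)"
            using u_bounds[of k x] by (intro ennreal_mult) auto
          finally have "ennpow (ennreal (1 - v x)) p \<le> ennpow (ennreal 2 * ennreal (u k x)) p"
            by (intro ennpow_mono) auto
          then show ?thesis by (subst (asm) ennpow_cmult) (auto simp: add_increasing2)
        qed
      qed
      also have "\<dots> = ennreal (2 powr p) * energy (\<lambda>x. ennreal (u k x)) + emeasure M (ball x\<^sub>0 (R + 1))"
        by (simp add: nn_integral_cmult nn_integral_add)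
      also have "\<dots> < \<infinity>"
        using u'[of k] emeasure_ball_less_top by (auto simp: ennreal_mult_less_top)
      finally show ?thesis .
    qed
    moreover have "1 - v x = 1" if "x \<in> K" for x
      using that R u_bounds[of k x] cutoff_eq_1[of x x\<^sub>0 R] by (auto simp: v_def)
    moreover have "0 \<le> 1 - v x \<and> 1 - v x \<le> 1" for x
      using u_bounds[of k x] cutoff_bounds[of x\<^sub>0 R x] by (auto simp: v_def)
    moreover have "(\<lambda>x. 1 - v x) \<in> borel_measurable M"
      unfolding v_def using measurable_M[OF borel_measurable_cutoff[of x\<^sub>0 R]] by measurable
    ultimately have "admissible K (\<lambda>x. 1 - v x) G"
      using wug G_meas by (simp add: admissible_def)
    then show ?thesis
      using energy_G bounded_condenser_capacity_le by (blast intro: order_trans)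
  qed
  moreover have "(\<lambda>k. ennreal (2 powr p) * (ennreal (2 powr p) * energy (g k) + emeasure M (A k))) \<longlonglongrightarrow> 0"
    using g A_lim by (intro ennreal_tendsto_cmult_0 ennreal_tendsto_add_0) auto
  ultimately have "bounded_condenser_capacity p M K UNIV \<le> 0"
    by (intro LIMSEQ_le_const) auto
  then show ?thesis using compact_imp_bounded[OF K] by (simp add: condenser_capacity_def)
qed

text \<open>The truncation takes values in \<open>[0,1]\<close> and vanishes off \<open>A k\<close>.
  So the small measure of \<open>A k\<close> bounds the integral of its p-th power as well as the
  cost of the cutoff, and the whole Sobolev norm becomes small.\<close>

lemma admissible_small_if_limit_less_1:
  assumes u: "\<And>k. admissible (E \<inter> ball x\<^sub>0 (real k)) (u k) (g k)" and g: "(\<lambda>k. energy (g k)) \<longlonglongrightarrow> 0"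
    and r: "strict_mono r"
    and lim: "\<And>R. L1_tends_on (ball x\<^sub>0 R) (\<lambda>k. u (r k)) (\<lambda>_. c)" and c: "0 \<le> c" "c < 1" and e: "0 < e"
  obtains v G where "admissible (E \<inter> ball x\<^sub>0 (real j)) v G" "energy (\<lambda>x. ennreal (v x)) < ennreal e" "energy G < ennreal e"
proof -
  note u' = u[unfolded admissible_def]
  have u_meas [measurable]: "u k \<in> borel_measurable M" for k using u' by blast
  have u_bounds: "0 \<le> u k x" "u k x \<le> 1" for k x using u' by blast+
  \<comment> \<open>Three equal steps from \<open>c\<close> to 1: the part above
    \<open>c + d\<close> has small measure, the truncation level is \<open>c + 2 * d\<close>, and
    the value 1 on \<open>E\<close> stays above it.\<close>
  define d where "d = (1 - c) / 3"
  have d: "0 < d" "c + 2 * d < 1" using c by (auto simp: d_def field_simps)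
  define a where "a = 1 / (1 - (c + 2 * d))"
  have a: "0 < a" using d by (simp add: a_def)
  define A where "A k = {x \<in> ball x\<^sub>0 (real j + 2). c + d < u (r k) x}" for k
  have A_meas: "A k \<in> sets M" for k
    unfolding A_def by measurable
  have A_lim: "(\<lambda>k. emeasure M (A k)) \<longlonglongrightarrow> 0"
  proof (rule ennreal_tendsto_0_le)
    show "emeasure M (A k) \<le> emeasure M {y \<in> ball x\<^sub>0 (real j + 2). d < \<bar>u (r k) y - c\<bar>}" for k
    proof (rule emeasure_mono)
      show "{y \<in> ball x\<^sub>0 (real j + 2). d < \<bar>u (r k) y - c\<bar>} \<in> sets M" by measurable
    qed (auto simp: A_def)
    show "(\<lambda>k. emeasure M {y \<in> ball x\<^sub>0 (real j + 2). d < \<bar>u (r k) y - c\<bar>}) \<longlonglongrightarrow> 0"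
      using lim d by (intro L1_tends_on_measure) auto
  qed
  have "(\<lambda>k. energy (g (r k))) \<longlonglongrightarrow> 0"
    using LIMSEQ_subseq_LIMSEQ[OF g r] by (simp add: o_def)
  then have "(\<lambda>k. ennreal (2 powr p) * (ennreal (a powr p) * energy (g (r k)) + emeasure M (A k))) \<longlonglongrightarrow> 0"
    using A_lim by (intro ennreal_tendsto_cmult_0 ennreal_tendsto_add_0) auto
  then have "\<forall>\<^sub>F k in sequentially. ennreal (2 powr p) * (ennreal (a powr p) * energy (g (r k)) + emeasure M (A k)) < ennreal e"
    using e by (intro order_tendstoD(2)) auto
  moreover have "\<forall>\<^sub>F k in sequentially. emeasure M (A k) < ennreal e"
    using A_lim e by (intro order_tendstoD(2)) auto
  ultimately have "\<forall>\<^sub>F k in sequentially. j \<le> k \<and> emeasure M (A k) < ennreal e \<and>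
      ennreal (2 powr p) * (ennreal (a powr p) * energy (g (r k)) + emeasure M (A k)) < ennreal e"
    using eventually_ge_at_top[of j] by eventually_elim auto
  then obtain k where k: "j \<le> k" "emeasure M (A k) < ennreal e"
      "ennreal (2 powr p) * (ennreal (a powr p) * energy (g (r k)) + emeasure M (A k)) < ennreal e"
    by (auto simp: eventually_sequentially)
  have jr: "j \<le> r k" using k(1) seq_suble[OF r, of k] by simp
  obtain S where S: "S \<in> sets borel" "A k \<subseteq> S" "emeasure M S = emeasure M (A k)"
    using borel_outer_approx[OF A_meas] by metis
  define v where "v x = min (max 0 ((u (r k) x - (c + 2 * d)) / (1 - (c + 2 * d)))) (cutoff x\<^sub>0 j x)" for x
  define G where "G x = ennreal a * g (r k) x + indicator S x" for x
  have wug: "weak_upper_gradient p M (\<lambda>x. ereal (v x)) G"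
    unfolding v_def G_def a_def
    by (rule weak_upper_gradient_truncation[where c = "c + d" and x\<^sub>0 = x\<^sub>0 and R = "real j + 1" and e = 0])
      (use u' S d cutoff_bounds cutoff_lipschitz in \<open>auto simp: A_def cutoff_eq_0\<close>)
  have G_meas: "G \<in> borel_measurable borel"
    unfolding G_def using u'[of "r k"] S by (intro borel_measurable_add borel_measurable_times) auto
  have "energy G \<le> ennreal (2 powr p) * (ennreal (a powr p) * energy (g (r k)) + emeasure M (A k))"
    unfolding G_def S(3)[symmetric] using u' S a by (intro energy_truncation_le) auto
  then have energy_G: "energy G < ennreal e" using k(3) by (rule le_less_trans)
  have v_bounds: "0 \<le> v x" "v x \<le> 1" for x
    using cutoff_bounds[of x\<^sub>0 j x] by (auto simp: v_def)
  have "energy (\<lambda>x. ennreal (v x)) \<le> (\<integral>\<^sup>+x. indicator (A k) x \<partial>M)"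
  proof (rule nn_integral_mono)
    fix x
    show "ennpow (ennreal (v x)) p \<le> indicator (A k) x"
    proof (cases "x \<in> A k")
      case True
      have "ennpow (ennreal (v x)) p \<le> ennpow 1 p" using v_bounds by (intro ennpow_mono) auto
      then show ?thesis using True by simp
    next
      case False
      then consider "x \<notin> ball x\<^sub>0 (real j + 1)" | "u (r k) x \<le> c + 2 * d"
        using d by (force simp: A_def)
      then have "v x = 0"
        using cutoff_bounds[of x\<^sub>0 j x] d
        by cases (auto simp: v_def cutoff_eq_0 max_absorb1 divide_nonpos_pos)
      then show ?thesis by simp
    qed
  qed
  also have "\<dots> < ennreal e" using k(2) A_meas by simp
  finally have energy_v: "energy (\<lambda>x. ennreal (v x)) < ennreal e" .
  have "v x = 1" if "x \<in> E \<inter> ball x\<^sub>0 (real j)" for x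
  proof -
    have "x \<in> E \<inter> ball x\<^sub>0 (real (r k))" using that jr by auto
    then have "u (r k) x = 1" using u'[of "r k"] by blast
    then show ?thesis using that d cutoff_eq_1[of x x\<^sub>0 j] by (simp add: v_def)
  qed
  moreover have "v \<in> borel_measurable M"
    unfolding v_def using measurable_M[OF borel_measurable_cutoff[of x\<^sub>0 j]] by measurable
  ultimately have "admissible (E \<inter> ball x\<^sub>0 (real j)) v G"
    using wug G_meas v_bounds energy_G energy_v by (auto simp: admissible_def intro: less_trans[OF _ ennreal_less_top])
  then show ?thesis using that energy_G energy_v by blast
qed

text \<open>The supremum of the gradients is a weak upper gradient of the supremum of the functions,
  and the energies of suprema are bounded by geometric series. One half of \<open>e'\<close> is
  spent on the functions, the other on the gradients.\<close>

lemma sobolev_capacity_UN_eq_0: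
  fixes E :: "nat \<Rightarrow> 'a set"
  assumes "\<And>j e. 0 < e \<Longrightarrow> \<exists>v G. admissible (E j) v G \<and> energy (\<lambda>x. ennreal (v x)) < ennreal e \<and> energy G < ennreal e"
  shows "sobolev_capacity p M (\<Union>j. E j) = 0"
proof -
  have "sobolev_capacity p M (\<Union>j. E j) \<le> 0"
  proof (rule ennreal_le_epsilon)
    fix e' :: real assume e': "0 < e'"
    define e where "e = e' / 2"
    have e: "0 < e" using e' by (simp add: e_def)
    have "\<exists>v G. admissible (E j) v G \<and> energy (\<lambda>x. ennreal (v x)) < ennreal (e * (1 / 2) ^ Suc j) \<and>
        energy G < ennreal (e * (1 / 2) ^ Suc j)" for j
      using e by (intro assms) simp
    then obtain v G where v: "\<And>j. admissible (E j) (v j) (G j)"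
      "\<And>j. energy (\<lambda>x. ennreal (v j x)) < ennreal (e * (1 / 2) ^ Suc j)" "\<And>j. energy (G j) < ennreal (e * (1 / 2) ^ Suc j)"
      by metis
    note v' = v(1)[unfolded admissible_def]
    \<comment> \<open>The supremum is formed in \<open>ennreal\<close>, where it always exists; it
      is at most 1, so nothing is lost in the conversion.\<close>
    define V where "V x = enn2real (SUP j. ennreal (v j x))" for x
    define H where "H x = (SUP j. G j x)" for x
    have sup_le: "(SUP j. ennreal (v j x)) \<le> 1" for x
      using v' by (intro SUP_least) auto
    have V: "ennreal (V x) = (SUP j. ennreal (v j x))" for x
      unfolding V_def by (rule ennreal_enn2real) (rule le_less_trans[OF sup_le], simp)
    have V_nonneg: "0 \<le> V x" for x by (simp add: V_def)
    have v_le_V: "v j x \<le> V x" for j x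
    proof -
      have "ennreal (v j x) \<le> ennreal (V x)" unfolding V by (rule SUP_upper) simp
      then show ?thesis using V_nonneg by simp
    qed
    have V_le: "V x \<le> b" if "\<And>j. v j x \<le> b" "0 \<le> b" for x b
    proof -
      have "ennreal (V x) \<le> ennreal b" unfolding V using that by (intro SUP_least ennreal_leI)
      then show ?thesis using that(2) by simp
    qed
    have [measurable]: "G j \<in> borel_measurable borel" for j using v' by blast
    have H_meas: "H \<in> borel_measurable borel" unfolding H_def by measurable
    have "aec (\<lambda>\<gamma> l. \<forall>j. ennreal \<bar>v j (\<gamma> 0) - v j (\<gamma> l)\<bar> \<le> curve_integral (G j) \<gamma> l)"
      using v' by (intro aec_all) (simp add: weak_upper_gradient_real)
    then have "aec (\<lambda>\<gamma> l. ennreal \<bar>V (\<gamma> 0) - V (\<gamma> l)\<bar> \<le> curve_integral H \<gamma> l)"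
    proof (rule aec_mono)
      fix \<gamma> l assume *: "\<forall>j. ennreal \<bar>v j (\<gamma> 0) - v j (\<gamma> l)\<bar> \<le> curve_integral (G j) \<gamma> l"
      have le: "ennreal \<bar>v j (\<gamma> 0) - v j (\<gamma> l)\<bar> \<le> curve_integral H \<gamma> l" for j
      proof -
        have "curve_integral (G j) \<gamma> l \<le> curve_integral H \<gamma> l"
          unfolding H_def by (intro curve_integral_mono SUP_upper) simp
        then show ?thesis using * by (blast intro: order_trans)
      qed
      show "ennreal \<bar>V (\<gamma> 0) - V (\<gamma> l)\<bar> \<le> curve_integral H \<gamma> l"
      \<comment> \<open>A finite integral of \<open>H\<close> bounds the variation of all
        \<open>v j\<close> uniformly, hence that of their supremum.\<close>
      proof (cases "curve_integral H \<gamma> l")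
        case (real b)
        have b: "\<bar>v j (\<gamma> 0) - v j (\<gamma> l)\<bar> \<le> b" for j
          using le[of j] real by simp
        have "V (\<gamma> 0) \<le> V (\<gamma> l) + b"
        proof (rule V_le)
          show "v j (\<gamma> 0) \<le> V (\<gamma> l) + b" for j using b[of j] v_le_V[of j "\<gamma> l"] by linarith
        qed (use real V_nonneg in auto)
        moreover have "V (\<gamma> l) \<le> V (\<gamma> 0) + b"
        proof (rule V_le)
          show "v j (\<gamma> l) \<le> V (\<gamma> 0) + b" for j using b[of j] v_le_V[of j "\<gamma> 0"] by linarith
        qed (use real V_nonneg in auto)
        ultimately show ?thesis using real by (auto intro!: ennreal_leI)
      qed simp
    qed
    then have wug: "weak_upper_gradient p M (\<lambda>x. ereal (V x)) H"
      using measurable_M[OF H_meas] by (simp add: weak_upper_gradient_real)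
    have sum_le: "energy (\<lambda>x. SUP j. k j x) \<le> ennreal e"
      if "\<And>j. k j \<in> borel_measurable M" "\<And>j. energy (k j) < ennreal (e * (1 / 2) ^ Suc j)" for k :: "nat \<Rightarrow> 'a \<Rightarrow> ennreal"
    proof -
      have "energy (\<lambda>x. SUP j. k j x) \<le> (\<integral>\<^sup>+x. (\<Sum>j. ennpow (k j x) p) \<partial>M)"
        by (intro nn_integral_mono ennpow_SUP_le) simp
      also have "\<dots> = (\<Sum>j. energy (k j))"
        using that(1) by (intro nn_integral_suminf) measurable
      also have "\<dots> \<le> (\<Sum>j. ennreal (e * (1 / 2) ^ Suc j))"
        using that(2) by (intro suminf_le) (auto intro: less_imp_le)
      also have "\<dots> = ennreal e" using e by (intro suminf_geometric_ennreal) simp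
      finally show ?thesis .
    qed
    have energy_V: "energy (\<lambda>x. ennreal (V x)) \<le> ennreal e"
      unfolding V using v' v(2) by (intro sum_le) auto
    have energy_H: "energy H \<le> ennreal e"
      unfolding H_def using v(3) by (intro sum_le measurable_M) auto
    have norm: "sobolev_norm_pow p M (\<lambda>x. ereal (V x)) \<le> ennreal e'"
    proof -
      have "sobolev_norm_pow p M (\<lambda>x. ereal (V x)) \<le> ennreal e + ennreal e"
        using sobolev_norm_pow_real_le[OF V_nonneg wug] add_mono[OF energy_V energy_H] by (rule order_trans)
      also have "\<dots> = ennreal e'" using e by (simp add: e_def flip: ennreal_plus)
      finally show ?thesis .
    qed
    have "V \<in> borel_measurable M"
      unfolding V_def using v' by (intro borel_measurable_enn2real borel_measurable_SUP) auto
    then have "(\<lambda>x. ereal (V x)) \<in> sobolev_space p M"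
      using norm by (auto simp: sobolev_space_def intro: le_less_trans)
    moreover have "1 \<le> ereal (V x)" if "x \<in> (\<Union>j. E j)" for x
    proof -
      obtain j where "x \<in> E j" using \<open>x \<in> (\<Union>j. E j)\<close> by blast
      then have "v j x = 1" using v' by blast
      then show ?thesis using v_le_V[of j x] by simp
    qed
    ultimately have "sobolev_capacity p M (\<Union>j. E j) \<le> sobolev_norm_pow p M (\<lambda>x. ereal (V x))"
      unfolding sobolev_capacity_def by (intro INF_lower) auto
    then show "sobolev_capacity p M (\<Union>j. E j) \<le> 0 + ennreal e'"
      using norm by simp
  qed
  then show ?thesis by simp
qed

text \<open>A function that is at least 1 everywhere has norm at least the measure of a unit ball.
  It follows that X itself is one of the sets considered in (ii) and (iii).\<close>

lemma sobolev_capacity_UNIV_pos: "0 < sobolev_capacity p M UNIV"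
proof -
  fix x :: 'a
  have "emeasure M (ball x 1) \<le> sobolev_norm_pow p M f" if "\<forall>y. 1 \<le> f y" for f
  proof -
    have "emeasure M (ball x 1) = (\<integral>\<^sup>+y. indicator (ball x 1) y \<partial>M)" by simp
    also have "\<dots> \<le> (\<integral>\<^sup>+y. ennpow (e2ennreal \<bar>f y\<bar>) p \<partial>M)"
    proof (rule nn_integral_mono)
      fix y
      have "1 \<le> f y" using that by simp
      then have "1 \<le> \<bar>f y\<bar>" by (cases "f y") auto
      then have "1 \<le> e2ennreal \<bar>f y\<bar>" using e2ennreal_mono[of 1 "\<bar>f y\<bar>"] by (simp add: one_ennreal_def)
      then have "ennpow 1 p \<le> ennpow (e2ennreal \<bar>f y\<bar>) p" by (intro ennpow_mono) auto
      then show "indicator (ball x 1) y \<le> ennpow (e2ennreal \<bar>f y\<bar>) p"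
        by (auto simp: indicator_def)
    qed
    also have "\<dots> \<le> sobolev_norm_pow p M f"
      by (simp add: sobolev_norm_pow_def)
    finally show ?thesis .
  qed
  then have "emeasure M (ball x 1) \<le> sobolev_capacity p M UNIV"
    unfolding sobolev_capacity_def by (intro INF_greatest) auto
  then show ?thesis using emeasure_ball_pos[of 1 x] by simp
qed

text \<open>A bounded X lies in a ball and has finite measure, so the constant 1 with gradient 0 is
  admissible. Thus a positive condenser capacity forces X to be unbounded.\<close>

lemma condenser_capacity_eq_0_if_bounded_UNIV:
  assumes "bounded (UNIV :: 'a set)"
  shows "condenser_capacity p M E UNIV = 0"
proof -
  obtain x :: 'a and R where "UNIV \<subseteq> ball x R"
    using bounded_subset_ballD[OF assms] by blast
  then have "emeasure M UNIV < \<infinity>"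
    using emeasure_ball_less_top[of x R] by (simp add: top.extremum_unique)
  then have "admissible E (\<lambda>_. 1) (\<lambda>_. 0)"
    by (auto simp: admissible_def weak_upper_gradient_real curve_integral_def intro!: aecI[of "\<lambda>_. 0"])
  then have "bounded_condenser_capacity p M E UNIV \<le> energy (\<lambda>_. 0)"
    by (rule bounded_condenser_capacity_le)
  moreover have "bounded E" using assms bounded_subset by blast
  ultimately show ?thesis by (simp add: condenser_capacity_def)
qed

text \<open>The contrapositive of (i) implies (iii): the positive capacity of \<open>K\<close> rules
  out the limit 1, and a smaller limit makes every bounded part of \<open>E\<close>
  negligible.\<close>

lemma sobolev_capacity_eq_0:
  assumes conn: "connected (UNIV :: 'a set)" and P: "locally_poincare p M"
    and E: "condenser_capacity p M E UNIV = 0"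
    and K: "compact K" "0 < condenser_capacity p M K UNIV"
  shows "sobolev_capacity p M E = 0"
proof -
  fix x\<^sub>0 :: 'a
  \<comment> \<open>Competitors are taken for growing parts of \<open>E\<close>, since an unbounded
    \<open>E\<close> may have no competitor of finite norm.\<close>
  have "\<exists>u g. admissible (E \<inter> ball x\<^sub>0 (real k)) u g \<and> energy g < ennreal (1 / Suc k)" for k
  proof -
    have "bounded_condenser_capacity p M (E \<inter> ball x\<^sub>0 (real k)) UNIV < ennreal (1 / Suc k)"
      using bounded_condenser_capacity_ball_le[of E x\<^sub>0 k] E by simp
    then show ?thesis by (rule bounded_condenser_capacity_lessE) blast
  qed
  then obtain u g where u: "\<And>k. admissible (E \<inter> ball x\<^sub>0 (real k)) (u k) (g k)" "\<And>k. energy (g k) < ennreal (1 / Suc k)"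
    by metis
  have "(\<lambda>k. ennreal (1 / Suc k)) \<longlonglongrightarrow> 0"
    using LIMSEQ_inverse_real_of_nat by (subst ennreal_tendsto_0_iff) (auto simp: inverse_eq_divide)
  then have g: "(\<lambda>k. energy (g k)) \<longlonglongrightarrow> 0"
    using u(2) by (intro ennreal_tendsto_0_le[of "\<lambda>k. energy (g k)"]) (auto intro: less_imp_le)
  obtain r c where r: "strict_mono r" "c \<in> {0..1}" "\<And>R. L1_tends_on (ball x\<^sub>0 R) (\<lambda>k. u (r k)) (\<lambda>_. c)"
    using L1_tends_constant[OF conn P, of u g x\<^sub>0] u(1) g by (auto simp: admissible_def)
  have "c \<noteq> 1"
  proof
    assume "c = 1"
    moreover have "(\<lambda>k. energy (g (r k))) \<longlonglongrightarrow> 0"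
      using LIMSEQ_subseq_LIMSEQ[OF g r(1)] by (simp add: o_def)
    ultimately have "condenser_capacity p M K UNIV = 0"
      using u(1) r(3) K(1) by (intro compact_capacity_0_if_limit_1[of _ "\<lambda>k. u (r k)" "\<lambda>k. g (r k)" x\<^sub>0]) auto
    then show False using K(2) by simp
  qed
  then have c: "0 \<le> c" "c < 1" using r(2) by auto
  have "sobolev_capacity p M (\<Union>j. E \<inter> ball x\<^sub>0 (real j)) = 0"
    by (intro sobolev_capacity_UN_eq_0) (metis admissible_small_if_limit_less_1[OF u(1) g r(1,3) c])
  also have "(\<Union>j. E \<inter> ball x\<^sub>0 (real j)) = E"
    using reals_Archimedean2 by auto
  finally show ?thesis .
qed

text \<open>A finite capacity of X would be 0 by the averaging argument, and so would be that of
  every ball, in particular of one containing \<open>K\<close>.\<close>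

lemma condenser_capacity_UNIV_eq_top:
  assumes K: "compact K" "0 < condenser_capacity p M K UNIV"
  shows "condenser_capacity p M UNIV UNIV = \<infinity>"
proof (rule ccontr)
  assume fin: "condenser_capacity p M UNIV UNIV \<noteq> \<infinity>"
  fix x\<^sub>0 :: 'a
  have "\<not> bounded (UNIV :: 'a set)"
    using K condenser_capacity_eq_0_if_bounded_UNIV by auto
  note SUP = condenser_capacity_eq_SUP[OF this, of x\<^sub>0, unfolded Int_UNIV_left]
  have "condenser_capacity p M UNIV UNIV < \<infinity>"
    using fin by (simp add: less_top)
  then have "(SUP j::nat. bounded_condenser_capacity p M (ball x\<^sub>0 (real j)) UNIV) = 0"
    unfolding SUP by (rule SUP_capacity_ball_eq_0)
  then have zero: "bounded_condenser_capacity p M (ball x\<^sub>0 (real j)) UNIV = 0" for j :: nat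
    by (metis SUP_upper UNIV_I le_zero_eq)
  obtain R where "K \<subseteq> ball x\<^sub>0 R" using bounded_subset_ballD[OF compact_imp_bounded[OF K(1)]] by metis
  moreover obtain j :: nat where "R \<le> j" using real_arch_simple by blast
  ultimately have "K \<subseteq> ball x\<^sub>0 (real j)" by auto
  then have "bounded_condenser_capacity p M K UNIV = 0"
    using bounded_condenser_capacity_mono zero by (metis le_zero_eq)
  then show False using K(2) compact_imp_bounded[OF K(1)] by (simp add: condenser_capacity_def)
qed

end

theorem proposition6p10:
  fixes p :: real and M :: "'a::metric_space measure"
  assumes "1 < p"
    and "metric_measure_space M"
    and "\<And>S :: 'a set. closed S \<Longrightarrow> bounded S \<Longrightarrow> compact S"
    and "connected (UNIV :: 'a set)"
    and "locally_doubling M"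
    and "locally_poincare p M"
  shows "(p_hyperbolic p M \<longleftrightarrow> (\<exists>K. compact K \<and> condenser_capacity p M K UNIV > 0)) \<and>
    (p_hyperbolic p M \<longleftrightarrow>
       (\<exists>E. sobolev_capacity p M E > 0 \<and> condenser_capacity p M E UNIV > 0)) \<and>
    (p_hyperbolic p M \<longleftrightarrow>
       (\<forall>E. sobolev_capacity p M E > 0 \<longrightarrow> condenser_capacity p M E UNIV > 0)) \<and>
    (p_hyperbolic p M \<longleftrightarrow> condenser_capacity p M UNIV UNIV > 0) \<and>
    (p_hyperbolic p M \<longleftrightarrow> condenser_capacity p M UNIV UNIV = \<infinity>)"
proof -
  interpret proper_metric_measure p M
    using assms by unfold_locales auto
  let ?hyp = "\<exists>K. compact K \<and> condenser_capacity p M K UNIV > 0"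
  \<comment> \<open>Hyperbolicity includes unboundedness, which is automatic here because all
    condenser capacities vanish on a bounded space.\<close>
  have i: "p_hyperbolic p M \<longleftrightarrow> ?hyp"
    using condenser_capacity_eq_0_if_bounded_UNIV
    by (auto simp: p_hyperbolic_def p_parabolic_def zero_less_iff_neq_zero)
  have ii: "?hyp" if "condenser_capacity p M E UNIV > 0" for E
    using condenser_capacity_posE[OF that] by blast
  have iii: "condenser_capacity p M E UNIV > 0" if "?hyp" "sobolev_capacity p M E > 0" for E
    using sobolev_capacity_eq_0[OF assms(4,6), of E] that by (auto simp: zero_less_iff_neq_zero)
  have v: "condenser_capacity p M UNIV UNIV = \<infinity>" if "?hyp"
    using condenser_capacity_UNIV_eq_top that by blast
  \<comment> \<open>X has positive Sobolev capacity, so (iii) can be applied to it; for the same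
    reason it is a witness for (ii).\<close>
  have UNIV: "condenser_capacity p M UNIV UNIV > 0" if "?hyp"
    using iii[OF that sobolev_capacity_UNIV_pos] .
  have "?hyp \<longleftrightarrow> (\<exists>E. sobolev_capacity p M E > 0 \<and> condenser_capacity p M E UNIV > 0)"
    using ii UNIV sobolev_capacity_UNIV_pos by metis
  moreover have "?hyp \<longleftrightarrow> (\<forall>E. sobolev_capacity p M E > 0 \<longrightarrow> condenser_capacity p M E UNIV > 0)"
    using ii iii sobolev_capacity_UNIV_pos by metis
  moreover have "?hyp \<longleftrightarrow> condenser_capacity p M UNIV UNIV > 0"
    using ii[of UNIV] UNIV by (rule iffI[rotated])
  moreover have "?hyp \<longleftrightarrow> condenser_capacity p M UNIV UNIV = \<infinity>"
  proof
    assume "condenser_capacity p M UNIV UNIV = \<infinity>"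
    then have "condenser_capacity p M UNIV UNIV > 0" by simp
    then show ?hyp by (rule ii)
  qed (rule v)
  ultimately show ?thesis unfolding i by (intro conjI refl)
qed

end
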